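(* Let $G$ be a real Lie group with Lie algebra $\mathfrak{g}$ and $E$ a countable set with a coding map $c\colon E\to G$, $e\mapsto g_e$. Suppose that a Markov chain on $E$ is irreducible and recurrent and let $e\in E$. (i) If the Markov chain is $e$-expanding, then $\mathrm{Ad}_*\mu_e$ is uniformly expanding on Grassmannians. (ii) Suppose the Markov chain is additionally positive recurrent, with stationary distribution $\pi$, and that $c_*\pi$ has a finite first moment in $\mathfrak{g}$. Then the Markov chain is $e$-expanding if and only if $\mathrm{Ad}_*\mu_e$ is uniformly expanding on Grassmannians.
   Context: Markov chain notation: $\mathbb{P}_e$ is the Markov measure on $\Omega=E^{\mathbb{N}}$ (indices from $0$) started at $\omega_0=e$, with expectation $\mathbb{E}_e$; $\tau_e(\omega)=\inf\{n\ge1:\omega_n=e\}$. Irreducible: $\mathbb{P}_e[\tau_{e'}<\infty]>0$ for all $e,e'$. Recurrent: $\mathbb{P}_e[\tau_e<\infty]=1$ for all $e$. Positive recurrent: $\mathbb{E}_e[\tau_e]<\infty$ for all $e$. For $\omega\in\Omega$, $g_{\omega|_n}=g_{\omega_{n-1}}\cdots g_{\omega_0}$. The renewal measure $\mu_e$ is the law on $G$ of $g_{\omega|_{\tau_e}}$ under $\mathbb{P}_e$. Fix a norm on $\mathfrak{g}$ and on its exterior powers. $c_*\pi$ has a finite first moment in $\mathfrak{g}$ if $\sum_{e'\in E}\log N(g_{e'})\,\pi(\{e'\})<\infty$, where $N(g)=\max(\|\mathrm{Ad}(g)\|,\|\mathrm{Ad}(g)^{-1}\|)$. $e$-expanding: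 for every $1\le k\le\dim(G)-1$ and every non-zero pure wedge product $v\in\mathfrak{g}^{\wedge k}$, $\liminf_{n\to\infty}\frac1n\log\|\mathrm{Ad}^{\wedge k}(g_{\omega|_n})v\|>0$ for $\mathbb{P}_e$-a.e. $\omega$. For a probability measure $\mu$ on $G$, $\mathrm{Ad}_*\mu$ is uniformly expanding on Grassmannians if for every $1\le k\le\dim(G)-1$ and every non-zero pure wedge product $v\in\mathfrak{g}^{\wedge k}$, for $\mu^{\otimes\mathbb{N}}$-a.e. $b=(b_m)_{m\ge0}\in G^{\mathbb{N}}$, $\liminf_{n\to\infty}\frac1n\log\|\mathrm{Ad}^{\wedge k}(b_{n-1}\cdots b_0)v\|>0$. *)

theory Defs
  imports "HOL-Probability.Probability" "HOL-Algebra.Group"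
begin

section \<open>Lie groups\<close>

text \<open>For open \<open>S\<close> in a finite-dimensional space this is \<open>C\<^sup>n\<close> (all iterated directional
  derivatives up to order \<open>n\<close> exist and are continuous).\<close>

primrec Cn_on :: "nat \<Rightarrow> 'a::real_normed_vector set \<Rightarrow> ('a \<Rightarrow> 'b::real_normed_vector) \<Rightarrow> bool" where
  "Cn_on 0 S f \<longleftrightarrow> continuous_on S f"
| "Cn_on (Suc n) S f \<longleftrightarrow> (\<forall>x\<in>S. f differentiable (at x)) \<and>
     (\<forall>v. Cn_on n S (\<lambda>x. frechet_derivative f (at x) v))"

definition smooth_on :: "'a::real_normed_vector set \<Rightarrow> ('a \<Rightarrow> 'b::real_normed_vector) \<Rightarrow> bool" where
  "smooth_on S f \<longleftrightarrow> (\<forall>n. Cn_on n S f)"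

text \<open>A chart is a pair of its domain and a map that is only meaningful on that domain.\<close>

type_synonym ('g, 'b) chart = "'g set \<times> ('g \<Rightarrow> 'b)"

definition is_chart :: "'g topology \<Rightarrow> ('g, 'b::real_normed_vector) chart \<Rightarrow> bool" where
  "is_chart T = (\<lambda>(U, \<phi>). openin T U \<and> open (\<phi> ` U) \<and>
     homeomorphic_map (subtopology T U) (top_of_set (\<phi> ` U)) \<phi>)"

definition smooth_atlas :: "'g topology \<Rightarrow> ('g, 'b::real_normed_vector) chart set \<Rightarrow> bool" where
  "smooth_atlas T A \<longleftrightarrow>
     (\<forall>c\<in>A. is_chart T c) \<and> (\<Union>c\<in>A. fst c) = topspace T \<and>
     (\<forall>(U, \<phi>)\<in>A. \<forall>(V, \<psi>)\<in>A. smooth_on (\<phi> ` (U \<inter> V)) (\<lambda>z. \<psi> (inv_into U \<phi> z)))"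

definition smooth_mfd_map ::
  "'g topology \<Rightarrow> ('g, 'b::real_normed_vector) chart set \<Rightarrow>
   'h topology \<Rightarrow> ('h, 'c::real_normed_vector) chart set \<Rightarrow> ('g \<Rightarrow> 'h) \<Rightarrow> bool" where
  "smooth_mfd_map T A T' A' f \<longleftrightarrow> continuous_map T T' f \<and>
     (\<forall>(U, \<phi>)\<in>A. \<forall>(V, \<psi>)\<in>A'.
        smooth_on (\<phi> ` {x \<in> U. f x \<in> V}) (\<lambda>z. \<psi> (f (inv_into U \<phi> z))))"

definition prod_atlas ::
  "('g, 'b) chart set \<Rightarrow> ('h, 'c) chart set \<Rightarrow> ('g \<times> 'h, 'b \<times> 'c) chart set" where
  "prod_atlas A A' = {(U \<times> V, map_prod \<phi> \<psi>) | U \<phi> V \<psi>. (U, \<phi>) \<in> A \<and> (V, \<psi>) \<in> A'}"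

text \<open>The model space \<open>'b\<close> is an arbitrary finite-dimensional normed space; unlike the
  types of class \<open>euclidean_space\<close> it may have dimension 0. Second countability is not required.\<close>

locale lie_group = group G for G :: "'g monoid" (structure) +
  fixes T :: "'g topology" and A :: "('g, 'b::real_normed_vector) chart set"
  assumes finite_dimensional: "\<exists>B :: 'b set. finite B \<and> span B = UNIV"
    and topspace_eq: "topspace T = carrier G"
    and Hausdorff: "Hausdorff_space T"
    and atlas: "smooth_atlas T A"
    and smooth_mult: "smooth_mfd_map (prod_topology T T) (prod_atlas A A) T A (\<lambda>(x, y). x \<otimes> y)"
    and smooth_inv: "smooth_mfd_map T A T A (\<lambda>x. inv x)"

text \<open>A chart \<open>(U, \<phi>)\<close> around the identity identifies the tangent space of \<open>G\<close> at the
  identity, i.e. the Lie algebra, with \<open>'b\<close>, and the norm of \<open>'b\<close> becomes a norm on the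
  Lie algebra. Under this identification the adjoint action of \<open>g\<close> is the derivative at
  \<open>\<phi> \<one>\<close> of conjugation by \<open>g\<close> read in the chart.\<close>

definition Ad :: "'g monoid \<Rightarrow> ('g, 'b::real_normed_vector) chart \<Rightarrow> 'g \<Rightarrow> 'b \<Rightarrow> 'b" where
  "Ad G = (\<lambda>(U, \<phi>) g. frechet_derivative
     (\<lambda>z. \<phi> (g \<otimes>\<^bsub>G\<^esub> inv_into U \<phi> z \<otimes>\<^bsub>G\<^esub> m_inv G g)) (at (\<phi> \<one>\<^bsub>G\<^esub>)))"

definition Ad_size :: "'g monoid \<Rightarrow> ('g, 'b::real_normed_vector) chart \<Rightarrow> 'g \<Rightarrow> real" where
  "Ad_size G ch g = max (onorm (Ad G ch g)) (onorm (inv_into UNIV (Ad G ch g)))"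

definition borel_of :: "'g topology \<Rightarrow> 'g measure" where
  "borel_of T = sigma (topspace T) {U. openin T U}"

primrec left_prod :: "'g monoid \<Rightarrow> (nat \<Rightarrow> 'g) \<Rightarrow> nat \<Rightarrow> 'g" where
  "left_prod G b 0 = \<one>\<^bsub>G\<^esub>"
| "left_prod G b (Suc n) = b n \<otimes>\<^bsub>G\<^esub> left_prod G b n"


section \<open>Exterior powers\<close>

text \<open>The \<open>k\<close>-th exterior power of a finite-dimensional space is realised as the dual of the space
  of alternating \<open>k\<close>-linear forms. Such a form takes its \<open>k\<close> arguments from the
  first \<open>k\<close> entries of a sequence; elements of the dual are extended by 0 to all functions, so that
  they are determined by their values on forms.\<close>

definition alt_forms :: "nat \<Rightarrow> ((nat \<Rightarrow> 'b::real_vector) \<Rightarrow> real) set" where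
  "alt_forms k = {\<alpha>.
     (\<forall>v w. (\<forall>i<k. v i = w i) \<longrightarrow> \<alpha> v = \<alpha> w) \<and>
     (\<forall>v. \<forall>i<k. linear (\<lambda>x. \<alpha> (v(i := x)))) \<and>
     (\<forall>v. \<forall>i<k. \<forall>j<k. i \<noteq> j \<and> v i = v j \<longrightarrow> \<alpha> v = 0)}"

type_synonym 'b multivector = "((nat \<Rightarrow> 'b) \<Rightarrow> real) \<Rightarrow> real"

definition ext_power :: "nat \<Rightarrow> 'b::real_vector multivector set" where
  "ext_power k = {F.
     (\<forall>\<alpha>\<in>alt_forms k. \<forall>\<beta>\<in>alt_forms k. F (\<lambda>v. \<alpha> v + \<beta> v) = F \<alpha> + F \<beta>) \<and>
     (\<forall>\<alpha>\<in>alt_forms k. \<forall>r. F (\<lambda>v. r * \<alpha> v) = r * F \<alpha>) \<and>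
     (\<forall>\<alpha>. \<alpha> \<notin> alt_forms k \<longrightarrow> F \<alpha> = 0)}"

definition wedge :: "nat \<Rightarrow> (nat \<Rightarrow> 'b::real_vector) \<Rightarrow> 'b multivector" where
  "wedge k v = (\<lambda>\<alpha>. if \<alpha> \<in> alt_forms k then \<alpha> v else 0)"

definition ext_map :: "nat \<Rightarrow> ('b::real_vector \<Rightarrow> 'b) \<Rightarrow> 'b multivector \<Rightarrow> 'b multivector" where
  "ext_map k L F = (\<lambda>\<alpha>. if \<alpha> \<in> alt_forms k then F (\<lambda>v. \<alpha> (\<lambda>i. L (v i))) else 0)"

definition ext_norm :: "nat \<Rightarrow> ('b::real_vector multivector \<Rightarrow> real) \<Rightarrow> bool" where
  "ext_norm k p \<longleftrightarrow>
     (\<forall>F\<in>ext_power k. 0 \<le> p F \<and> (p F = 0 \<longleftrightarrow> F = (\<lambda>_. 0))) \<and>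
     (\<forall>F\<in>ext_power k. \<forall>r. p (\<lambda>\<alpha>. r * F \<alpha>) = \<bar>r\<bar> * p F) \<and>
     (\<forall>F\<in>ext_power k. \<forall>H\<in>ext_power k. p (\<lambda>\<alpha>. F \<alpha> + H \<alpha>) \<le> p F + p H)"

definition pure_wedges :: "nat \<Rightarrow> 'b::real_vector multivector set" where
  "pure_wedges k = {wedge k v | v. wedge k v \<noteq> (\<lambda>_. 0)}"

lemma alt_formsI:
  assumes "\<And>v w. (\<And>i. i < k \<Longrightarrow> v i = w i) \<Longrightarrow> \<alpha> v = \<alpha> w"
    and "\<And>v i. i < k \<Longrightarrow> linear (\<lambda>x. \<alpha> (v(i := x)))"
    and "\<And>v i j. i < k \<Longrightarrow> j < k \<Longrightarrow> i \<noteq> j \<Longrightarrow> v i = v j \<Longrightarrow> \<alpha> v = 0"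
  shows "\<alpha> \<in> alt_forms k"
  unfolding alt_forms_def mem_Collect_eq
  by (intro conjI allI impI; (elim conjE)?; rule assms; assumption?; simp)

lemma alt_forms_cong:
  "\<alpha> \<in> alt_forms k \<Longrightarrow> (\<And>i. i < k \<Longrightarrow> v i = w i) \<Longrightarrow> \<alpha> v = \<alpha> w"
  unfolding alt_forms_def by simp

lemma alt_forms_linear:
  "\<alpha> \<in> alt_forms k \<Longrightarrow> i < k \<Longrightarrow> linear (\<lambda>x. \<alpha> (v(i := x)))"
  unfolding alt_forms_def by simp

lemma alt_forms_eq_0:
  assumes "\<alpha> \<in> alt_forms k" "i < k" "j < k" "i \<noteq> j" "v i = v j"
  shows "\<alpha> v = 0"
proof -
  have "\<forall>v. \<forall>i<k. \<forall>j<k. i \<noteq> j \<and> v i = v j \<longrightarrow> \<alpha> v = 0"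
    using assms(1) unfolding alt_forms_def by simp
  from this[rule_format, of i j v] show ?thesis using assms by simp
qed

lemma alt_forms_add:
  assumes "\<alpha> \<in> alt_forms k" "\<beta> \<in> alt_forms k"
  shows "(\<lambda>v. \<alpha> v + \<beta> v) \<in> alt_forms k"
proof (rule alt_formsI)
  show "\<alpha> v + \<beta> v = \<alpha> w + \<beta> w" if "\<And>i. i < k \<Longrightarrow> v i = w i" for v w
    using alt_forms_cong[OF assms(1) that] alt_forms_cong[OF assms(2) that] by simp
  show "linear (\<lambda>x. \<alpha> (v(i := x)) + \<beta> (v(i := x)))" if "i < k" for v i
    by (rule linear_compose_add[OF alt_forms_linear[OF assms(1) that] alt_forms_linear[OF assms(2) that]])
  show "\<alpha> v + \<beta> v = 0" if "i < k" "j < k" "i \<noteq> j" "v i = v j" for v i j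
    using alt_forms_eq_0[OF assms(1) that] alt_forms_eq_0[OF assms(2) that] by simp
qed

lemma alt_forms_scale:
  assumes "\<alpha> \<in> alt_forms k"
  shows "(\<lambda>v. r * \<alpha> v) \<in> alt_forms k"
proof (rule alt_formsI)
  show "r * \<alpha> v = r * \<alpha> w" if "\<And>i. i < k \<Longrightarrow> v i = w i" for v w
    using alt_forms_cong[OF assms that] by simp
  show "linear (\<lambda>x. r * \<alpha> (v(i := x)))" if "i < k" for v i
    using linear_compose_scale_right[OF alt_forms_linear[OF assms that], of r] by simp
  show "r * \<alpha> v = 0" if "i < k" "j < k" "i \<noteq> j" "v i = v j" for v i j
    using alt_forms_eq_0[OF assms that] by simp
qed

lemma alt_forms_pullback:
  assumes "\<alpha> \<in> alt_forms k" "linear L"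
  shows "(\<lambda>v. \<alpha> (\<lambda>i. L (v i))) \<in> alt_forms k"
proof (rule alt_formsI)
  show "\<alpha> (\<lambda>i. L (v i)) = \<alpha> (\<lambda>i. L (w i))" if "\<And>i. i < k \<Longrightarrow> v i = w i" for v w
    by (rule alt_forms_cong[OF assms(1)]) (simp add: that)
  show "linear (\<lambda>x. \<alpha> (\<lambda>j. L ((v(i := x)) j)))" if "i < k" for v i
  proof -
    have "(\<lambda>j. L (v j))(i := L x) = (\<lambda>j. L ((v(i := x)) j))" for x by auto
    with linear_compose[OF assms(2) alt_forms_linear[OF assms(1) that, of "\<lambda>j. L (v j)"]]
    show ?thesis by (simp add: o_def)
  qed
  show "\<alpha> (\<lambda>i. L (v i)) = 0" if "i < k" "j < k" "i \<noteq> j" "v i = v j" for v i j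
    by (rule alt_forms_eq_0[OF assms(1) that(1-3)]) (simp add: that)
qed

lemma wedge_in_ext_power: "wedge k v \<in> ext_power k"
  unfolding ext_power_def wedge_def by (simp add: alt_forms_add alt_forms_scale)

lemma ext_map_wedge: "linear L \<Longrightarrow> ext_map k L (wedge k v) = wedge k (\<lambda>i. L (v i))"
  by (simp add: ext_map_def wedge_def alt_forms_pullback fun_eq_iff)


section \<open>Markov chains\<close>

text \<open>The Markov measure on \<open>E\<^sup>\<nat>\<close> of the chain with transition probabilities \<open>pmf (K x) y\<close>
  started at \<open>e\<close>, obtained from the Ionescu-Tulcea theorem. It is characterised by
  its values on cylinder sets, see \<open>emeasure_markov_cylinder\<close>.\<close>

definition markov_step :: "('e \<Rightarrow> 'e pmf) \<Rightarrow> 'e \<Rightarrow> nat \<Rightarrow> (nat \<Rightarrow> 'e) \<Rightarrow> 'e measure" where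
  "markov_step K e n \<omega> =
     (case n of 0 \<Rightarrow> return (count_space UNIV) e | Suc m \<Rightarrow> measure_pmf (K (\<omega> m)))"

definition markov_measure :: "('e \<Rightarrow> 'e pmf) \<Rightarrow> 'e \<Rightarrow> (nat \<Rightarrow> 'e) measure" where
  "markov_measure K e = projective_family.lim UNIV
     (Ionescu_Tulcea.CI (markov_step K e) (\<lambda>_. count_space UNIV)) (\<lambda>_. count_space UNIV)"

lemma Ionescu_Tulcea_markov:
  fixes K :: "'e::countable \<Rightarrow> 'e pmf"
  shows "Ionescu_Tulcea (markov_step K e) (\<lambda>_. count_space UNIV)"
proof (rule Ionescu_Tulcea.intro)
  fix i :: nat
  show "markov_step K e i \<in> measurable (PiM {0..<i} (\<lambda>_. count_space UNIV)) (subprob_algebra (count_space UNIV))"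
  proof (cases i)
    case 0
    have "return (count_space UNIV) e \<in> space (subprob_algebra (count_space UNIV))"
      by (simp add: space_subprob_algebra prob_space_return prob_space_imp_subprob_space)
    then show ?thesis by (simp add: markov_step_def[abs_def] 0)
  next
    case (Suc m)
    have "(\<lambda>\<omega>. \<omega> m) \<in> measurable (PiM {0..<i} (\<lambda>_. count_space UNIV)) (count_space (UNIV::'e set))"
      by (rule measurable_component_singleton) (simp add: Suc)
    moreover have "(\<lambda>x. measure_pmf (K x)) \<in> measurable (count_space UNIV) (subprob_algebra (count_space UNIV))"
      by (simp add: measure_pmf_in_subprob_algebra)
    ultimately show ?thesis
      by (simp add: markov_step_def[abs_def] Suc)
  qed
next
  fix i :: nat and x :: "nat \<Rightarrow> 'e"
  show "prob_space (markov_step K e i x)"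
    by (simp add: markov_step_def prob_space_return measure_pmf.prob_space_axioms split: nat.split)
qed

lemma sets_markov_measure:
  fixes K :: "'e::countable \<Rightarrow> 'e pmf"
  shows "sets (markov_measure K e) = sets (PiM UNIV (\<lambda>_. count_space UNIV))"
proof -
  interpret IT: Ionescu_Tulcea "markov_step K e" "\<lambda>_. count_space UNIV"
    by (rule Ionescu_Tulcea_markov)
  show ?thesis unfolding markov_measure_def by simp
qed

lemma emeasure_markov_cylinder:
  fixes K :: "'e::countable \<Rightarrow> 'e pmf"
  shows "emeasure (markov_measure K e) {\<omega>. \<forall>i\<le>n. \<omega> i = x i} =
    (if x 0 = e then \<Prod>i<n. ennreal (pmf (K (x i)) (x (Suc i))) else 0)"
proof -
  let ?M = "\<lambda>_::nat. count_space (UNIV :: 'e set)"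
  interpret IT: Ionescu_Tulcea "markov_step K e" ?M
    by (rule Ionescu_Tulcea_markov)
  have sp: "restrict y {0..<m} \<in> space (PiM {0..<m} ?M)" for y :: "nat \<Rightarrow> 'e" and m
    by (auto simp: space_PiM)
  have sing: "{restrict x {0..<m}} \<in> sets (PiM {0..<m} ?M)" for m
  proof -
    have "{restrict x {0..<m}} = PiE {0..<m} (\<lambda>i. {x i})"
      by (auto simp: PiE_iff fun_eq_iff extensional_def restrict_def)
    also have "\<dots> \<in> sets (PiM {0..<m} ?M)" by (rule sets_PiM_I_finite) auto
    finally show ?thesis .
  qed
  have und: "(\<lambda>_. undefined) \<in> space (PiM {0..<0} ?M)" by (auto simp: space_PiM)
  have C: "emeasure (IT.C 0 (Suc m) (\<lambda>_. undefined)) {restrict x {0..<Suc m}} =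
    emeasure (IT.C 0 m (\<lambda>_. undefined)) {restrict x {0..<m}} *
    emeasure (markov_step K e m x) {x m}" for m
  proof -
    have "emeasure (IT.C 0 (Suc m) (\<lambda>_. undefined)) {restrict x {0..<Suc m}} =
      (\<integral>\<^sup>+\<omega>. emeasure (IT.eP m \<omega>) {restrict x {0..<Suc m}} \<partial>IT.C 0 m (\<lambda>_. undefined))"
    proof -
      have ne: "space (IT.C 0 m (\<lambda>_. undefined)) \<noteq> {}"
        using IT.space_C[OF und, of m] sp[of x m] by auto
      have me: "IT.eP m \<in> measurable (IT.C 0 m (\<lambda>_. undefined)) (subprob_algebra (PiM {0..<Suc m} ?M))"
        using IT.measurable_eP[of m] IT.sets_C[OF und, of m]
        by (metis add_0 measurable_cong_sets)
      show ?thesis using emeasure_bind[OF ne me sing[of "Suc m"]] by simp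
    qed
    also have "\<dots> = (\<integral>\<^sup>+\<omega>. emeasure (markov_step K e m x) {x m} *
        indicator {restrict x {0..<m}} \<omega> \<partial>IT.C 0 m (\<lambda>_. undefined))"
    proof (rule nn_integral_cong)
      fix \<omega> assume "\<omega> \<in> space (IT.C 0 m (\<lambda>_. undefined))"
      then have \<omega>: "\<omega> \<in> space (PiM {0..<m} ?M)" using IT.space_C[OF und, of m] by simp
      then have ext: "\<omega> \<in> extensional {0..<m}" by (auto simp: space_PiM PiE_def)
      have eq: "fun_upd \<omega> m -` {restrict x {0..<Suc m}} =
        (if \<omega> = restrict x {0..<m} then {x m} else {})"
      proof -
        have "fun_upd \<omega> m y = restrict x {0..<Suc m} \<longleftrightarrow> \<omega> = restrict x {0..<m} \<and> y = x m" for y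
        proof
          assume h: "fun_upd \<omega> m y = restrict x {0..<Suc m}"
          have "\<omega> i = restrict x {0..<m} i" for i
            using fun_cong[OF h, of i] ext by (cases "i < m") (auto simp: extensional_def)
          moreover have "y = x m" using fun_cong[OF h, of m] by simp
          ultimately show "\<omega> = restrict x {0..<m} \<and> y = x m" by auto
        next
          assume "\<omega> = restrict x {0..<m} \<and> y = x m"
          then show "fun_upd \<omega> m y = restrict x {0..<Suc m}" by (auto simp: fun_eq_iff)
        qed
        then show ?thesis by auto
      qed
      have st: "markov_step K e m (restrict x {0..<m}) = markov_step K e m x"
        by (auto simp: markov_step_def split: nat.split)
      show "emeasure (IT.eP m \<omega>) {restrict x {0..<Suc m}} =
        emeasure (markov_step K e m x) {x m} * indicator {restrict x {0..<m}} \<omega>"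
        using IT.emeasure_eP[OF \<omega> sing[of "Suc m"]] by (auto simp: eq st)
    qed
    also have "\<dots> = emeasure (markov_step K e m x) {x m} *
        emeasure (IT.C 0 m (\<lambda>_. undefined)) {restrict x {0..<m}}"
      using sing[of m] IT.sets_C[OF und, of m] by (intro nn_integral_cmult_indicator) simp
    finally show ?thesis by (simp add: mult.commute)
  qed
  have "{\<omega>. \<forall>i\<le>n. \<omega> i = x i} = prod_emb UNIV ?M {0..<Suc n} {restrict x {0..<Suc n}}"
    by (auto simp: prod_emb_def fun_eq_iff restrict_def less_Suc_eq_le) metis
  then have "emeasure (markov_measure K e) {\<omega>. \<forall>i\<le>n. \<omega> i = x i} =
    emeasure (IT.CI {0..<Suc n}) {restrict x {0..<Suc n}}"
    unfolding markov_measure_def by (simp only: IT.lim[OF finite_atLeastLessThan sing])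
  also have "\<dots> = emeasure (IT.C 0 (Suc n) (\<lambda>_. undefined)) {restrict x {0..<Suc n}}"
  proof -
    have "prod_emb {0..<Suc n} ?M {0..<Suc n} {restrict x {0..<Suc n}} = {restrict x {0..<Suc n}}"
      by (rule prod_emb_id) auto
    then show ?thesis using IT.emeasure_CI[OF subset_refl sing[of "Suc n"]] by metis
  qed
  also have "\<dots> = (if x 0 = e then \<Prod>i<n. ennreal (pmf (K (x i)) (x (Suc i))) else 0)"
  proof (induction n)
    case 0
    have "restrict x {0..<0} = (\<lambda>_. undefined)" by auto
    then show ?case
      unfolding C using sing[of 0] by (simp add: markov_step_def indicator_def)
  next
    case (Suc n)
    show ?case
      unfolding C[of "Suc n"] Suc.IH by (simp add: markov_step_def emeasure_pmf_single)
  qed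
  finally show ?thesis .
qed

definition return_time :: "'e \<Rightarrow> (nat \<Rightarrow> 'e) \<Rightarrow> enat" where
  "return_time e \<omega> = Inf {enat n | n. 1 \<le> n \<and> \<omega> n = e}"

definition irreducible_chain :: "('e \<Rightarrow> 'e pmf) \<Rightarrow> bool" where
  "irreducible_chain K \<longleftrightarrow>
     (\<forall>e e'. measure (markov_measure K e) {\<omega>. return_time e' \<omega> < \<infinity>} > 0)"

definition recurrent_chain :: "('e \<Rightarrow> 'e pmf) \<Rightarrow> bool" where
  "recurrent_chain K \<longleftrightarrow>
     (\<forall>e. measure (markov_measure K e) {\<omega>. return_time e \<omega> < \<infinity>} = 1)"

definition positive_recurrent_chain :: "('e \<Rightarrow> 'e pmf) \<Rightarrow> bool" where
  "positive_recurrent_chain K \<longleftrightarrow>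
     (\<forall>e. (\<integral>\<^sup>+\<omega>. ennreal_of_enat (return_time e \<omega>) \<partial>markov_measure K e) < \<infinity>)"

definition stationary_distribution :: "('e \<Rightarrow> 'e pmf) \<Rightarrow> 'e pmf \<Rightarrow> bool" where
  "stationary_distribution K \<pi> \<longleftrightarrow> bind_pmf \<pi> K = \<pi>"

text \<open>The value of the random product where the return time is infinite is irrelevant for
  recurrent chains.\<close>

definition renewal_measure ::
  "'g monoid \<Rightarrow> 'g topology \<Rightarrow> ('e \<Rightarrow> 'g) \<Rightarrow> ('e \<Rightarrow> 'e pmf) \<Rightarrow> 'e \<Rightarrow> 'g measure" where
  "renewal_measure G T c K e = distr (markov_measure K e) (borel_of T)
     (\<lambda>\<omega>. left_prod G (\<lambda>n. c (\<omega> n)) (the_enat (return_time e \<omega>)))"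


section \<open>Expansion\<close>

text \<open>In all of the following, \<open>ch\<close> is a chart around the identity and \<open>nrm k\<close> a norm on
  the \<open>k\<close>-th exterior power of the Lie algebra.\<close>

definition finite_first_moment ::
  "'g monoid \<Rightarrow> ('g, 'b::real_normed_vector) chart \<Rightarrow> ('e \<Rightarrow> 'g) \<Rightarrow> 'e pmf \<Rightarrow> bool" where
  "finite_first_moment G ch c \<pi> \<longleftrightarrow>
     (\<lambda>e'. ln (Ad_size G ch (c e')) * pmf \<pi> e') summable_on UNIV"

definition growth_rate ::
  "'g monoid \<Rightarrow> ('g, 'b::real_normed_vector) chart \<Rightarrow> (nat \<Rightarrow> 'b multivector \<Rightarrow> real) \<Rightarrow>
   nat \<Rightarrow> 'b multivector \<Rightarrow> (nat \<Rightarrow> 'g) \<Rightarrow> ereal" where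
  "growth_rate G ch nrm k v b =
     liminf (\<lambda>n. ereal (1 / real n * ln (nrm k (ext_map k (Ad G ch (left_prod G b n)) v))))"

definition expanding_from ::
  "'g monoid \<Rightarrow> ('g, 'b::real_normed_vector) chart \<Rightarrow> (nat \<Rightarrow> 'b multivector \<Rightarrow> real) \<Rightarrow>
   ('e \<Rightarrow> 'g) \<Rightarrow> ('e \<Rightarrow> 'e pmf) \<Rightarrow> 'e \<Rightarrow> bool" where
  "expanding_from G ch nrm c K e \<longleftrightarrow>
     (\<forall>k\<in>{1..dim (UNIV :: 'b set) - 1}. \<forall>v\<in>pure_wedges k.
        AE \<omega> in markov_measure K e. growth_rate G ch nrm k v (\<lambda>n. c (\<omega> n)) > 0)"

definition unif_expanding_on_grassmannians ::
  "'g monoid \<Rightarrow> ('g, 'b::real_normed_vector) chart \<Rightarrow> (nat \<Rightarrow> 'b multivector \<Rightarrow> real) \<Rightarrow>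
   'g measure \<Rightarrow> bool" where
  "unif_expanding_on_grassmannians G ch nrm \<mu> \<longleftrightarrow>
     (\<forall>k\<in>{1..dim (UNIV :: 'b set) - 1}. \<forall>v\<in>pure_wedges k.
        AE b in PiM (UNIV :: nat set) (\<lambda>_. \<mu>). growth_rate G ch nrm k v b > 0)"

end

(* Under P_e the path splits at its visits to e into independent, identically distributed
   excursions, and the product of the g's over one excursion has law mu_e. Hence a random walk
   with law mu_e is the chain's product sampled at the visit times t_0 < t_1 < ....

   (i) Since t_m >= m, linear growth of the chain along all times gives linear growth along the
   visits.

   (ii) Between t_m and t_{m+1} the logarithm of the norm drops by at most a constant plus
   k * Y_m, where Y_m is the sum of log N(g) over the m-th excursion. The stationary distribution
   dominates pi(e) times the occupation measure of an excursion (half of Kac's formula), so both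
   the length of an excursion and Y_m are integrable. By Borel-Cantelli Y_m = o(m), and by the
   maximal ergodic inequality t_m = O(m); the growth at the visits then spreads to all times. *)
theory Submission
  imports Defs
begin

section \<open>Norms on exterior powers\<close>

text \<open>The delicate direction is from the visits to all times. Inside an excursion the vector
  may shrink, and the loss is estimated backwards: if g is the partial product since the last visit,
  the wedge at that visit is the image of the present one under Ad(g^-1). What is wanted is
  therefore a bound for the induced map on wedges by a constant times the k-th power of an operator
  norm, with a constant uniform in the map and the wedge. As the norm on each exterior power is
  arbitrary, a comparison of norms in finite dimension comes first.

  Independence of the excursions rests on a multiplicativity: a concatenation of loops at e, closed
  by a last e, has as its probability the product of the probabilities of the loops. This gives an
  inequality on cylinders, and an inequality between two probabilities on a countable set is an
  equality.

  G need not be second countable, so the growth event is not visibly measurable for the product of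
  Borel structures. Almost sure statements are therefore compared on sequences of words over E,
  where anything that depends on finitely many entries is measurable.\<close>

lemma coordinatewise_convergent_subseq:
  fixes y :: "nat \<Rightarrow> 'i \<Rightarrow> real"
  assumes "finite I" and bound: "\<And>n i. i \<in> I \<Longrightarrow> \<bar>y n i\<bar> \<le> R"
  shows "\<exists>r z. strict_mono (r :: nat \<Rightarrow> nat) \<and> (\<forall>i\<in>I. (\<lambda>n. y (r n) i) \<longlonglongrightarrow> z i)"
  using assms
proof (induction I rule: finite_induct)
  case empty
  show ?case by (intro exI[of _ id]) (auto simp: strict_mono_def)
next
  case (insert j I)
  then obtain r z where r: "strict_mono (r :: nat \<Rightarrow> nat)" and z: "\<forall>i\<in>I. (\<lambda>n. y (r n) i) \<longlonglongrightarrow> z i"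
    by auto
  have "bounded (range (\<lambda>n. y (r n) j))"
    using insert.prems by (auto simp: bounded_iff intro!: exI[of _ R])
  then obtain l s where s: "strict_mono (s :: nat \<Rightarrow> nat)" and l: "((\<lambda>n. y (r n) j) \<circ> s) \<longlonglongrightarrow> l"
    using bounded_imp_convergent_subsequence by blast
  have "(\<lambda>n. y ((r \<circ> s) n) i) \<longlonglongrightarrow> (z(j := l)) i" if "i \<in> insert j I" for i
  proof (cases "i = j")
    case True
    then show ?thesis using l by (simp add: o_def)
  next
    case False
    then have "(\<lambda>n. y (r n) i) \<longlonglongrightarrow> z i" using that z by simp
    from LIMSEQ_subseq_LIMSEQ[OF this s] show ?thesis using False by (simp add: o_def)
  qed
  then show ?case using strict_mono_o[OF r s] by blast
qed

text \<open>\<open>N\<close> is only a seminorm and the conclusion is stated modulo its kernel, so that it applies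
  to spanning families which need not be linearly independent.\<close>

locale coord_seminorm =
  fixes N :: "('i \<Rightarrow> real) \<Rightarrow> real"
  assumes triangle: "N (\<lambda>i. x i + y i) \<le> N x + N y"
    and scale: "N (\<lambda>i. r * x i) = \<bar>r\<bar> * N x"
begin

lemma zero: "N (\<lambda>i. 0) = 0"
  using scale[of 0 "\<lambda>i. 0"] by simp

lemma minus: "N (\<lambda>i. x i - y i) = N (\<lambda>i. y i - x i)"
  using scale[of "-1" "\<lambda>i. x i - y i"] by simp

lemma triangle_diff: "N (\<lambda>i. x i - z i) \<le> N (\<lambda>i. x i - y i) + N (\<lambda>i. y i - z i)"
  using triangle[of "\<lambda>i. x i - y i" "\<lambda>i. y i - z i"] by simp

lemma nonneg: "0 \<le> N x"
  using triangle[of x "\<lambda>i. - x i"] scale[of "-1" x] zero by simp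

lemma le_add_diff: "N x \<le> N (\<lambda>i. x i - y i) + N y"
  using triangle[of "\<lambda>i. x i - y i" y] by simp

lemma eq_if_diff_zero: "N (\<lambda>i. x i - y i) = 0 \<Longrightarrow> N x = N y"
  using le_add_diff[of x y] le_add_diff[of y x] minus[of x y] by simp

definition unit :: "'i \<Rightarrow> 'i \<Rightarrow> real" where
  "unit j = (\<lambda>i. if i = j then 1 else 0)"

lemma le_sum_units:
  assumes "finite I" "\<And>i. i \<notin> I \<Longrightarrow> x i = 0"
  shows "N x \<le> (\<Sum>i\<in>I. \<bar>x i\<bar> * N (unit i))"
  using assms
proof (induction I arbitrary: x rule: finite_induct)
  case empty
  then have "x = (\<lambda>i. 0)" by auto
  then show ?case using zero by simp
next
  case (insert j I)
  have "(\<lambda>i. (x(j := 0)) i + x j * unit j i) = x"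
    by (auto simp: unit_def)
  then have "N x \<le> N (x(j := 0)) + \<bar>x j\<bar> * N (unit j)"
    using triangle[of "x(j := 0)" "\<lambda>i. x j * unit j i"] scale[of "x j" "unit j"] by simp
  also have "N (x(j := 0)) \<le> (\<Sum>i\<in>I. \<bar>(x(j := 0)) i\<bar> * N (unit i))"
    by (rule insert.IH) (use insert.prems in auto)
  also have "\<dots> = (\<Sum>i\<in>I. \<bar>x i\<bar> * N (unit i))"
    using insert.hyps by (intro sum.cong) auto
  finally show ?case using insert.hyps by simp
qed

text \<open>A space spanned by finitely many vectors is closed, in seminorm form. Approximants from
  the span of \<open>I\<close> may have unbounded coordinates, but by \<open>IH\<close> each can be
  replaced, modulo the kernel, by one whose coordinates are bounded; a subsequence of these
  converges coordinatewise, hence in \<open>N\<close>.\<close>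

lemma limit_attained:
  assumes "finite I"
    and IH: "\<And>x. (\<And>i. i \<notin> I \<Longrightarrow> x i = 0) \<Longrightarrow>
      \<exists>y. (\<forall>i. i \<notin> I \<longrightarrow> y i = 0) \<and> N (\<lambda>i. x i - y i) = 0 \<and> (\<Sum>i\<in>I. \<bar>y i\<bar>) \<le> M * N x"
    and M: "0 \<le> M"
    and approx: "\<And>\<epsilon>. \<epsilon> > 0 \<Longrightarrow> \<exists>u. (\<forall>i. i \<notin> I \<longrightarrow> u i = 0) \<and> N (\<lambda>i. a i - u i) < \<epsilon>"
  shows "\<exists>u. (\<forall>i. i \<notin> I \<longrightarrow> u i = 0) \<and> N (\<lambda>i. a i - u i) = 0"
proof -
  have "\<exists>y. (\<forall>i. i \<notin> I \<longrightarrow> y i = 0) \<and> N (\<lambda>i. a i - y i) < inverse (real (Suc n)) \<and>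
      (\<Sum>i\<in>I. \<bar>y i\<bar>) \<le> M * (N a + 1)" for n
  proof -
    obtain u where u: "\<forall>i. i \<notin> I \<longrightarrow> u i = 0" "N (\<lambda>i. a i - u i) < inverse (real (Suc n))"
      using approx[of "inverse (real (Suc n))"] by auto
    obtain y where y: "\<forall>i. i \<notin> I \<longrightarrow> y i = 0" "N (\<lambda>i. u i - y i) = 0" "(\<Sum>i\<in>I. \<bar>y i\<bar>) \<le> M * N u"
      using IH[of u] u(1) by blast
    have "N u \<le> N a + N (\<lambda>i. a i - u i)"
      using le_add_diff[of u a] minus[of u a] by simp
    also have "\<dots> \<le> N a + 1"
    proof -
      have "inverse (real (Suc n)) \<le> 1" by (simp add: inverse_le_1_iff)
      then show ?thesis using u(2) by linarith
    qed
    finally have "M * N u \<le> M * (N a + 1)" using M by (rule mult_left_mono)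
    moreover have "N (\<lambda>i. a i - y i) < inverse (real (Suc n))"
      using triangle_diff[of a y u] u(2) y(2) by simp
    ultimately show ?thesis using y by (intro exI[of _ y]) simp
  qed
  then obtain y where y: "\<And>n i. i \<notin> I \<Longrightarrow> y n i = 0"
      "\<And>n. N (\<lambda>i. a i - y n i) < inverse (real (Suc n))"
      "\<And>n. (\<Sum>i\<in>I. \<bar>y n i\<bar>) \<le> M * (N a + 1)"
    by metis
  have "\<bar>y n i\<bar> \<le> M * (N a + 1)" if "i \<in> I" for n i
  proof -
    have "\<bar>y n i\<bar> \<le> (\<Sum>i\<in>I. \<bar>y n i\<bar>)"
      by (rule member_le_sum) (use that \<open>finite I\<close> in auto)
    then show ?thesis using y(3)[of n] by linarith
  qed
  from coordinatewise_convergent_subseq[OF \<open>finite I\<close>, of y, OF this]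
  obtain r z where r: "strict_mono (r :: nat \<Rightarrow> nat)" and z: "\<forall>i\<in>I. (\<lambda>n. y (r n) i) \<longlonglongrightarrow> z i"
    by blast
  define u where "u = (\<lambda>i. if i \<in> I then z i else 0)"
  have bd: "N (\<lambda>i. a i - u i) \<le> inverse (real (Suc (r n))) + (\<Sum>i\<in>I. \<bar>y (r n) i - z i\<bar> * N (unit i))" for n
  proof -
    have "N (\<lambda>i. y (r n) i - u i) \<le> (\<Sum>i\<in>I. \<bar>y (r n) i - u i\<bar> * N (unit i))"
      by (rule le_sum_units) (use \<open>finite I\<close> y(1) in \<open>auto simp: u_def\<close>)
    also have "\<dots> = (\<Sum>i\<in>I. \<bar>y (r n) i - z i\<bar> * N (unit i))"
      by (rule sum.cong) (auto simp: u_def)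
    finally show ?thesis
      using triangle_diff[of a u "y (r n)"] y(2)[of "r n"] by linarith
  qed
  have "(\<lambda>n. inverse (real (Suc (r n))) + (\<Sum>i\<in>I. \<bar>y (r n) i - z i\<bar> * N (unit i))) \<longlonglongrightarrow>
      0 + (\<Sum>i\<in>I. \<bar>z i - z i\<bar> * N (unit i))"
  proof (intro tendsto_intros)
    show "(\<lambda>n. inverse (real (Suc (r n)))) \<longlonglongrightarrow> 0"
      using LIMSEQ_subseq_LIMSEQ[OF LIMSEQ_inverse_real_of_nat r] by (simp add: o_def)
    show "(\<lambda>n. y (r n) i) \<longlonglongrightarrow> z i" if "i \<in> I" for i using z that by blast
  qed
  from LIMSEQ_le_const[OF this] bd have "N (\<lambda>i. a i - u i) \<le> 0"
    by simp
  then have "N (\<lambda>i. a i - u i) = 0" using nonneg[of "\<lambda>i. a i - u i"] by simp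
  then show ?thesis by (intro exI[of _ u]) (simp add: u_def)
qed

text \<open>Unit vectors are added one at a time. Either the new vector \<open>unit j\<close> lies
  at distance zero from the span of \<open>I\<close> and can be expressed through it at no cost, or
  it lies at a distance \<delta> > 0 and its coefficient in \<open>x\<close> is at most N(x) /
  \<delta>.\<close>

lemma bounded_coordinates:
  assumes "finite I"
  shows "\<exists>M\<ge>0. \<forall>x. (\<forall>i. i \<notin> I \<longrightarrow> x i = 0) \<longrightarrow>
     (\<exists>y. (\<forall>i. i \<notin> I \<longrightarrow> y i = 0) \<and> N (\<lambda>i. x i - y i) = 0 \<and> (\<Sum>i\<in>I. \<bar>y i\<bar>) \<le> M * N x)"
  using assms
proof (induction I rule: finite_induct)
  case empty
  show ?case by (intro exI[of _ 0]) (auto simp: zero intro: exI[of _ "\<lambda>_. 0"])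
next
  case (insert j I)
  then obtain M where M: "M \<ge> 0"
    and IH: "\<And>x. (\<And>i. i \<notin> I \<Longrightarrow> x i = 0) \<Longrightarrow>
      \<exists>y. (\<forall>i. i \<notin> I \<longrightarrow> y i = 0) \<and> N (\<lambda>i. x i - y i) = 0 \<and> (\<Sum>i\<in>I. \<bar>y i\<bar>) \<le> M * N x"
    by auto
  show ?case
  proof (cases "\<forall>\<epsilon>>0. \<exists>u. (\<forall>i. i \<notin> I \<longrightarrow> u i = 0) \<and> N (\<lambda>i. unit j i - u i) < \<epsilon>")
    case True
    obtain u where u: "\<forall>i. i \<notin> I \<longrightarrow> u i = 0" "N (\<lambda>i. unit j i - u i) = 0"
      using limit_attained[OF insert.hyps(1) IH M, of "unit j"] True by blast
    show ?thesis
    proof (rule exI[of _ M], intro conjI allI impI M)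
      fix x :: "'i \<Rightarrow> real" assume x: "\<forall>i. i \<notin> insert j I \<longrightarrow> x i = 0"
      \<comment> \<open>\<open>x'\<close> eliminates the coordinate \<open>j\<close> by putting the
        representative \<open>u\<close> in place of the unit vector. It differs from
        \<open>x\<close> by a kernel element, so the seminorm and the constant \<open>M\<close> are
        unchanged.\<close>
      define x' where "x' = (\<lambda>i. (x(j := 0)) i + x j * u i)"
      have "(\<lambda>i. x i - x' i) = (\<lambda>i. x j * (unit j i - u i))"
        using insert.hyps u by (auto simp: x'_def unit_def algebra_simps)
      then have eq: "N (\<lambda>i. x i - x' i) = 0" using scale[of "x j"] u by simp
      obtain y where y: "\<forall>i. i \<notin> I \<longrightarrow> y i = 0" "N (\<lambda>i. x' i - y i) = 0" "(\<Sum>i\<in>I. \<bar>y i\<bar>) \<le> M * N x'"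
      proof -
        have "x' i = 0" if "i \<notin> I" for i using x u that by (simp add: x'_def)
        then have "\<exists>y. (\<forall>i. i \<notin> I \<longrightarrow> y i = 0) \<and> N (\<lambda>i. x' i - y i) = 0 \<and> (\<Sum>i\<in>I. \<bar>y i\<bar>) \<le> M * N x'"
          by (rule IH)
        then show ?thesis by (elim exE conjE) (rule that)
      qed
      have "N (\<lambda>i. x i - y i) = 0"
        using triangle_diff[of x y x'] eq y(2) nonneg[of "\<lambda>i. x i - y i"] by simp
      then show "\<exists>y. (\<forall>i. i \<notin> insert j I \<longrightarrow> y i = 0) \<and> N (\<lambda>i. x i - y i) = 0 \<and>
          (\<Sum>i\<in>insert j I. \<bar>y i\<bar>) \<le> M * N x"
        using y insert.hyps eq_if_diff_zero[OF eq] by (intro exI[of _ y]) auto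
    qed
  next
    case False
    then obtain \<delta> where \<delta>: "\<delta> > 0" "\<And>u. (\<And>i. i \<notin> I \<Longrightarrow> u i = 0) \<Longrightarrow> \<delta> \<le> N (\<lambda>i. unit j i - u i)"
      by (meson not_le)
    \<comment> \<open>The summand 1 / \<delta> pays for the coefficient at \<open>j\<close>; the
      rest of \<open>x\<close>, whose seminorm is at most N(x) (1 + N(unit j) / \<delta>), is
      handled by \<open>M\<close>.\<close>
    define M' where "M' = M * (1 + N (unit j) / \<delta>) + 1 / \<delta>"
    have M': "M' \<ge> 0" using M \<delta>(1) nonneg[of "unit j"] by (simp add: M'_def)
    show ?thesis
    proof (rule exI[of _ M'], intro conjI allI impI M')
      fix x :: "'i \<Rightarrow> real" assume x: "\<forall>i. i \<notin> insert j I \<longrightarrow> x i = 0"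
      have t: "\<bar>x j\<bar> * \<delta> \<le> N x"
      proof (cases "x j = 0")
        case True
        then show ?thesis using nonneg by simp
      next
        case False
        \<comment> \<open>Chosen so that \<open>x\<close> is \<open>x j\<close> times the difference
          of \<open>unit j\<close> and \<open>u\<close>, whose seminorm is at least
          \<delta>.\<close>
        define u where "u = (\<lambda>i. - ((x(j := 0)) i / x j))"
        have "(\<lambda>i. x j * (unit j i - u i)) = x"
          using False by (auto simp: u_def unit_def)
        then have "N x = \<bar>x j\<bar> * N (\<lambda>i. unit j i - u i)"
          using scale[of "x j" "\<lambda>i. unit j i - u i"] by simp
        moreover have "\<delta> \<le> N (\<lambda>i. unit j i - u i)"
          by (rule \<delta>(2)) (use x in \<open>auto simp: u_def\<close>)
        ultimately show ?thesis by (simp add: mult_left_mono)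
      qed
      have t': "\<bar>x j\<bar> \<le> N x / \<delta>" using t \<delta>(1) by (simp add: field_simps)
      have "(\<lambda>i. (x(j := 0)) i - x i) = (\<lambda>i. (- x j) * unit j i)"
        by (auto simp: unit_def)
      then have "N (x(j := 0)) \<le> N x + \<bar>x j\<bar> * N (unit j)"
        using le_add_diff[of "x(j := 0)" x] scale[of "- x j" "unit j"] by simp
      also have "\<dots> \<le> N x + N x / \<delta> * N (unit j)"
        using t' nonneg[of "unit j"] by (intro add_left_mono mult_right_mono)
      finally have Nu: "N (x(j := 0)) \<le> N x * (1 + N (unit j) / \<delta>)"
        by (simp add: algebra_simps)
      obtain y where y: "\<forall>i. i \<notin> I \<longrightarrow> y i = 0" "N (\<lambda>i. (x(j := 0)) i - y i) = 0"
          "(\<Sum>i\<in>I. \<bar>y i\<bar>) \<le> M * N (x(j := 0))"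
      proof -
        have "(x(j := 0)) i = 0" if "i \<notin> I" for i using x that by simp
        then have "\<exists>y. (\<forall>i. i \<notin> I \<longrightarrow> y i = 0) \<and> N (\<lambda>i. (x(j := 0)) i - y i) = 0 \<and>
            (\<Sum>i\<in>I. \<bar>y i\<bar>) \<le> M * N (x(j := 0))"
          by (rule IH)
        then show ?thesis by (elim exE conjE) (rule that)
      qed
      have "(\<lambda>i. x i - (y(j := x j)) i) = (\<lambda>i. (x(j := 0)) i - y i)"
        using y(1) insert.hyps by auto
      moreover have "(\<Sum>i\<in>insert j I. \<bar>(y(j := x j)) i\<bar>) = \<bar>x j\<bar> + (\<Sum>i\<in>I. \<bar>y i\<bar>)"
      proof -
        have "(\<Sum>i\<in>I. \<bar>(y(j := x j)) i\<bar>) = (\<Sum>i\<in>I. \<bar>y i\<bar>)"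
          using insert.hyps by (intro sum.cong) auto
        then show ?thesis using insert.hyps by simp
      qed
      moreover have "\<bar>x j\<bar> + (\<Sum>i\<in>I. \<bar>y i\<bar>) \<le> M' * N x"
        using t' order_trans[OF y(3) mult_left_mono[OF Nu M]] by (simp add: M'_def algebra_simps)
      ultimately show "\<exists>y. (\<forall>i. i \<notin> insert j I \<longrightarrow> y i = 0) \<and> N (\<lambda>i. x i - y i) = 0 \<and>
          (\<Sum>i\<in>insert j I. \<bar>y i\<bar>) \<le> M' * N x"
        using y x by (intro exI[of _ "y(j := x j)"]) auto
    qed
  qed
qed

lemma bounded_coordinates_obtain:
  assumes "finite I"
  obtains M where "M \<ge> 0" "\<forall>x. (\<forall>i. i \<notin> I \<longrightarrow> x i = 0) \<longrightarrow>
     (\<exists>y. N (\<lambda>i. x i - y i) = 0 \<and> (\<Sum>i\<in>I. \<bar>y i\<bar>) \<le> M * N x)"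
proof -
  from bounded_coordinates[OF assms] obtain M where M: "M \<ge> 0"
    "\<forall>x. (\<forall>i. i \<notin> I \<longrightarrow> x i = 0) \<longrightarrow>
     (\<exists>y. (\<forall>i. i \<notin> I \<longrightarrow> y i = 0) \<and> N (\<lambda>i. x i - y i) = 0 \<and> (\<Sum>i\<in>I. \<bar>y i\<bar>) \<le> M * N x)"
    by (elim exE conjE) (rule that)
  show thesis
  proof (rule that[OF M(1)], intro allI impI)
    fix x :: "'i \<Rightarrow> real" assume x: "\<forall>i. i \<notin> I \<longrightarrow> x i = 0"
    from mp[OF spec[OF M(2)] x]
    show "\<exists>y. N (\<lambda>i. x i - y i) = 0 \<and> (\<Sum>i\<in>I. \<bar>y i\<bar>) \<le> M * N x"
      by (elim exE conjE) (intro exI conjI)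
  qed
qed

end

text \<open>The seminorm is the norm of the linear combination with given coefficients. Since
  \<open>B\<close> is merely spanning, coefficients are not unique, and the bound concerns a
  suitable choice of them.\<close>

lemma bounded_coordinates_finite_dim:
  fixes B :: "'b::real_normed_vector set"
  assumes "finite B" "span B = UNIV"
  shows "\<exists>M\<ge>0. \<forall>v. \<exists>x. v = (\<Sum>b\<in>B. x b *\<^sub>R b) \<and> (\<Sum>b\<in>B. \<bar>x b\<bar>) \<le> M * norm v"
proof -
  interpret coord_seminorm "\<lambda>x. norm (\<Sum>b\<in>B. x b *\<^sub>R b)"
  proof
    fix x y :: "'b \<Rightarrow> real" and r :: real
    show "norm (\<Sum>b\<in>B. (x b + y b) *\<^sub>R b) \<le> norm (\<Sum>b\<in>B. x b *\<^sub>R b) + norm (\<Sum>b\<in>B. y b *\<^sub>R b)"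
      using norm_triangle_ineq[of "\<Sum>b\<in>B. x b *\<^sub>R b" "\<Sum>b\<in>B. y b *\<^sub>R b"]
      by (simp add: scaleR_add_left sum.distrib)
    have "(\<Sum>b\<in>B. (r * x b) *\<^sub>R b) = r *\<^sub>R (\<Sum>b\<in>B. x b *\<^sub>R b)"
      by (simp add: scaleR_sum_right)
    then show "norm (\<Sum>b\<in>B. (r * x b) *\<^sub>R b) = \<bar>r\<bar> * norm (\<Sum>b\<in>B. x b *\<^sub>R b)" by simp
  qed
  obtain M where M: "M \<ge> 0" "\<forall>x. (\<forall>b. b \<notin> B \<longrightarrow> x b = 0) \<longrightarrow>
      (\<exists>y. norm (\<Sum>b\<in>B. (x b - y b) *\<^sub>R b) = 0 \<and> (\<Sum>b\<in>B. \<bar>y b\<bar>) \<le> M * norm (\<Sum>b\<in>B. x b *\<^sub>R b))"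
    by (rule bounded_coordinates_obtain[OF assms(1)]) (rule that)
  have "\<exists>x. v = (\<Sum>b\<in>B. x b *\<^sub>R b) \<and> (\<Sum>b\<in>B. \<bar>x b\<bar>) \<le> M * norm v" for v
  proof -
    have "v \<in> range (\<lambda>u. \<Sum>b\<in>B. u b *\<^sub>R b)"
      using assms by (simp add: span_finite[symmetric])
    then obtain u where u: "v = (\<Sum>b\<in>B. u b *\<^sub>R b)" by auto
    define x where "x = (\<lambda>b. if b \<in> B then u b else 0)"
    have x: "v = (\<Sum>b\<in>B. x b *\<^sub>R b)" unfolding u by (rule sum.cong) (auto simp: x_def)
    obtain y where y: "norm (\<Sum>b\<in>B. (x b - y b) *\<^sub>R b) = 0" "(\<Sum>b\<in>B. \<bar>y b\<bar>) \<le> M * norm v"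
    proof -
      have "\<forall>b. b \<notin> B \<longrightarrow> x b = 0" by (simp add: x_def)
      from mp[OF spec[OF M(2)] this] show ?thesis unfolding x[symmetric] by (elim exE conjE) (rule that)
    qed
    have "v = (\<Sum>b\<in>B. y b *\<^sub>R b)"
      using y(1) by (simp add: x scaleR_diff_left sum_subtractf)
    with y(2) show ?thesis by blast
  qed
  with M(1) show ?thesis by blast
qed

section \<open>Norm bounds for wedges and for induced maps\<close>

lemma wedge_cong: "(\<And>i. i < k \<Longrightarrow> v i = w i) \<Longrightarrow> wedge k v = wedge k w"
  unfolding wedge_def using alt_forms_cong by fastforce

lemma wedge_expand:
  fixes v :: "nat \<Rightarrow> 'b::real_vector"
  assumes "i < k" "v i = (\<Sum>b\<in>B. x b *\<^sub>R b)"
  shows "wedge k v = (\<lambda>\<alpha>. \<Sum>b\<in>B. x b * wedge k (v(i := b)) \<alpha>)"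
proof
  fix \<alpha> :: "(nat \<Rightarrow> 'b) \<Rightarrow> real"
  show "wedge k v \<alpha> = (\<Sum>b\<in>B. x b * wedge k (v(i := b)) \<alpha>)"
  proof (cases "\<alpha> \<in> alt_forms k")
    case True
    note lin = alt_forms_linear[OF True assms(1), of v]
    have "\<alpha> v = \<alpha> (v(i := \<Sum>b\<in>B. x b *\<^sub>R b))" using assms(2) by (metis fun_upd_triv)
    also have "\<dots> = (\<Sum>b\<in>B. x b *\<^sub>R \<alpha> (v(i := b)))"
      by (simp add: linear_sum[OF lin] linear_cmul[OF lin])
    finally show ?thesis using True by (simp add: wedge_def)
  qed (simp add: wedge_def)
qed

lemma ext_power_add: "F \<in> ext_power k \<Longrightarrow> H \<in> ext_power k \<Longrightarrow> (\<lambda>\<alpha>. F \<alpha> + H \<alpha>) \<in> ext_power k"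
  unfolding ext_power_def by (simp add: algebra_simps)

lemma ext_power_scale: "F \<in> ext_power k \<Longrightarrow> (\<lambda>\<alpha>. r * F \<alpha>) \<in> ext_power k"
  unfolding ext_power_def by (simp add: algebra_simps)

lemma ext_power_zero: "(\<lambda>\<alpha>. 0) \<in> ext_power k"
  unfolding ext_power_def by simp

lemma ext_power_sum:
  "finite I \<Longrightarrow> (\<And>i. i \<in> I \<Longrightarrow> F i \<in> ext_power k) \<Longrightarrow> (\<lambda>\<alpha>. \<Sum>i\<in>I. x i * F i \<alpha>) \<in> ext_power k"
proof (induction I rule: finite_induct)
  case (insert j I)
  then have "(\<lambda>\<alpha>. x j * F j \<alpha> + (\<Sum>i\<in>I. x i * F i \<alpha>)) \<in> ext_power k"
    by (intro ext_power_add ext_power_scale) auto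
  then show ?case using insert by simp
qed (simp add: ext_power_zero)

lemma ext_norm_nonneg: "ext_norm k p \<Longrightarrow> F \<in> ext_power k \<Longrightarrow> 0 \<le> p F"
  and ext_norm_eq_0_iff: "ext_norm k p \<Longrightarrow> F \<in> ext_power k \<Longrightarrow> p F = 0 \<longleftrightarrow> F = (\<lambda>_. 0)"
  and ext_norm_scale: "ext_norm k p \<Longrightarrow> F \<in> ext_power k \<Longrightarrow> p (\<lambda>\<alpha>. r * F \<alpha>) = \<bar>r\<bar> * p F"
  and ext_norm_triangle: "ext_norm k p \<Longrightarrow> F \<in> ext_power k \<Longrightarrow> H \<in> ext_power k \<Longrightarrow>
    p (\<lambda>\<alpha>. F \<alpha> + H \<alpha>) \<le> p F + p H"
  unfolding ext_norm_def by blast+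

lemma ext_norm_sum:
  assumes p: "ext_norm k p" and "finite I" "\<And>i. i \<in> I \<Longrightarrow> F i \<in> ext_power k"
  shows "p (\<lambda>\<alpha>. \<Sum>i\<in>I. x i * F i \<alpha>) \<le> (\<Sum>i\<in>I. \<bar>x i\<bar> * p (F i))"
  using assms(2,3)
proof (induction I rule: finite_induct)
  case empty
  then show ?case using ext_norm_eq_0_iff[OF p ext_power_zero] by simp
next
  case (insert j I)
  have "p (\<lambda>\<alpha>. x j * F j \<alpha> + (\<Sum>i\<in>I. x i * F i \<alpha>)) \<le> p (\<lambda>\<alpha>. x j * F j \<alpha>) + p (\<lambda>\<alpha>. \<Sum>i\<in>I. x i * F i \<alpha>)"
    by (intro ext_norm_triangle[OF p] ext_power_scale ext_power_sum) (use insert in auto)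
  with insert ext_norm_scale[OF p, of "F j" "x j"] show ?case by simp
qed

text \<open>Slots are freed one at a time: in the claim for \<open>m\<close> the slots from
  \<open>m\<close> on are confined to the finite set \<open>B\<close>. For \<open>m\<close> = 0
  finitely many wedges remain, and each freed slot multiplies the constant by \<open>M\<close>, the
  bound on coordinates with respect to \<open>B\<close>.\<close>

lemma wedge_norm_bound:
  fixes p :: "'b::real_normed_vector multivector \<Rightarrow> real"
  assumes p: "ext_norm k p" and fd: "\<exists>B::'b set. finite B \<and> span B = UNIV"
  shows "\<exists>C\<ge>0. \<forall>v. p (wedge k v) \<le> C * (\<Prod>i<k. norm (v i))"
proof -
  obtain B :: "'b set" where B: "finite B" "span B = UNIV" using fd by blast
  obtain M where M: "M \<ge> 0"
      "\<And>v. \<exists>x. v = (\<Sum>b\<in>B. x b *\<^sub>R b) \<and> (\<Sum>b\<in>B. \<bar>x b\<bar>) \<le> M * norm v"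
    using bounded_coordinates_finite_dim[OF B] by blast
  have "\<exists>C\<ge>0. \<forall>v. (\<forall>i. m \<le> i \<and> i < k \<longrightarrow> v i \<in> B) \<longrightarrow> p (wedge k v) \<le> C * (\<Prod>i<m. norm (v i))"
    if "m \<le> k" for m
    using that
  proof (induction m)
    case 0
    let ?J = "PiE {..<k} (\<lambda>_. B)"
    have fin: "finite ?J" using B(1) by (intro finite_PiE) auto
    let ?C = "\<Sum>J\<in>?J. p (wedge k J)"
    have nn: "0 \<le> p (wedge k J)" for J by (rule ext_norm_nonneg[OF p wedge_in_ext_power])
    have "p (wedge k v) \<le> ?C" if "\<forall>i. 0 \<le> i \<and> i < k \<longrightarrow> v i \<in> B" for v
    proof -
      \<comment> \<open>The restriction is extensional, hence a member of the finite set of index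
        functions; the wedge sees only the first \<open>k\<close> entries.\<close>
      have "wedge k v = wedge k (restrict v {..<k})" by (rule wedge_cong) simp
      moreover have "p (wedge k (restrict v {..<k})) \<le> ?C"
        by (rule member_le_sum[of _ _ "\<lambda>J. p (wedge k J)"]) (use that fin nn in auto)
      ultimately show ?thesis by simp
    qed
    then show ?case using nn by (intro exI[of _ ?C]) (auto intro!: sum_nonneg)
  next
    case (Suc m)
    then obtain C where C: "C \<ge> 0"
        "\<And>v. (\<And>i. m \<le> i \<Longrightarrow> i < k \<Longrightarrow> v i \<in> B) \<Longrightarrow> p (wedge k v) \<le> C * (\<Prod>i<m. norm (v i))"
      by auto
    have "p (wedge k v) \<le> (C * M) * (\<Prod>i<Suc m. norm (v i))"
      if v: "\<forall>i. Suc m \<le> i \<and> i < k \<longrightarrow> v i \<in> B" for v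
    proof -
      obtain x where x: "v m = (\<Sum>b\<in>B. x b *\<^sub>R b)" "(\<Sum>b\<in>B. \<bar>x b\<bar>) \<le> M * norm (v m)"
        using M(2) by blast
      have "p (wedge k v) \<le> (\<Sum>b\<in>B. \<bar>x b\<bar> * p (wedge k (v(m := b))))"
        using wedge_expand[of m k v x B] x(1) Suc.prems ext_norm_sum[OF p B(1), of "\<lambda>b. wedge k (v(m := b))" x]
        by (simp add: wedge_in_ext_power)
      also have "\<dots> \<le> (\<Sum>b\<in>B. \<bar>x b\<bar> * (C * (\<Prod>i<m. norm (v i))))"
      proof (intro sum_mono mult_left_mono)
        fix b assume b: "b \<in> B"
        have "p (wedge k (v(m := b))) \<le> C * (\<Prod>i<m. norm ((v(m := b)) i))"
        proof (rule C(2))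
          fix i assume "m \<le> i" "i < k"
          then show "(v(m := b)) i \<in> B" using b v by (cases "i = m") auto
        qed
        also have "(\<Prod>i<m. norm ((v(m := b)) i)) = (\<Prod>i<m. norm (v i))" by (rule prod.cong) auto
        finally show "p (wedge k (v(m := b))) \<le> C * (\<Prod>i<m. norm (v i))" .
      qed auto
      also have "\<dots> = (\<Sum>b\<in>B. \<bar>x b\<bar>) * (C * (\<Prod>i<m. norm (v i)))" by (simp add: sum_distrib_right)
      also have "\<dots> \<le> (M * norm (v m)) * (C * (\<Prod>i<m. norm (v i)))"
        using x(2) C(1) by (intro mult_right_mono mult_nonneg_nonneg prod_nonneg) auto
      finally show ?thesis by (simp add: algebra_simps)
    qed
    then show ?case using C(1) M(1) by (intro exI[of _ "C * M"]) auto
  qed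
  from this[of k] obtain C where C: "C \<ge> 0"
      "\<forall>v. (\<forall>i. k \<le> i \<and> i < k \<longrightarrow> v i \<in> B) \<longrightarrow> p (wedge k v) \<le> C * (\<Prod>i<k. norm (v i))"
    by blast
  have "p (wedge k v) \<le> C * (\<Prod>i<k. norm (v i))" for v
    by (rule C(2)[rule_format]) auto
  with C(1) show ?thesis by blast
qed

lemma wedge_in_span_basis_wedges:
  fixes v :: "nat \<Rightarrow> 'b::real_normed_vector"
  assumes B: "finite B" "span B = UNIV"
  shows "\<exists>x. wedge k v = (\<lambda>\<alpha>. \<Sum>J\<in>PiE {..<k} (\<lambda>_. B). x J * wedge k J \<alpha>)"
proof -
  let ?J = "PiE {..<k} (\<lambda>_. B)"
  have fin: "finite ?J" using B(1) by (intro finite_PiE) auto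
  have "\<exists>x. wedge k v = (\<lambda>\<alpha>. \<Sum>J\<in>?J. x J * wedge k J \<alpha>)"
    if "m \<le> k" "\<And>i. m \<le> i \<Longrightarrow> i < k \<Longrightarrow> v i \<in> B" for m v
    using that
  proof (induction m arbitrary: v)
    case 0
    let ?v = "restrict v {..<k}"
    have "?v \<in> ?J" using 0 by auto
    then have "wedge k ?v = (\<lambda>\<alpha>. \<Sum>J\<in>?J. (if J = ?v then 1 else 0) * wedge k J \<alpha>)"
      using fin by (simp add: if_distrib[of "\<lambda>c. c * _"] sum.delta cong: if_cong)
    moreover have "wedge k v = wedge k ?v" by (rule wedge_cong) simp
    ultimately have "wedge k v = (\<lambda>\<alpha>. \<Sum>J\<in>?J. (if J = ?v then 1 else 0) * wedge k J \<alpha>)"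
      by (simp only:)
    then show ?case by (intro exI[of _ "\<lambda>J. if J = ?v then 1 else 0"])
  next
    case (Suc m)
    obtain a where a: "v m = (\<Sum>b\<in>B. a b *\<^sub>R b)"
      using bounded_coordinates_finite_dim[OF B] by blast
    have "\<exists>x. wedge k (v(m := b)) = (\<lambda>\<alpha>. \<Sum>J\<in>?J. x J * wedge k J \<alpha>)" if "b \<in> B" for b
    proof (rule Suc.IH)
      fix i assume "m \<le> i" "i < k"
      then show "(v(m := b)) i \<in> B" using that Suc.prems(2)[of i] by (cases "i = m") auto
    qed (use Suc.prems in simp)
    then obtain x where x: "\<And>b. b \<in> B \<Longrightarrow> wedge k (v(m := b)) = (\<lambda>\<alpha>. \<Sum>J\<in>?J. x b J * wedge k J \<alpha>)"
      by metis
    have "wedge k v = (\<lambda>\<alpha>. \<Sum>b\<in>B. a b * wedge k (v(m := b)) \<alpha>)"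
      using Suc.prems(1) by (intro wedge_expand a) simp
    also have "\<dots> = (\<lambda>\<alpha>. \<Sum>J\<in>?J. (\<Sum>b\<in>B. a b * x b J) * wedge k J \<alpha>)"
    proof
      fix \<alpha>
      have "(\<Sum>b\<in>B. a b * wedge k (v(m := b)) \<alpha>) = (\<Sum>b\<in>B. \<Sum>J\<in>?J. a b * x b J * wedge k J \<alpha>)"
        by (intro sum.cong refl) (simp add: x sum_distrib_left mult.assoc)
      also have "\<dots> = (\<Sum>J\<in>?J. \<Sum>b\<in>B. a b * x b J * wedge k J \<alpha>)" by (rule sum.swap)
      finally show "(\<Sum>b\<in>B. a b * wedge k (v(m := b)) \<alpha>) = (\<Sum>J\<in>?J. (\<Sum>b\<in>B. a b * x b J) * wedge k J \<alpha>)"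
        by (simp add: sum_distrib_right)
    qed
    finally show ?case by (intro exI[of _ "\<lambda>J. \<Sum>b\<in>B. a b * x b J"])
  qed
  from this[of k v] show ?thesis by simp
qed

text \<open>Estimating through the entries of \<open>v\<close> would bring in the product of their
  norms, which the norm of the wedge does not control. Instead the wedge is written through wedges
  of elements of \<open>B\<close> with coefficients bounded by its norm; on those finitely many
  wedges the induced map costs at most a constant times \<open>onorm L ^ k\<close>.\<close>

lemma ext_map_norm_bound:
  fixes p :: "'b::real_normed_vector multivector \<Rightarrow> real"
  assumes p: "ext_norm k p" and fd: "\<exists>B::'b set. finite B \<and> span B = UNIV"
  shows "\<exists>C>0. \<forall>L v. bounded_linear L \<longrightarrow>
    p (ext_map k L (wedge k v)) \<le> C * onorm L ^ k * p (wedge k v)"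
proof -
  obtain B :: "'b set" where B: "finite B" "span B = UNIV" using fd by blast
  let ?J = "PiE {..<k} (\<lambda>_. B)"
  have fin: "finite ?J" using B(1) by (intro finite_PiE) auto
  have mem: "(\<lambda>\<alpha>. \<Sum>J\<in>?J. x J * wedge k J \<alpha>) \<in> ext_power k" for x
    by (intro ext_power_sum fin wedge_in_ext_power)
  let ?N = "\<lambda>x. p (\<lambda>\<alpha>. \<Sum>J\<in>?J. x J * wedge k J \<alpha>)"
  interpret coord_seminorm ?N
  proof
    fix x y :: "(nat \<Rightarrow> 'b) \<Rightarrow> real" and r :: real
    show "?N (\<lambda>J. x J + y J) \<le> ?N x + ?N y"
      using ext_norm_triangle[OF p mem mem, of x y] by (simp add: algebra_simps sum.distrib)
    show "?N (\<lambda>J. r * x J) = \<bar>r\<bar> * ?N x"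
      using ext_norm_scale[OF p mem, of r x] by (simp add: sum_distrib_left mult.assoc)
  qed
  obtain M where M: "M \<ge> 0" "\<forall>x. (\<forall>J. J \<notin> ?J \<longrightarrow> x J = 0) \<longrightarrow>
      (\<exists>y. ?N (\<lambda>J. x J - y J) = 0 \<and> (\<Sum>J\<in>?J. \<bar>y J\<bar>) \<le> M * ?N x)"
    by (rule bounded_coordinates_obtain[OF fin]) (rule that)
  obtain C where C: "C \<ge> 0" "\<And>v. p (wedge k v) \<le> C * (\<Prod>i<k. norm (v i))"
    using wedge_norm_bound[OF p fd] by blast
  define D where "D = (\<Sum>b\<in>B. norm b)"
  have D: "D \<ge> 0" "\<And>b. b \<in> B \<Longrightarrow> norm b \<le> D"
    using B(1) by (auto simp: D_def intro: sum_nonneg member_le_sum)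
  have main: "p (ext_map k L (wedge k v)) \<le> (M * C * D ^ k) * onorm L ^ k * p (wedge k v)"
    if L: "bounded_linear L" for L v
  proof -
    note lin = bounded_linear.linear[OF L]
    obtain x where x: "wedge k v = (\<lambda>\<alpha>. \<Sum>J\<in>?J. x J * wedge k J \<alpha>)"
      using wedge_in_span_basis_wedges[OF B] by blast
    define x' where "x' = (\<lambda>J. if J \<in> ?J then x J else 0)"
    have x': "wedge k v = (\<lambda>\<alpha>. \<Sum>J\<in>?J. x' J * wedge k J \<alpha>)"
      unfolding x by (intro ext sum.cong) (auto simp: x'_def)
    obtain y where y: "?N (\<lambda>J. x' J - y J) = 0" "(\<Sum>J\<in>?J. \<bar>y J\<bar>) \<le> M * ?N x'"
    proof -
      have "\<forall>J. J \<notin> ?J \<longrightarrow> x' J = 0" by (simp add: x'_def)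
      from mp[OF spec[OF M(2)] this] show ?thesis by (elim exE conjE) (rule that)
    qed
    \<comment> \<open>\<open>p\<close> is a genuine norm on the exterior power, so a difference in
      the kernel of \<open>?N\<close> vanishes and \<open>y\<close> represents the same element as
      \<open>x'\<close>.\<close>
    have "(\<lambda>\<alpha>. \<Sum>J\<in>?J. (x' J - y J) * wedge k J \<alpha>) = (\<lambda>_. 0)"
      using y(1) ext_norm_eq_0_iff[OF p mem, of "\<lambda>J. x' J - y J"] by (simp only:)
    then have wv: "wedge k v = (\<lambda>\<alpha>. \<Sum>J\<in>?J. y J * wedge k J \<alpha>)"
      unfolding x' by (simp add: fun_eq_iff left_diff_distrib sum_subtractf)
    have "ext_map k L (wedge k v) = (\<lambda>\<alpha>. \<Sum>J\<in>?J. y J * ext_map k L (wedge k J) \<alpha>)"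
      unfolding wv by (auto simp: ext_map_def)
    then have "p (ext_map k L (wedge k v)) \<le> (\<Sum>J\<in>?J. \<bar>y J\<bar> * p (ext_map k L (wedge k J)))"
      using ext_norm_sum[OF p fin, of "\<lambda>J. ext_map k L (wedge k J)" y]
      by (simp add: ext_map_wedge[OF lin] wedge_in_ext_power)
    also have "\<dots> \<le> (\<Sum>J\<in>?J. \<bar>y J\<bar> * (C * (onorm L * D) ^ k))"
    proof (intro sum_mono mult_left_mono)
      fix J assume J: "J \<in> ?J"
      have "p (ext_map k L (wedge k J)) \<le> C * (\<Prod>i<k. norm (L (J i)))"
        using C(2) by (simp add: ext_map_wedge[OF lin])
      also have "(\<Prod>i<k. norm (L (J i))) \<le> (\<Prod>i<k. onorm L * D)"
      proof (rule prod_mono, intro conjI)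
        fix i assume "i \<in> {..<k}"
        then have "norm (J i) \<le> D" using J D(2) by auto
        then show "norm (L (J i)) \<le> onorm L * D"
          using onorm[OF L, of "J i"] onorm_pos_le[OF L] by (meson mult_left_mono order_trans)
      qed simp
      finally show "p (ext_map k L (wedge k J)) \<le> C * (onorm L * D) ^ k"
        using C(1) by (simp add: mult_left_mono)
    qed simp
    also have "\<dots> = (\<Sum>J\<in>?J. \<bar>y J\<bar>) * (C * (onorm L * D) ^ k)" by (simp add: sum_distrib_right)
    also have "\<dots> \<le> (M * p (wedge k v)) * (C * (onorm L * D) ^ k)"
      using y(2) C(1) D(1) onorm_pos_le[OF L] unfolding x'[symmetric] by (intro mult_right_mono) auto
    finally show ?thesis by (simp add: power_mult_distrib algebra_simps)
  qed
  \<comment> \<open>Adding 1 makes the constant positive, so that its logarithm can be taken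
    later.\<close>
  have "p (ext_map k L (wedge k v)) \<le> (M * C * D ^ k + 1) * onorm L ^ k * p (wedge k v)"
    if L: "bounded_linear L" for L v
  proof -
    have "0 \<le> onorm L ^ k * p (wedge k v)"
      using onorm_pos_le[OF L] ext_norm_nonneg[OF p wedge_in_ext_power] by (intro mult_nonneg_nonneg) auto
    then show ?thesis using main[OF L, of v] by (simp add: algebra_simps)
  qed
  moreover have "M * C * D ^ k + 1 > 0" using M(1) C(1) D(1) by (simp add: add_nonneg_pos)
  ultimately show ?thesis by blast
qed

section \<open>The adjoint representation\<close>

lemma is_chart_inj_on: "is_chart T (U, \<phi>) \<Longrightarrow> inj_on \<phi> U"
  and is_chart_openin: "is_chart T (U, \<phi>) \<Longrightarrow> openin T U"
  unfolding is_chart_def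
  using homeomorphic_imp_injective_map[of "subtopology T U" "top_of_set (\<phi> ` U)" \<phi>] openin_subset[of T U]
  by (auto simp: Int_absorb1)

lemma is_chart_open_image:
  assumes ch: "is_chart T (U, \<phi>)" and V: "openin T V" "V \<subseteq> U"
  shows "open (\<phi> ` V)"
proof -
  have h: "homeomorphic_map (subtopology T U) (top_of_set (\<phi> ` U)) \<phi>" and o: "open (\<phi> ` U)"
    using ch by (auto simp: is_chart_def)
  have "openin (subtopology T U) V" using V by (simp add: openin_subtopology_alt Int_absorb1) blast
  then have "openin (top_of_set (\<phi> ` U)) (\<phi> ` V)"
    using homeomorphic_map_openness_eq[OF h] by blast
  then show ?thesis using o by (simp add: openin_open_eq)
qed

context lie_group
begin

lemma atlas_chart: "(U, \<phi>) \<in> A \<Longrightarrow> is_chart T (U, \<phi>)"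
  using atlas unfolding smooth_atlas_def by blast

lemma chart_subset: "(U, \<phi>) \<in> A \<Longrightarrow> U \<subseteq> carrier G"
  using is_chart_openin[OF atlas_chart] openin_subset topspace_eq by metis

lemma obtain_chart:
  assumes "g \<in> carrier G"
  obtains V \<psi> where "(V, \<psi>) \<in> A" "g \<in> V"
proof -
  have "g \<in> (\<Union>c\<in>A. fst c)" using atlas assms topspace_eq unfolding smooth_atlas_def by simp
  then show thesis using that by fastforce
qed

lemma chart_inv_into: "(U, \<phi>) \<in> A \<Longrightarrow> x \<in> U \<Longrightarrow> inv_into U \<phi> (\<phi> x) = x"
  using is_chart_inj_on[OF atlas_chart] by (rule inv_into_f_f)

text \<open>Smoothness of multiplication refers to the product chart and its inverse on the product
  domain. That inverse splits into the two separate inverses on the image of the chart, which is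
  open, and a derivative depends on values in such a neighbourhood only.\<close>

lemma smooth_mult_charts:
  assumes "(U, \<phi>) \<in> A" "(V, \<psi>) \<in> A" "(W, \<rho>) \<in> A" "x \<in> U" "y \<in> V" "x \<otimes> y \<in> W"
  shows "(\<lambda>z. \<rho> (inv_into U \<phi> (fst z) \<otimes> inv_into V \<psi> (snd z))) differentiable (at (\<phi> x, \<psi> y))"
proof -
  let ?f = "\<lambda>z. \<rho> ((\<lambda>(x, y). x \<otimes> y) (inv_into (U \<times> V) (map_prod \<phi> \<psi>) z))"
  let ?S = "map_prod \<phi> \<psi> ` {p \<in> U \<times> V. (\<lambda>(x, y). x \<otimes> y) p \<in> W}"
  have mem: "(U \<times> V, map_prod \<phi> \<psi>) \<in> prod_atlas A A" using assms by (auto simp: prod_atlas_def)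
  have "smooth_on ?S ?f"
    using smooth_mult mem assms(3) unfolding smooth_mfd_map_def by blast
  then have "Cn_on (Suc 0) ?S ?f" unfolding smooth_on_def by blast
  then have "\<forall>z\<in>?S. ?f differentiable (at z)" by simp
  moreover have "map_prod \<phi> \<psi> (x, y) \<in> ?S" using assms by (intro imageI) simp
  ultimately have "?f differentiable (at (map_prod \<phi> \<psi> (x, y)))" by (rule bspec)
  then have "?f differentiable (at (\<phi> x, \<psi> y))" by simp
  then obtain D where "(?f has_derivative D) (at (\<phi> x, \<psi> y))" unfolding differentiable_def by blast
  moreover have "open (\<phi> ` U \<times> \<psi> ` V)"
    using atlas_chart[OF assms(1)] atlas_chart[OF assms(2)] by (auto simp: is_chart_def intro: open_Times)
  moreover have "(\<phi> x, \<psi> y) \<in> \<phi> ` U \<times> \<psi> ` V" using assms by simp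
  moreover have "?f z = \<rho> (inv_into U \<phi> (fst z) \<otimes> inv_into V \<psi> (snd z))" if "z \<in> \<phi> ` U \<times> \<psi> ` V" for z
  proof -
    obtain a b where ab: "a \<in> U" "b \<in> V" "z = (\<phi> a, \<psi> b)" using \<open>z \<in> _\<close> by auto
    have inj: "inj_on (map_prod \<phi> \<psi>) (U \<times> V)"
      using is_chart_inj_on[OF atlas_chart] assms by (intro map_prod_inj_on) auto
    have "inv_into (U \<times> V) (map_prod \<phi> \<psi>) z = (a, b)"
      using inv_into_f_f[OF inj, of "(a, b)"] ab by simp
    then show ?thesis using ab chart_inv_into assms by simp
  qed
  ultimately have "((\<lambda>z. \<rho> (inv_into U \<phi> (fst z) \<otimes> inv_into V \<psi> (snd z))) has_derivative D) (at (\<phi> x, \<psi> y))"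
    by (rule has_derivative_transform_within_open)
  then show ?thesis unfolding differentiable_def by blast
qed

lemma continuous_mult: "continuous_map (prod_topology T T) T (\<lambda>(x, y). x \<otimes> y)"
  using smooth_mult unfolding smooth_mfd_map_def by blast

lemma continuous_left_mult: "g \<in> carrier G \<Longrightarrow> continuous_map T T (\<lambda>x. g \<otimes> x)"
  using continuous_map_compose[OF _ continuous_mult, of T "\<lambda>x. (g, x)"] topspace_eq
  by (simp add: o_def continuous_map_pairwise)

lemma continuous_right_mult: "g \<in> carrier G \<Longrightarrow> continuous_map T T (\<lambda>x. x \<otimes> g)"
  using continuous_map_compose[OF _ continuous_mult, of T "\<lambda>x. (x, g)"] topspace_eq
  by (simp add: o_def continuous_map_pairwise)

lemma continuous_conj:
  assumes "g \<in> carrier G"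
  shows "continuous_map T T (\<lambda>x. g \<otimes> x \<otimes> inv g)"
  using continuous_map_compose[OF continuous_left_mult[OF assms] continuous_right_mult[of "inv g"]] assms
  by (simp add: o_def)

lemma open_chart_preimage:
  assumes "(U, \<phi>) \<in> A" "continuous_map T T f" "openin T V"
  shows "open (\<phi> ` {x \<in> U. f x \<in> V})"
proof (rule is_chart_open_image[OF atlas_chart[OF assms(1)]])
  have "{x \<in> U. f x \<in> V} = U \<inter> {x \<in> topspace T. f x \<in> V}"
    using chart_subset[OF assms(1)] topspace_eq by auto
  also have "openin T \<dots>"
    by (intro openin_Int is_chart_openin[OF atlas_chart[OF assms(1)]] openin_continuous_map_preimage[OF assms(2,3)])
  finally show "openin T {x \<in> U. f x \<in> V}" .
qed auto

context
  fixes U \<phi> assumes U: "(U, \<phi>) \<in> A" "\<one> \<in> U"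
begin

text \<open>\<open>frechet_derivative\<close> is a choice operator, so \<open>Ad\<close> means
  something only once differentiability is known. Conjugation is split into left multiplication by
  \<open>g\<close> and right multiplication by \<open>inv g\<close>, passing through a chart at
  \<open>g\<close>; each factor is the group multiplication with one argument frozen.\<close>

lemma Ad_has_derivative:
  assumes g: "g \<in> carrier G"
  shows "((\<lambda>z. \<phi> (g \<otimes> inv_into U \<phi> z \<otimes> inv g)) has_derivative Ad G (U, \<phi>) g) (at (\<phi> \<one>))"
proof -
  have g': "inv g \<in> carrier G" using g by simp
  obtain V \<psi> where V: "(V, \<psi>) \<in> A" "g \<in> V" using obtain_chart[OF g] .
  obtain W \<rho> where W: "(W, \<rho>) \<in> A" "inv g \<in> W" using obtain_chart[OF g'] .
  have "(\<lambda>z. \<psi> (inv_into V \<psi> (fst z) \<otimes> inv_into U \<phi> (snd z))) differentiable (at (\<psi> g, \<phi> \<one>))"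
    by (rule smooth_mult_charts) (use U V g in auto)
  then obtain D1 where D1: "((\<lambda>z. \<psi> (inv_into V \<psi> (fst z) \<otimes> inv_into U \<phi> (snd z))) has_derivative D1) (at (\<psi> g, \<phi> \<one>))"
    unfolding differentiable_def by blast
  have "((\<lambda>z. (\<psi> g, z)) has_derivative (\<lambda>z. (0, z))) (at (\<phi> \<one>))"
    by (auto intro!: derivative_eq_intros)
  from has_derivative_compose[OF this D1]
  have L: "((\<lambda>z. \<psi> (g \<otimes> inv_into U \<phi> z)) has_derivative (\<lambda>z. D1 (0, z))) (at (\<phi> \<one>))"
    using V by (simp add: chart_inv_into)
  have "(\<lambda>z. \<phi> (inv_into V \<psi> (fst z) \<otimes> inv_into W \<rho> (snd z))) differentiable (at (\<psi> g, \<rho> (inv g)))"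
    by (rule smooth_mult_charts) (use U V W g in auto)
  then obtain D2 where D2: "((\<lambda>z. \<phi> (inv_into V \<psi> (fst z) \<otimes> inv_into W \<rho> (snd z))) has_derivative D2) (at (\<psi> g, \<rho> (inv g)))"
    unfolding differentiable_def by blast
  have "((\<lambda>z. (z, \<rho> (inv g))) has_derivative (\<lambda>z. (z, 0))) (at (\<psi> g))"
    by (auto intro!: derivative_eq_intros)
  from has_derivative_compose[OF this D2]
  have R: "((\<lambda>z. \<phi> (inv_into V \<psi> z \<otimes> inv g)) has_derivative (\<lambda>z. D2 (z, 0))) (at (\<psi> g))"
    using W by (simp add: chart_inv_into)
  have at: "\<psi> (g \<otimes> inv_into U \<phi> (\<phi> \<one>)) = \<psi> g" using U g by (simp add: chart_inv_into)
  have "((\<lambda>z. \<phi> (inv_into V \<psi> (\<psi> (g \<otimes> inv_into U \<phi> z)) \<otimes> inv g)) has_derivative (\<lambda>z. D2 (D1 (0, z), 0))) (at (\<phi> \<one>))"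
    using has_derivative_compose[OF L, of "\<lambda>z. \<phi> (inv_into V \<psi> z \<otimes> inv g)" "\<lambda>z. D2 (z, 0)"] R at by simp
  \<comment> \<open>The intermediate chart is inverted correctly where \<open>g \<otimes> x\<close>
    stays in \<open>V\<close>; this neighbourhood of the identity is enough for the
    derivative.\<close>
  moreover have "open (\<phi> ` {x \<in> U. g \<otimes> x \<in> V})"
    by (rule open_chart_preimage[OF U(1) continuous_left_mult[OF g] is_chart_openin[OF atlas_chart[OF V(1)]]])
  moreover have "\<phi> \<one> \<in> \<phi> ` {x \<in> U. g \<otimes> x \<in> V}" using U V g by auto
  moreover have "\<phi> (inv_into V \<psi> (\<psi> (g \<otimes> inv_into U \<phi> z)) \<otimes> inv g) = \<phi> (g \<otimes> inv_into U \<phi> z \<otimes> inv g)"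
    if z: "z \<in> \<phi> ` {x \<in> U. g \<otimes> x \<in> V}" for z
  proof -
    obtain x where "z = \<phi> x" "x \<in> U" "g \<otimes> x \<in> V" using z by auto
    then show ?thesis using U V by (simp add: chart_inv_into)
  qed
  ultimately have "((\<lambda>z. \<phi> (g \<otimes> inv_into U \<phi> z \<otimes> inv g)) has_derivative (\<lambda>z. D2 (D1 (0, z), 0))) (at (\<phi> \<one>))"
    by (rule has_derivative_transform_within_open)
  then show ?thesis
    unfolding Ad_def prod.case using frechet_derivative_works differentiableI by blast
qed

lemma bounded_linear_Ad: "g \<in> carrier G \<Longrightarrow> bounded_linear (Ad G (U, \<phi>) g)"
  by (rule has_derivative_bounded_linear[OF Ad_has_derivative])

text \<open>The chain rule: the two conjugations compose to the one by \<open>g \<otimes> h\<close>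
  as long as the inner one stays in the chart, which holds near the identity by continuity.\<close>

lemma Ad_mult:
  assumes g: "g \<in> carrier G" and h: "h \<in> carrier G"
  shows "Ad G (U, \<phi>) (g \<otimes> h) = (\<lambda>v. Ad G (U, \<phi>) g (Ad G (U, \<phi>) h v))"
proof -
  let ?\<kappa> = "\<lambda>g z. \<phi> (g \<otimes> inv_into U \<phi> z \<otimes> inv g)"
  have "?\<kappa> h (\<phi> \<one>) = \<phi> \<one>" using U h by (simp add: chart_inv_into)
  then have "((\<lambda>z. ?\<kappa> g (?\<kappa> h z)) has_derivative (\<lambda>v. Ad G (U, \<phi>) g (Ad G (U, \<phi>) h v))) (at (\<phi> \<one>))"
    using has_derivative_compose[OF Ad_has_derivative[OF h], of "?\<kappa> g" "Ad G (U, \<phi>) g"] Ad_has_derivative[OF g]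
    by simp
  moreover have "open (\<phi> ` {x \<in> U. h \<otimes> x \<otimes> inv h \<in> U})"
    by (rule open_chart_preimage[OF U(1) continuous_conj[OF h] is_chart_openin[OF atlas_chart[OF U(1)]]])
  moreover have "\<phi> \<one> \<in> \<phi> ` {x \<in> U. h \<otimes> x \<otimes> inv h \<in> U}" using U h by auto
  moreover have "?\<kappa> g (?\<kappa> h z) = ?\<kappa> (g \<otimes> h) z" if z: "z \<in> \<phi> ` {x \<in> U. h \<otimes> x \<otimes> inv h \<in> U}" for z
  proof -
    obtain x where x: "z = \<phi> x" "x \<in> U" "h \<otimes> x \<otimes> inv h \<in> U" using z by auto
    then have "x \<in> carrier G" using chart_subset[OF U(1)] by blast
    then have "g \<otimes> (h \<otimes> x \<otimes> inv h) \<otimes> inv g = (g \<otimes> h) \<otimes> x \<otimes> inv (g \<otimes> h)"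
      using g h by (simp add: inv_mult_group m_assoc)
    then show ?thesis using x U by (simp add: chart_inv_into)
  qed
  ultimately have "(?\<kappa> (g \<otimes> h) has_derivative (\<lambda>v. Ad G (U, \<phi>) g (Ad G (U, \<phi>) h v))) (at (\<phi> \<one>))"
    by (rule has_derivative_transform_within_open)
  with Ad_has_derivative[of "g \<otimes> h"] g h show ?thesis
    by (intro has_derivative_unique[of "?\<kappa> (g \<otimes> h)" _ "\<phi> \<one>"]) auto
qed

lemma Ad_one: "Ad G (U, \<phi>) \<one> = (\<lambda>v. v)"
proof -
  have "((\<lambda>z. z) has_derivative (\<lambda>v. v)) (at (\<phi> \<one>))" by (rule has_derivative_ident)
  moreover have "open (\<phi> ` U)" using atlas_chart[OF U(1)] by (simp add: is_chart_def)
  moreover have "\<phi> \<one> \<in> \<phi> ` U" using U by simp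
  moreover have "z = \<phi> (\<one> \<otimes> inv_into U \<phi> z \<otimes> inv \<one>)" if z: "z \<in> \<phi> ` U" for z
  proof -
    obtain x where x: "z = \<phi> x" "x \<in> U" using z by auto
    then show ?thesis using U chart_subset[OF U(1)] by (simp add: chart_inv_into subset_iff)
  qed
  ultimately have "((\<lambda>z. \<phi> (\<one> \<otimes> inv_into U \<phi> z \<otimes> inv \<one>)) has_derivative (\<lambda>v. v)) (at (\<phi> \<one>))"
    by (rule has_derivative_transform_within_open)
  with Ad_has_derivative[of \<one>] show ?thesis
    by (intro has_derivative_unique[of "\<lambda>z. \<phi> (\<one> \<otimes> inv_into U \<phi> z \<otimes> inv \<one>)" _ "\<phi> \<one>"]) auto
qed

lemma Ad_inv_left: "g \<in> carrier G \<Longrightarrow> Ad G (U, \<phi>) (inv g) (Ad G (U, \<phi>) g v) = v"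
  using fun_cong[OF Ad_mult[of "inv g" g], of v] by (simp add: Ad_one)

lemma Ad_inv_right: "g \<in> carrier G \<Longrightarrow> Ad G (U, \<phi>) g (Ad G (U, \<phi>) (inv g) v) = v"
  using fun_cong[OF Ad_mult[of g "inv g"], of v] by (simp add: Ad_one)

lemma Ad_size_eq:
  assumes "g \<in> carrier G"
  shows "Ad_size G (U, \<phi>) g = max (onorm (Ad G (U, \<phi>) g)) (onorm (Ad G (U, \<phi>) (inv g)))"
proof -
  have "inv_into UNIV (Ad G (U, \<phi>) g) = Ad G (U, \<phi>) (inv g)"
    by (rule Hilbert_Choice.inv_equality) (use assms in \<open>auto simp: Ad_inv_left Ad_inv_right\<close>)
  then show ?thesis by (simp add: Ad_size_def)
qed

lemma onorm_Ad_inv_le: "g \<in> carrier G \<Longrightarrow> onorm (Ad G (U, \<phi>) (inv g)) \<le> Ad_size G (U, \<phi>) g"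
  by (simp add: Ad_size_eq)

text \<open>The identity is the composition of \<open>Ad\<close> of \<open>g\<close> and of its
  inverse, so one of them has operator norm at least 1. On the zero space both norms would be 0,
  whence the nonzero vector. The bound makes ln N(g) nonnegative.\<close>

lemma Ad_size_ge_1:
  assumes g: "g \<in> carrier G" and nontriv: "\<exists>v::'b. v \<noteq> 0"
  shows "1 \<le> Ad_size G (U, \<phi>) g"
proof -
  obtain v :: 'b where "v \<noteq> 0" using nontriv by blast
  let ?a = "onorm (Ad G (U, \<phi>) g)" and ?b = "onorm (Ad G (U, \<phi>) (inv g))"
  have bl: "bounded_linear (Ad G (U, \<phi>) g)" "bounded_linear (Ad G (U, \<phi>) (inv g))"
    using g by (auto intro: bounded_linear_Ad)
  have "norm v = norm (Ad G (U, \<phi>) (inv g) (Ad G (U, \<phi>) g v))" using g by (simp add: Ad_inv_left)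
  also have "\<dots> \<le> ?b * norm (Ad G (U, \<phi>) g v)" by (rule onorm[OF bl(2)])
  also have "\<dots> \<le> ?b * (?a * norm v)" by (intro mult_left_mono onorm bl onorm_pos_le)
  finally have "1 \<le> ?b * ?a" using \<open>v \<noteq> 0\<close> by simp
  moreover have "?b * ?a \<le> max ?a ?b * max ?a ?b"
    by (intro mult_mono) (auto intro: onorm_pos_le bl simp: le_max_iff_disj)
  ultimately have "1 \<le> (Ad_size G (U, \<phi>) g)\<^sup>2" using Ad_size_eq[OF g] by (simp add: power2_eq_square)
  moreover have "0 \<le> Ad_size G (U, \<phi>) g"
    using onorm_pos_le[OF bl(1)] Ad_size_eq[OF g] by simp
  ultimately show ?thesis by (metis one_power2 power2_le_imp_le)
qed

end

lemma left_prod_closed: "(\<And>i. b i \<in> carrier G) \<Longrightarrow> left_prod G b n \<in> carrier G"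
  by (induction n) auto

lemma left_prod_add:
  assumes "\<And>i. b i \<in> carrier G"
  shows "left_prod G b (m + n) = left_prod G (\<lambda>i. b (m + i)) n \<otimes> left_prod G b m"
  by (induction n) (simp_all add: assms left_prod_closed m_assoc)

text \<open>Submultiplicativity of the operator norm. The inverse product is estimated because norms
  are pulled back from later to earlier times.\<close>

lemma onorm_Ad_inv_left_prod_le:
  assumes U: "(U, \<phi>) \<in> A" "\<one> \<in> U" and b: "\<And>i. b i \<in> carrier G" and nontriv: "\<exists>v::'b. v \<noteq> 0"
  shows "onorm (Ad G (U, \<phi>) (inv (left_prod G b n))) \<le> exp (\<Sum>i<n. ln (Ad_size G (U, \<phi>) (b i)))"
proof (induction n)
  case 0
  have "onorm (\<lambda>v::'b. v) \<le> 1" by (rule onorm_bound) auto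
  then show ?case by (simp add: Ad_one[OF U])
next
  case (Suc n)
  let ?p = "left_prod G b n"
  have p: "?p \<in> carrier G" by (rule left_prod_closed[OF b])
  have eq: "inv (b n \<otimes> ?p) = inv ?p \<otimes> inv (b n)" using p b by (simp add: inv_mult_group)
  have "onorm (Ad G (U, \<phi>) (inv (b n \<otimes> ?p))) \<le> onorm (Ad G (U, \<phi>) (inv ?p)) * onorm (Ad G (U, \<phi>) (inv (b n)))"
    unfolding eq using onorm_compose[of "Ad G (U, \<phi>) (inv ?p)" "Ad G (U, \<phi>) (inv (b n))"] p b
    by (simp add: Ad_mult[OF U] bounded_linear_Ad[OF U] o_def)
  also have "\<dots> \<le> exp (\<Sum>i<n. ln (Ad_size G (U, \<phi>) (b i))) * Ad_size G (U, \<phi>) (b n)"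
    by (intro mult_mono Suc.IH onorm_Ad_inv_le[OF U b] onorm_pos_le bounded_linear_Ad[OF U]) (use b in auto)
  also have "Ad_size G (U, \<phi>) (b n) = exp (ln (Ad_size G (U, \<phi>) (b n)))"
    using Ad_size_ge_1[OF U b nontriv, of n] by simp
  finally show ?case by (simp add: exp_add)
qed

end

section \<open>Excursions of a recurrent Markov chain\<close>

abbreviation seq_space :: "(nat \<Rightarrow> 'a) measure" where
  "seq_space \<equiv> PiM UNIV (\<lambda>_. count_space UNIV)"

section \<open>Laws on sequences over a countable alphabet\<close>

lemma measurable_segment:
  "(\<lambda>\<omega>. map \<omega> [a..<b]) \<in> measurable (seq_space :: (nat \<Rightarrow> 'a::countable) measure) (count_space UNIV)"
proof -
  have "(\<lambda>\<omega>. map \<omega> [a..<b]) -` {l} \<inter> space seq_space \<in> sets (seq_space :: (nat \<Rightarrow> 'a) measure)" for l :: "'a list"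
  proof -
    have "(\<lambda>\<omega>. map \<omega> [a..<b]) -` {l} \<inter> space seq_space =
        {\<omega> \<in> space seq_space. length l = b - a \<and> (\<forall>i\<in>{..<b - a}. \<omega> (a + i) = l ! i)}"
      by (auto simp: list_eq_iff_nth_eq space_PiM)
    also have "\<dots> \<in> sets seq_space" by measurable
    finally show ?thesis .
  qed
  then show ?thesis by (simp add: measurable_count_space_eq2_countable)
qed

text \<open>Lists over a countable alphabet form a countable discrete space, so an arbitrary
  function \<open>h\<close> of an initial segment is measurable.\<close>

lemma measurable_of_segment:
  fixes f :: "(nat \<Rightarrow> 'a::countable) \<Rightarrow> 'c"
  assumes "\<And>x. f x = h (map x [0..<n])" "\<And>l. h l \<in> space N"
  shows "f \<in> measurable seq_space N"
proof -
  have "h \<in> measurable (count_space UNIV) N" using assms(2) by auto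
  moreover have "f = (\<lambda>x. h (map x [0..<n]))" using assms(1) by (rule ext)
  ultimately show ?thesis using measurable_compose[OF measurable_segment[of 0 n]] by (simp only:)
qed

text \<open>Both total masses are 1 and the inequality passes to the complement of a point, so a
  strict loss at one point could not be made up elsewhere.\<close>

lemma prob_measure_eqI_countable_le:
  fixes M N :: "'a::countable measure"
  assumes M: "prob_space M" "sets M = UNIV" and N: "prob_space N" "sets N = UNIV"
    and le: "\<And>a. emeasure N {a} \<le> emeasure M {a}"
  shows "M = N"
proof -
  interpret M: prob_space M by fact
  interpret N: prob_space N by fact
  have sp: "space M = UNIV" "space N = UNIV"
    using M(2) N(2) by (metis UNIV_I sets.sets_into_space top.extremum_unique)+
  have le': "emeasure N A \<le> emeasure M A" for A
    by (subst (1 2) emeasure_countable_singleton) (auto simp: M N intro!: nn_integral_mono le)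
  have "measure N {a} = measure M {a}" for a
  proof -
    have "measure N {a} \<le> measure M {a}" "measure N (- {a}) \<le> measure M (- {a})"
      using le'[of "{a}"] le'[of "- {a}"] by (simp_all add: M.emeasure_eq_measure N.emeasure_eq_measure)
    moreover have "measure N (- {a}) = 1 - measure N {a}" "measure M (- {a}) = 1 - measure M {a}"
      using M.prob_compl[of "{a}"] N.prob_compl[of "{a}"] by (simp_all add: M N sp Compl_eq_Diff_UNIV)
    ultimately show ?thesis by linarith
  qed
  then show ?thesis
    by (intro measure_eqI_countable[of _ UNIV]) (auto simp: M N M.emeasure_eq_measure N.emeasure_eq_measure)
qed

text \<open>The discrete comparison is applied to the law of each initial segment, and every
  finite-dimensional box is an event about such a segment.\<close>

lemma seq_measure_eqI_cylinder_le:
  fixes M N :: "(nat \<Rightarrow> 'a::countable) measure"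
  assumes M: "prob_space M" "sets M = sets seq_space" and N: "prob_space N" "sets N = sets seq_space"
    and le: "\<And>l. emeasure N {x. map x [0..<length l] = l} \<le> emeasure M {x. map x [0..<length l] = l}"
  shows "M = N"
proof (rule measure_eqI_PiM_infinite[OF M(2) N(2)])
  show "finite_measure M" using M(1) by (simp add: prob_space_def)
  have spM: "space M = UNIV" "space N = UNIV"
    using M(2) N(2) by (auto dest!: sets_eq_imp_space_eq simp: space_PiM)
  have seg [measurable]: "(\<lambda>x. map x [0..<n]) \<in> measurable M (count_space UNIV)"
      "(\<lambda>x. map x [0..<n]) \<in> measurable N (count_space UNIV)" for n
    using measurable_segment[of 0 n]
    by (simp_all only: measurable_cong_sets[OF M(2) refl] measurable_cong_sets[OF N(2) refl])
  have eq: "distr M (count_space UNIV) (\<lambda>x. map x [0..<n]) = distr N (count_space UNIV) (\<lambda>x. map x [0..<n])" for n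
  proof (rule prob_measure_eqI_countable_le)
    show "prob_space (distr M (count_space UNIV) (\<lambda>x. map x [0..<n]))"
      by (rule prob_space.prob_space_distr[OF M(1) seg(1)])
    show "prob_space (distr N (count_space UNIV) (\<lambda>x. map x [0..<n]))"
      by (rule prob_space.prob_space_distr[OF N(1) seg(2)])
    fix l :: "'a list"
    show "emeasure (distr N (count_space UNIV) (\<lambda>x. map x [0..<n])) {l}
        \<le> emeasure (distr M (count_space UNIV) (\<lambda>x. map x [0..<n])) {l}"
    \<comment> \<open>The assumption at \<open>l\<close> speaks of segments as long as
      \<open>l\<close>; lists of another length have mass 0 on both sides.\<close>
    proof (cases "length l = n")
      case True
      then show ?thesis using le[of l] by (simp add: emeasure_distr spM vimage_def)
    next
      case False
      then have "(\<lambda>x. map x [0..<n]) -` {l} = {}" by auto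
      then show ?thesis by (simp add: emeasure_distr)
    qed
  qed auto
  fix A :: "nat \<Rightarrow> 'a set" and J :: "nat set"
  assume "finite J"
  then obtain n where n: "J \<subseteq> {..<n}" using finite_nat_bounded by blast
  let ?B = "{l. \<forall>j\<in>J. l ! j \<in> A j}"
  have "prod_emb UNIV (\<lambda>_. count_space UNIV) J (PiE J A) = (\<lambda>x. map x [0..<n]) -` ?B"
    using n by (auto simp: prod_emb_def PiE_iff subset_eq)
  then show "emeasure M (prod_emb UNIV (\<lambda>_. count_space UNIV) J (PiE J A)) =
      emeasure N (prod_emb UNIV (\<lambda>_. count_space UNIV) J (PiE J A))"
    using arg_cong[OF eq[of n], of "\<lambda>D. emeasure D ?B"] by (simp add: emeasure_distr spM)
qed

subsection \<open>Path probabilities\<close>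

fun path_weight :: "('e \<Rightarrow> 'e pmf) \<Rightarrow> 'e list \<Rightarrow> real" where
  "path_weight K (x # y # zs) = pmf (K x) y * path_weight K (y # zs)"
| "path_weight K _ = 1"

lemma path_weight_nonneg: "0 \<le> path_weight K l"
  by (induction K l rule: path_weight.induct) auto

text \<open>The shared state \<open>y\<close> ends the first path and starts the second.
  Multiplicativity there is the Markov property in terms of weights.\<close>

lemma path_weight_append: "path_weight K (xs @ y # zs) = path_weight K (xs @ [y]) * path_weight K (y # zs)"
  by (induction K xs rule: path_weight.induct) auto

lemma path_weight_snoc: "l \<noteq> [] \<Longrightarrow> path_weight K (l @ [y]) = path_weight K l * pmf (K (last l)) y"
  by (induction K l rule: path_weight.induct) auto

lemma path_weight_eq_prod:
  "l \<noteq> [] \<Longrightarrow> path_weight K l = (\<Prod>i<length l - 1. pmf (K (l ! i)) (l ! Suc i))"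
  by (induction K l rule: path_weight.induct) (auto simp: prod.lessThan_Suc_shift simp del: prod.lessThan_Suc)

lemma prob_space_markov_measure:
  fixes K :: "'e::countable \<Rightarrow> 'e pmf"
  shows "prob_space (markov_measure K e)"
proof -
  interpret IT: Ionescu_Tulcea "markov_step K e" "\<lambda>_. count_space UNIV"
    by (rule Ionescu_Tulcea_markov)
  have "prob_space (distr (markov_measure K e) (PiM {} (\<lambda>_. count_space UNIV)) (\<lambda>x. restrict x {}))"
    unfolding markov_measure_def IT.distr_lim[OF finite.emptyI] by (rule IT.PF.prob_space_P) auto
  moreover have "(\<lambda>x. restrict x {}) \<in> measurable (markov_measure K e) (PiM {} (\<lambda>_. count_space UNIV))"
    by (simp only: measurable_cong_sets[OF sets_markov_measure refl]) (rule measurable_restrict_subset, simp)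
  ultimately show ?thesis by (metis prob_space_distrD)
qed

lemma space_markov_measure: "space (markov_measure (K :: 'e::countable \<Rightarrow> 'e pmf) e) = UNIV"
  using sets_eq_imp_space_eq[OF sets_markov_measure[of K e]] by (simp add: space_PiM)

lemma measurable_markov_measure:
  "measurable (markov_measure (K :: 'e::countable \<Rightarrow> 'e pmf) e) N = measurable seq_space N"
  by (rule measurable_cong_sets[OF sets_markov_measure refl])

lemma emeasure_markov_segment:
  fixes K :: "'e::countable \<Rightarrow> 'e pmf"
  assumes "l \<noteq> []"
  shows "emeasure (markov_measure K e) {\<omega>. map \<omega> [0..<length l] = l} =
    (if hd l = e then ennreal (path_weight K l) else 0)"
proof -
  have "{\<omega>. map \<omega> [0..<length l] = l} = {\<omega>. \<forall>i\<le>length l - 1. \<omega> i = l ! i}"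
  proof (rule Collect_cong)
    fix \<omega> :: "nat \<Rightarrow> 'e"
    have "i < length l \<longleftrightarrow> i \<le> length l - 1" for i using assms by (cases l) auto
    then show "map \<omega> [0..<length l] = l \<longleftrightarrow> (\<forall>i\<le>length l - 1. \<omega> i = l ! i)"
      using list_eq_iff_nth_eq[of "map \<omega> [0..<length l]" l] by simp
  qed
  then show ?thesis
    using assms emeasure_markov_cylinder[of K e "length l - 1" "\<lambda>i. l ! i"]
    by (simp add: path_weight_eq_prod hd_conv_nth prod_ennreal)
qed

text \<open>A discrete model of the first \<open>n\<close> + 1 states, grown at its end so that the
  last step can be integrated out; \<open>distr_markov_segment\<close> identifies it.\<close>

primrec path_pmf :: "('e \<Rightarrow> 'e pmf) \<Rightarrow> 'e \<Rightarrow> nat \<Rightarrow> 'e list pmf" where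
  "path_pmf K e 0 = return_pmf [e]"
| "path_pmf K e (Suc n) = bind_pmf (path_pmf K e n) (\<lambda>l. map_pmf (\<lambda>y. l @ [y]) (K (last l)))"

lemma set_path_pmf: "l \<in> set_pmf (path_pmf K e n) \<Longrightarrow> length l = Suc n \<and> hd l = e"
proof (induction n arbitrary: l)
  case (Suc n)
  then obtain m y where "m \<in> set_pmf (path_pmf K e n)" "l = m @ [y]" by auto
  with Suc.IH[of m] show ?case by (cases m) auto
qed simp

lemma pmf_path_pmf:
  "pmf (path_pmf K e n) l = (if length l = Suc n \<and> hd l = e then path_weight K l else 0)"
proof (induction n arbitrary: l)
  case 0
  show ?case by (cases l) (auto simp: length_Suc_conv)
next
  case (Suc n)
  show ?case
  proof (cases "length l = Suc (Suc n)")
    case False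
    then have "l \<notin> set_pmf (path_pmf K e (Suc n))" using set_path_pmf by metis
    then have "pmf (path_pmf K e (Suc n)) l = 0" unfolding set_pmf_iff by simp
    then show ?thesis using False by simp
  next
    case True
    then obtain l' y where l: "l = l' @ [y]" by (cases l rule: rev_cases) auto
    with True have l': "length l' = Suc n" "l' \<noteq> []" by auto
    have "pmf (map_pmf (\<lambda>y. m @ [y]) (K (last m))) l = indicator {l'} m * pmf (K (last l')) y" for m
    proof (cases "m = l'")
      case True
      have "pmf (map_pmf (\<lambda>y. l' @ [y]) (K (last l'))) (l' @ [y]) = pmf (K (last l')) y"
        by (rule pmf_map_inj') (simp add: inj_def)
      then show ?thesis using True l by simp
    next
      case False
      then have "l \<notin> set_pmf (map_pmf (\<lambda>y. m @ [y]) (K (last m)))" using l by auto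
      then have "pmf (map_pmf (\<lambda>y. m @ [y]) (K (last m))) l = 0" unfolding set_pmf_iff by simp
      then show ?thesis using False by simp
    qed
    then have "pmf (path_pmf K e (Suc n)) l = pmf (path_pmf K e n) l' * pmf (K (last l')) y"
      by (simp add: pmf_bind measure_pmf_single)
    then show ?thesis using True Suc.IH[of l'] l l' by (simp add: path_weight_snoc)
  qed
qed

lemma distr_markov_segment:
  fixes K :: "'e::countable \<Rightarrow> 'e pmf"
  shows "distr (markov_measure K e) (count_space UNIV) (\<lambda>\<omega>. map \<omega> [0..<Suc n]) = measure_pmf (path_pmf K e n)"
proof (rule measure_eqI_countable[of _ UNIV])
  let ?f = "\<lambda>\<omega>::nat \<Rightarrow> 'e. map \<omega> [0..<Suc n]"
  have [measurable]: "?f \<in> measurable (markov_measure K e) (count_space UNIV)"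
    unfolding measurable_markov_measure by (rule measurable_segment)
  fix l :: "'e list"
  show "emeasure (distr (markov_measure K e) (count_space UNIV) ?f) {l} = emeasure (measure_pmf (path_pmf K e n)) {l}"
  proof (cases "length l = Suc n")
    case True
    then have "l \<noteq> []" by auto
    then show ?thesis
      using emeasure_markov_segment[of l K e] True
      by (simp add: emeasure_distr space_markov_measure vimage_def emeasure_pmf_single pmf_path_pmf del: upt_Suc)
  next
    case False
    then have "?f -` {l} = {}" by (auto simp del: upt_Suc)
    then show ?thesis using False by (simp add: emeasure_distr emeasure_pmf_single pmf_path_pmf del: upt_Suc)
  qed
qed auto

subsection \<open>Decomposition into excursions\<close>

text \<open>On paths that never return, \<open>rt\<close> is the unspecified value \<open>the_enat \<infinity>\<close>, and so are the
  visit times and excursions built from it; recurrence makes this a null event.\<close>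

definition rt :: "'e \<Rightarrow> (nat \<Rightarrow> 'e) \<Rightarrow> nat" where
  "rt e \<omega> = the_enat (return_time e \<omega>)"

lemma return_time_eq:
  assumes "1 \<le> n" "\<omega> n = e" "\<And>i. 1 \<le> i \<Longrightarrow> i < n \<Longrightarrow> \<omega> i \<noteq> e"
  shows "return_time e \<omega> = enat n"
  unfolding return_time_def
proof (rule antisym)
  show "Inf {enat n |n. 1 \<le> n \<and> \<omega> n = e} \<le> enat n" using assms by (intro Inf_lower) auto
  show "enat n \<le> Inf {enat n |n. 1 \<le> n \<and> \<omega> n = e}"
  proof (rule Inf_greatest)
    fix x assume "x \<in> {enat n |n. 1 \<le> n \<and> \<omega> n = e}"
    then obtain n' where "x = enat n'" "1 \<le> n'" "\<omega> n' = e" by auto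
    moreover from this have "\<not> n' < n" using assms(3) by blast
    ultimately show "enat n \<le> x" by simp
  qed
qed

lemma rt_eq:
  assumes "1 \<le> n" "\<omega> n = e" "\<And>i. 1 \<le> i \<Longrightarrow> i < n \<Longrightarrow> \<omega> i \<noteq> e"
  shows "rt e \<omega> = n"
  using return_time_eq[of n \<omega> e] assms by (simp add: rt_def)

text \<open>Trades the infimum in \<open>enat\<close> for a \<open>LEAST\<close> over the naturals,
  from which measurability can be derived.\<close>

lemma rt_Least:
  "rt e \<omega> = (if \<exists>n. 1 \<le> n \<and> \<omega> n = e then LEAST n. 1 \<le> n \<and> \<omega> n = e else the_enat \<infinity>)"
proof (cases "\<exists>n. 1 \<le> n \<and> \<omega> n = e")
  case True
  define m where "m = (LEAST n. 1 \<le> n \<and> \<omega> n = e)"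
  have m: "1 \<le> m" "\<omega> m = e" using LeastI_ex[OF True] unfolding m_def by blast+
  have "rt e \<omega> = m"
  proof (rule rt_eq[of m \<omega> e, OF m])
    fix i assume "1 \<le> i" "i < m"
    then show "\<omega> i \<noteq> e" using not_less_Least[of i "\<lambda>n. 1 \<le> n \<and> \<omega> n = e"] unfolding m_def by blast
  qed
  then show ?thesis using True m_def by (simp only: if_True)
next
  case False
  then have "{enat n |n. 1 \<le> n \<and> \<omega> n = e} = {}" by auto
  then have "return_time e \<omega> = \<infinity>" unfolding return_time_def by (simp only: Inf_empty top_enat_def)
  then show ?thesis unfolding rt_def using False by (simp only: if_False)
qed

lemma return_time_finite_iff: "return_time e \<omega> < \<infinity> \<longleftrightarrow> (\<exists>n\<ge>1. \<omega> n = e)"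
proof (cases "\<exists>n\<ge>1. \<omega> n = e")
  case True
  then obtain n where "1 \<le> n" "\<omega> n = e" by auto
  then have "return_time e \<omega> \<le> enat n" unfolding return_time_def by (intro Inf_lower) auto
  then show ?thesis using True enat_ord_simps(4) le_less_trans by blast
next
  case False
  then have "{enat n |n. 1 \<le> n \<and> \<omega> n = e} = {}" by auto
  then have "return_time e \<omega> = \<infinity>" unfolding return_time_def by (simp only: Inf_empty top_enat_def)
  then show ?thesis using False by simp
qed

lemma rt_finite:
  assumes "\<exists>n\<ge>1. \<omega> n = e"
  shows "1 \<le> rt e \<omega>" "\<omega> (rt e \<omega>) = e" "\<And>i. 1 \<le> i \<Longrightarrow> i < rt e \<omega> \<Longrightarrow> \<omega> i \<noteq> e"
proof -
  have ex: "\<exists>n. 1 \<le> n \<and> \<omega> n = e" using assms by blast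
  have eq: "rt e \<omega> = (LEAST n. 1 \<le> n \<and> \<omega> n = e)" unfolding rt_Least using ex by (simp only: if_True)
  show "1 \<le> rt e \<omega>" "\<omega> (rt e \<omega>) = e" using LeastI_ex[OF ex] unfolding eq by blast+
  show "\<omega> i \<noteq> e" if "1 \<le> i" "i < rt e \<omega>" for i
    using not_less_Least[of i "\<lambda>n. 1 \<le> n \<and> \<omega> n = e"] that unfolding eq by blast
qed

lemma measurable_rt [measurable]: "rt e \<in> measurable seq_space (count_space UNIV)"
  unfolding rt_Least[abs_def] by measurable

primrec visit :: "'e \<Rightarrow> (nat \<Rightarrow> 'e) \<Rightarrow> nat \<Rightarrow> nat" where
  "visit e \<omega> 0 = 0"
| "visit e \<omega> (Suc m) = visit e \<omega> m + rt e (\<lambda>i. \<omega> (visit e \<omega> m + i))"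

definition excursion :: "'e \<Rightarrow> (nat \<Rightarrow> 'e) \<Rightarrow> nat \<Rightarrow> 'e list" where
  "excursion e \<omega> m = map \<omega> [visit e \<omega> m..<visit e \<omega> (Suc m)]"

text \<open>The definition adds the last excursion; this recursion splits off the first one and
  shifts the path.\<close>

lemma visit_Suc_shift: "visit e \<omega> (Suc m) = rt e \<omega> + visit e (\<lambda>i. \<omega> (rt e \<omega> + i)) m"
  by (induction m) (simp_all add: add.assoc)

lemma excursion_Suc: "excursion e \<omega> (Suc m) = excursion e (\<lambda>i. \<omega> (rt e \<omega> + i)) m"
proof -
  have "[rt e \<omega> + a..<rt e \<omega> + b] = map (\<lambda>i. rt e \<omega> + i) [a..<b]" for a b
    by (rule nth_equalityI) auto
  then show ?thesis unfolding excursion_def visit_Suc_shift[of e \<omega>] by (simp add: o_def)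
qed

lemma excursion_0: "excursion e \<omega> 0 = map \<omega> [0..<rt e \<omega>]"
  by (simp add: excursion_def)

lemma visit_eq_sum_length: "visit e \<omega> m = (\<Sum>i<m. length (excursion e \<omega> i))"
  by (induction m) (auto simp: excursion_def)

lemma measurable_shift_const [measurable]:
  "(\<lambda>\<omega> i. \<omega> (n + i)) \<in> measurable seq_space seq_space"
  by (rule measurable_PiM_single') (auto simp: space_PiM PiE_iff)

lemma measurable_visit: "(\<lambda>\<omega>. visit e \<omega> m) \<in> measurable (seq_space :: (nat \<Rightarrow> 'e::countable) measure) (count_space UNIV)"
proof (induction m)
  case (Suc m)
  have "(\<lambda>\<omega>. (\<lambda>n \<omega>. n + rt e (\<lambda>i. \<omega> (n + i))) (visit e \<omega> m) \<omega>) \<in> measurable (seq_space :: (nat \<Rightarrow> 'e) measure) (count_space UNIV)"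
  proof (rule measurable_compose_countable[OF _ Suc])
    fix n
    have "(\<lambda>\<omega>. rt e (\<lambda>i. \<omega> (n + i))) \<in> measurable (seq_space :: (nat \<Rightarrow> 'e) measure) (count_space UNIV)"
      by (rule measurable_compose[OF measurable_shift_const measurable_rt])
    then show "(\<lambda>\<omega>. n + rt e (\<lambda>i. \<omega> (n + i))) \<in> measurable (seq_space :: (nat \<Rightarrow> 'e) measure) (count_space UNIV)"
      by (rule measurable_compose) (rule measurable_count_space)
  qed
  then show ?case by (simp only: visit.simps)
qed simp

lemma measurable_excursion_component:
  "(\<lambda>\<omega>. excursion e \<omega> m) \<in> measurable (seq_space :: (nat \<Rightarrow> 'e::countable) measure) (count_space UNIV)"
proof -
  have "(\<lambda>\<omega>. (\<lambda>a \<omega>. map \<omega> [a..<visit e \<omega> (Suc m)]) (visit e \<omega> m) \<omega>) \<in> measurable (seq_space :: (nat \<Rightarrow> 'e) measure) (count_space UNIV)"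
  proof (rule measurable_compose_countable[where f = "\<lambda>a \<omega>. map \<omega> [a..<visit e \<omega> (Suc m)]", OF _ measurable_visit])
    fix a
    show "(\<lambda>\<omega>. map \<omega> [a..<visit e \<omega> (Suc m)]) \<in> measurable (seq_space :: (nat \<Rightarrow> 'e) measure) (count_space UNIV)"
      by (rule measurable_compose_countable[where f = "\<lambda>b \<omega>. map \<omega> [a..<b]", OF measurable_segment measurable_visit])
  qed
  then show ?thesis by (simp only: excursion_def)
qed

lemma measurable_excursion:
  "excursion e \<in> measurable (seq_space :: (nat \<Rightarrow> 'e::countable) measure) seq_space"
  by (rule measurable_PiM_single') (rule measurable_excursion_component, simp)

section \<open>Loops and the independence of excursions\<close>

text \<open>A loop is recorded without its final return to \<open>e\<close>, so that successive
  loops can be concatenated as they stand.\<close>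

definition is_loop :: "'e \<Rightarrow> 'e list \<Rightarrow> bool" where
  "is_loop e l \<longleftrightarrow> l \<noteq> [] \<and> hd l = e \<and> e \<notin> set (tl l)"

lemma map_upt_append_iff:
  "map \<omega> [0..<length (xs @ ys)] = xs @ ys \<longleftrightarrow>
   map \<omega> [0..<length xs] = xs \<and> map (\<lambda>i. \<omega> (length xs + i)) [0..<length ys] = ys"
proof -
  have "[0..<length xs + length ys] = [0..<length xs] @ map (\<lambda>i. length xs + i) [0..<length ys]"
    by (rule nth_equalityI) (auto simp: nth_append)
  then show ?thesis by (auto simp: o_def)
qed

lemma rt_loop:
  assumes "is_loop e l" "map \<omega> [0..<length l] = l" "\<omega> (length l) = e"
  shows "rt e \<omega> = length l"
proof (rule rt_eq)
  show "1 \<le> length l" using assms(1) by (cases l) (auto simp: is_loop_def)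
  show "\<omega> i \<noteq> e" if i: "1 \<le> i" "i < length l" for i
  proof -
    obtain j where j: "i = Suc j" using i by (cases i) auto
    have "\<omega> i = l ! i" using assms(2) i by (metis add_0 nth_map_upt diff_zero)
    also have "\<dots> = tl l ! j" using i j by (simp add: nth_tl)
    also have "\<dots> \<in> set (tl l)" using i j by (intro nth_mem) simp
    finally show ?thesis using assms(1) by (auto simp: is_loop_def)
  qed
qed fact

text \<open>The occurrences of \<open>e\<close> cut the path uniquely: a loop contains
  \<open>e\<close> at its head alone, and the closing \<open>e\<close> marks the end of the last
  loop.\<close>

lemma excursions_of_concat:
  assumes "\<forall>l\<in>set ls. is_loop e l" "map \<omega> [0..<length (concat ls @ [e])] = concat ls @ [e]"
  shows "map (excursion e \<omega>) [0..<length ls] = ls"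
  using assms
proof (induction ls arbitrary: \<omega>)
  case (Cons l ls)
  let ?\<omega> = "\<lambda>i. \<omega> (length l + i)"
  have pre: "map \<omega> [0..<length l] = l" "map ?\<omega> [0..<length (concat ls @ [e])] = concat ls @ [e]"
    using Cons.prems(2) map_upt_append_iff[of \<omega> l "concat ls @ [e]"] by simp_all
  \<comment> \<open>The rest starts with \<open>e\<close> in either case: with the next loop, or
    with the closing \<open>e\<close> if no loop is left.\<close>
  have "hd (concat ls @ [e]) = e" using Cons.prems(1) by (cases ls) (auto simp: is_loop_def hd_append)
  moreover have "\<omega> (length l) = hd (map ?\<omega> [0..<length (concat ls @ [e])])"
    by (simp add: hd_map del: upt_Suc)
  ultimately have e: "\<omega> (length l) = e" using pre(2) by simp
  have rt: "rt e \<omega> = length l" by (rule rt_loop) (use Cons.prems(1) pre e in auto)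
  have "map (excursion e \<omega>) [0..<Suc (length ls)] =
      excursion e \<omega> 0 # map (\<lambda>i. excursion e \<omega> (Suc i)) [0..<length ls]"
    by (simp add: upt_conv_Cons map_Suc_upt[symmetric] o_def del: upt_Suc)
  also have "\<dots> = l # map (excursion e ?\<omega>) [0..<length ls]"
    by (simp add: excursion_0 excursion_Suc rt pre(1))
  also have "map (excursion e ?\<omega>) [0..<length ls] = ls"
    by (rule Cons.IH) (use Cons.prems(1) pre in auto)
  finally show ?case by simp
qed simp

text \<open>Each junction is a visit to \<open>e\<close>, where weights multiply. This factorisation
  is the source of the independence of the excursions.\<close>

lemma path_weight_concat_loops:
  "\<forall>l\<in>set ls. is_loop e l \<Longrightarrow>
    path_weight K (concat ls @ [e]) = prod_list (map (\<lambda>l. path_weight K (l @ [e])) ls)"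
proof (induction ls)
  case (Cons l ls)
  have "hd (concat ls @ [e]) = e" using Cons.prems by (cases ls) (auto simp: is_loop_def hd_append)
  then obtain zs where zs: "concat ls @ [e] = e # zs" by (cases "concat ls @ [e]") auto
  have "path_weight K (concat (l # ls) @ [e]) = path_weight K (l @ e # zs)" using zs by simp
  also have "\<dots> = path_weight K (l @ [e]) * path_weight K (concat ls @ [e])"
    unfolding zs by (rule path_weight_append)
  finally show ?case using Cons by simp
qed simp

definition excursion_law :: "('e::countable \<Rightarrow> 'e pmf) \<Rightarrow> 'e \<Rightarrow> 'e list measure" where
  "excursion_law K e = distr (markov_measure K e) (count_space UNIV) (\<lambda>\<omega>. excursion e \<omega> 0)"

lemma sets_excursion_law: "sets (excursion_law K e) = UNIV"
  by (simp add: excursion_law_def)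

lemma space_excursion_law: "space (excursion_law K e) = UNIV"
  by (simp add: excursion_law_def)

lemma measurable_excursion_markov:
  "(\<lambda>\<omega>. excursion e \<omega> m) \<in> measurable (markov_measure K e) (count_space UNIV)"
  "excursion e \<in> measurable (markov_measure K e) seq_space"
  for K :: "'e::countable \<Rightarrow> 'e pmf"
  unfolding measurable_markov_measure by (rule measurable_excursion_component measurable_excursion)+

lemma prob_space_excursion_law: "prob_space (excursion_law K e)"
  unfolding excursion_law_def
  by (rule prob_space.prob_space_distr[OF prob_space_markov_measure measurable_excursion_markov(1)])

context
  fixes K :: "'e::countable \<Rightarrow> 'e pmf" and e :: 'e
  assumes rec: "recurrent_chain K"
begin

lemma AE_returns: "AE \<omega> in markov_measure K e. \<exists>n\<ge>1. \<omega> n = e"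
proof -
  interpret prob_space "markov_measure K e" by (rule prob_space_markov_measure)
  have "prob {\<omega>. return_time e \<omega> < \<infinity>} = 1" using rec by (simp add: recurrent_chain_def)
  from AE_prob_1[OF this] show ?thesis by (simp only: return_time_finite_iff mem_Collect_eq)
qed

lemma AE_starts: "AE \<omega> in markov_measure K e. \<omega> 0 = e"
proof -
  interpret prob_space "markov_measure K e" by (rule prob_space_markov_measure)
  have "emeasure (markov_measure K e) {\<omega>. \<omega> 0 = e} = 1"
    using emeasure_markov_segment[of "[e]" K e] by simp
  then have "prob {\<omega>. \<omega> 0 = e} = 1" by (simp add: emeasure_eq_measure)
  from AE_prob_1[OF this] show ?thesis by simp
qed

text \<open>Almost surely the path starts at \<open>e\<close> and returns, and then the first
  excursion equals \<open>l\<close> only if \<open>l\<close> is a loop and the path begins with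
  \<open>l\<close> followed by \<open>e\<close>. The weight therefore includes the step back to
  \<open>e\<close>.\<close>

lemma excursion_law_le:
  "emeasure (excursion_law K e) {l} \<le> (if is_loop e l then ennreal (path_weight K (l @ [e])) else 0)"
proof -
  let ?P = "markov_measure K e"
  have "emeasure (excursion_law K e) {l} = emeasure ?P {\<omega>. excursion e \<omega> 0 = l}"
    unfolding excursion_law_def
    by (subst emeasure_distr) (auto simp: measurable_excursion_markov space_markov_measure vimage_def)
  also have "\<dots> \<le> emeasure ?P (if is_loop e l then {\<omega>. map \<omega> [0..<length (l @ [e])] = l @ [e]} else {})"
  proof (rule emeasure_mono_AE)
    show "AE \<omega> in ?P. \<omega> \<in> {\<omega>. excursion e \<omega> 0 = l} \<longrightarrow>
        \<omega> \<in> (if is_loop e l then {\<omega>. map \<omega> [0..<length (l @ [e])] = l @ [e]} else {})"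
      using AE_returns AE_starts
    proof (eventually_elim, intro impI)
      fix \<omega> assume ret: "\<exists>n\<ge>1. \<omega> n = e" and st: "\<omega> 0 = e" and "\<omega> \<in> {\<omega>. excursion e \<omega> 0 = l}"
      then have l: "l = map \<omega> [0..<rt e \<omega>]" by (simp add: excursion_0)
      note rt = rt_finite[OF ret]
      have tl: "tl l = map \<omega> [1..<rt e \<omega>]" unfolding l using rt(1) by (simp add: map_tl[symmetric] upt_rec[of 0])
      have "e \<notin> set (tl l)"
      proof
        assume "e \<in> set (tl l)"
        then obtain i where "1 \<le> i" "i < rt e \<omega>" "\<omega> i = e" unfolding tl by auto
        with rt(3) show False by blast
      qed
      then have "is_loop e l"
        unfolding is_loop_def using rt(1) st by (auto simp: l hd_map)
      moreover have "map \<omega> [0..<length (l @ [e])] = l @ [e]"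
        using rt(2) by (simp add: l)
      ultimately show "\<omega> \<in> (if is_loop e l then {\<omega>. map \<omega> [0..<length (l @ [e])] = l @ [e]} else {})"
        by simp
    qed
    have "{\<omega>. map \<omega> [0..<length (l @ [e])] = l @ [e]} \<in> sets ?P"
      using measurable_sets[OF measurable_segment[of 0 "length (l @ [e])"], of "{l @ [e]}"]
      by (simp add: sets_markov_measure vimage_def space_PiM del: upt_Suc)
    then show "(if is_loop e l then {\<omega>. map \<omega> [0..<length (l @ [e])] = l @ [e]} else {}) \<in> sets ?P"
      by simp
  qed
  also have "\<dots> \<le> (if is_loop e l then ennreal (path_weight K (l @ [e])) else 0)"
    using emeasure_markov_segment[of "l @ [e]" K e] by (auto simp del: length_append)
  finally show ?thesis .
qed

lemma AE_excursion_law_loop: "AE l in excursion_law K e. is_loop e l"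
proof -
  have "emeasure (excursion_law K e) {l. \<not> is_loop e l} =
      (\<integral>\<^sup>+l. emeasure (excursion_law K e) {l} \<partial>count_space {l. \<not> is_loop e l})"
    by (rule emeasure_countable_singleton) (auto simp: sets_excursion_law)
  also have "\<dots> = (\<integral>\<^sup>+l. 0 \<partial>count_space {l. \<not> is_loop e l})"
    using excursion_law_le by (intro nn_integral_cong) (metis (mono_tags, lifting) le_zero_eq mem_Collect_eq space_count_space)
  finally show ?thesis by (intro AE_I[of _ _ "{l. \<not> is_loop e l}"]) (auto simp: sets_excursion_law)
qed

text \<open>It suffices to bound the cylinder probabilities from below, because both sides are
  probability measures.\<close>

theorem excursions_iid:
  "distr (markov_measure K e) seq_space (excursion e) = PiM UNIV (\<lambda>_. excursion_law K e)"
proof (rule seq_measure_eqI_cylinder_le)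
  let ?P = "markov_measure K e" and ?q = "excursion_law K e"
  show "prob_space (distr ?P seq_space (excursion e))"
    by (rule prob_space.prob_space_distr[OF prob_space_markov_measure measurable_excursion_markov(2)])
  show "prob_space (PiM UNIV (\<lambda>_. ?q))"
    by (rule prob_space_PiM) (rule prob_space_excursion_law)
  show "sets (PiM UNIV (\<lambda>_. ?q)) = sets seq_space"
    by (rule sets_PiM_cong) (auto simp: sets_excursion_law)
  fix ls :: "'e list list"
  let ?C = "{x. map x [0..<length ls] = ls}"
  let ?w = "\<lambda>l. if is_loop e l then ennreal (path_weight K (l @ [e])) else 0"
  have C: "?C \<in> sets (seq_space :: (nat \<Rightarrow> 'e list) measure)"
    using measurable_sets[OF measurable_segment[of 0 "length ls"], of "{ls}"] by (simp add: vimage_def space_PiM)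
  have "?C = prod_emb UNIV (\<lambda>_. ?q) {..<length ls} (PiE {..<length ls} (\<lambda>i. {ls ! i}))"
  proof (rule Set.set_eqI)
    fix x :: "nat \<Rightarrow> 'e list"
    have "x \<in> ?C \<longleftrightarrow> (\<forall>i<length ls. x i = ls ! i)"
      using list_eq_iff_nth_eq[of "map x [0..<length ls]" ls] by simp
    also have "\<dots> \<longleftrightarrow> x \<in> prod_emb UNIV (\<lambda>_. ?q) {..<length ls} (PiE {..<length ls} (\<lambda>i. {ls ! i}))"
      by (simp add: prod_emb_def PiE_iff space_excursion_law Ball_def)
    finally show "x \<in> ?C \<longleftrightarrow> x \<in> prod_emb UNIV (\<lambda>_. ?q) {..<length ls} (PiE {..<length ls} (\<lambda>i. {ls ! i}))" .
  qed
  then have "emeasure (PiM UNIV (\<lambda>_. ?q)) ?C = (\<Prod>i<length ls. emeasure ?q {ls ! i})"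
    by (simp only:) (rule emeasure_PiM_emb, auto simp: prob_space_excursion_law sets_excursion_law)
  also have "\<dots> \<le> (\<Prod>i<length ls. ?w (ls ! i))"
    by (intro prod_mono_ennreal excursion_law_le)
  \<comment> \<open>If all entries are loops, the bound is the probability of one cylinder of paths,
    on which the excursions are the prescribed ones; otherwise a factor is 0.\<close>
  also have "\<dots> \<le> emeasure (distr ?P seq_space (excursion e)) ?C"
  proof (cases "\<forall>l\<in>set ls. is_loop e l")
    case True
    have "(\<Prod>i<length ls. ?w (ls ! i)) = (\<Prod>i<length ls. ennreal (path_weight K (ls ! i @ [e])))"
      by (intro prod.cong refl) (simp add: True[rule_format, OF nth_mem])
    also have "\<dots> = ennreal (\<Prod>i<length ls. path_weight K (ls ! i @ [e]))"
      by (simp add: prod_ennreal path_weight_nonneg)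
    also have "(\<Prod>i<length ls. path_weight K (ls ! i @ [e])) = path_weight K (concat ls @ [e])"
      unfolding path_weight_concat_loops[OF True]
      by (simp add: prod.list_conv_set_nth atLeast0LessThan)
    also have "ennreal \<dots> = emeasure ?P {\<omega>. map \<omega> [0..<length (concat ls @ [e])] = concat ls @ [e]}"
    proof -
      have "hd (concat ls @ [e]) = e" using True by (cases ls) (auto simp: is_loop_def hd_append)
      then show ?thesis using emeasure_markov_segment[of "concat ls @ [e]" K e] by (simp only: if_True) simp
    qed
    also have "\<dots> \<le> emeasure ?P (excursion e -` ?C \<inter> space ?P)"
    proof (rule emeasure_mono)
      show "{\<omega>. map \<omega> [0..<length (concat ls @ [e])] = concat ls @ [e]} \<subseteq> excursion e -` ?C \<inter> space ?P"
      proof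
        fix \<omega> assume "\<omega> \<in> {\<omega>. map \<omega> [0..<length (concat ls @ [e])] = concat ls @ [e]}"
        then have "map (excursion e \<omega>) [0..<length ls] = ls"
          unfolding mem_Collect_eq by (rule excursions_of_concat[OF True])
        then show "\<omega> \<in> excursion e -` ?C \<inter> space ?P"
          unfolding space_markov_measure by (intro IntI vimageI2 CollectI UNIV_I)
      qed
      show "excursion e -` ?C \<inter> space ?P \<in> sets ?P"
        by (rule measurable_sets[OF measurable_excursion_markov(2) C])
    qed
    also have "\<dots> = emeasure (distr ?P seq_space (excursion e)) ?C"
      by (rule emeasure_distr[OF measurable_excursion_markov(2) C, symmetric])
    finally show ?thesis .
  next
    case False
    then obtain i where "i < length ls" "\<not> is_loop e (ls ! i)" by (auto simp: in_set_conv_nth)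
    then have "(\<Prod>i<length ls. ?w (ls ! i)) = 0" by (intro prod_zero) (auto intro!: bexI[of _ i])
    then show ?thesis by (simp only: zero_le)
  qed
  finally show "emeasure (PiM UNIV (\<lambda>_. ?q)) ?C \<le> emeasure (distr ?P seq_space (excursion e)) ?C" .
qed (rule sets_distr)

lemma AE_excursion_loops: "AE \<omega> in markov_measure K e. \<forall>m. is_loop e (excursion e \<omega> m)"
proof -
  have "AE x in PiM UNIV (\<lambda>_::nat. excursion_law K e). \<forall>m. is_loop e (x m)"
    unfolding AE_all_countable
    by (intro allI AE_PiM_component prob_space_excursion_law AE_excursion_law_loop) auto
  then show ?thesis
    unfolding excursions_iid[symmetric] by (rule AE_distrD[OF measurable_excursion_markov(2)])
qed

end

section \<open>Sums of independent copies of an integrable variable\<close>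

lemma distr_PiM_shift:
  assumes "prob_space Q"
  shows "distr (PiM UNIV (\<lambda>_::nat. Q)) (PiM UNIV (\<lambda>_::nat. Q)) (\<lambda>x i. x (Suc i)) = PiM UNIV (\<lambda>_::nat. Q)"
  using distr_PiM_reindex[of UNIV "\<lambda>_::nat. Q" Suc UNIV] assms by (simp add: restrict_def)

lemma measurable_PiM_shift:
  "(\<lambda>x i. x (Suc i)) \<in> measurable (PiM UNIV (\<lambda>_::nat. Q)) (PiM UNIV (\<lambda>_::nat. Q))"
  by (rule measurable_PiM_single') (auto simp: space_PiM PiE_iff)

text \<open>\<open>max_excess F l n x\<close> is the maximum of \<open>(\<Sum>i<m. F (x i) - l)\<close> over \<open>m \<le> n\<close>.\<close>

primrec max_excess :: "('a \<Rightarrow> real) \<Rightarrow> real \<Rightarrow> nat \<Rightarrow> (nat \<Rightarrow> 'a) \<Rightarrow> real" where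
  "max_excess F l 0 x = 0"
| "max_excess F l (Suc n) x = max 0 (F (x 0) - l + max_excess F l n (\<lambda>i. x (Suc i)))"

lemma max_excess_nonneg: "0 \<le> max_excess F l n x"
  by (cases n) auto

lemma max_excess_mono: "max_excess F l n x \<le> max_excess F l (Suc n) x"
proof (induction n arbitrary: x)
  case (Suc n)
  show ?case using Suc[of "\<lambda>i. x (Suc i)"] by (auto simp: max_def)
qed simp

lemma sum_le_max_excess: "m \<le> n \<Longrightarrow> (\<Sum>i<m. F (x i) - l) \<le> max_excess F l n x"
proof (induction n arbitrary: m x)
  case (Suc n)
  show ?case
  proof (cases m)
    case 0
    then show ?thesis using max_excess_nonneg[of F l "Suc n" x] by simp
  next
    case (Suc m')
    then have "(\<Sum>i<m'. F (x (Suc i)) - l) \<le> max_excess F l n (\<lambda>i. x (Suc i))"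
      using Suc.IH[of m' "\<lambda>i. x (Suc i)"] Suc.prems by simp
    then show ?thesis unfolding Suc sum.lessThan_Suc_shift by simp
  qed
qed simp

context prob_space
begin

abbreviation iid :: "(nat \<Rightarrow> 'a) measure" where
  "iid \<equiv> PiM UNIV (\<lambda>_::nat. M)"

lemma prob_space_iid: "prob_space iid"
  by (rule prob_space_PiM) (rule prob_space_axioms)

lemma distr_iid_component: "distr iid M (\<lambda>x. x n) = M"
  by (rule distr_PiM_component) (auto intro: prob_space_axioms)

context
  fixes F :: "'a \<Rightarrow> real"
  assumes F: "integrable M F" and F_nonneg: "\<And>a. 0 \<le> F a"
begin

lemma F_measurable [measurable]: "F \<in> borel_measurable M"
  using F by (rule borel_measurable_integrable)

lemma integrable_iid_component: "integrable iid (\<lambda>x. F (x n))"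
  using F integrable_distr[of "\<lambda>x. x n" iid M F] by (simp add: distr_iid_component)

lemma integral_iid_component: "(\<integral>x. F (x n) \<partial>iid) = (\<integral>a. F a \<partial>M)"
  using integral_distr[of "\<lambda>x. x n" iid M F] by (simp add: distr_iid_component)

lemma integrable_max_excess: "integrable iid (max_excess F l n)"
proof (induction n)
  case 0
  show ?case by simp
next
  case (Suc n)
  interpret P: prob_space iid by (rule prob_space_iid)
  have "integrable iid (\<lambda>x. max_excess F l n (\<lambda>i. x (Suc i)))"
    using measurable_PiM_shift[of M] integrable_distr[of "\<lambda>x i. x (Suc i)" iid iid "max_excess F l n"] Suc
    by (simp add: distr_PiM_shift[OF prob_space_axioms])
  then show ?case
    using integrable_iid_component[of 0] by (auto intro!: integrable_max)
qed

lemma measurable_max_excess [measurable]: "max_excess F l n \<in> borel_measurable iid"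
  using integrable_max_excess by (rule borel_measurable_integrable)

text \<open>Garsia's proof of the maximal ergodic inequality.\<close>

lemma maximal_inequality:
  assumes "l > 0"
  shows "measure iid {x \<in> space iid. max_excess F l n x > 0} \<le> (\<integral>a. F a \<partial>M) / l"
proof -
  interpret P: prob_space iid by (rule prob_space_iid)
  let ?E = "\<lambda>n. {x \<in> space iid. max_excess F l n x > 0}"
  let ?m = "max_excess F l (Suc n)" and ?\<theta> = "\<lambda>x i. x (Suc i)"
  have [measurable]: "?E n \<in> sets iid" for n by measurable
  have I\<theta>: "integrable iid (\<lambda>x. ?m (?\<theta> x))"
    using integrable_distr[of ?\<theta> iid iid ?m] integrable_max_excess[of l "Suc n"]
    by (simp only: distr_PiM_shift[OF prob_space_axioms] measurable_PiM_shift)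
  have eq\<theta>: "(\<integral>x. ?m (?\<theta> x) \<partial>iid) = (\<integral>x. ?m x \<partial>iid)"
    using integral_distr[of ?\<theta> iid iid ?m] measurable_max_excess[of l "Suc n"]
    by (simp only: distr_PiM_shift[OF prob_space_axioms] measurable_PiM_shift)
  have IF: "integrable iid (\<lambda>x. indicator (?E (Suc n)) x * F (x 0))"
    using integrable_mult_indicator[of "?E (Suc n)" iid "\<lambda>x. F (x 0)"] integrable_iid_component[of 0]
    by (simp del: max_excess.simps)
  \<comment> \<open>Shift invariance of the product measure: the integral of a function minus its
    shift vanishes.\<close>
  have "0 = (\<integral>x. ?m x - ?m (?\<theta> x) \<partial>iid)"
    using I\<theta> eq\<theta> integrable_max_excess[of l "Suc n"] by (simp del: max_excess.simps)
  also have "\<dots> \<le> (\<integral>x. indicator (?E (Suc n)) x * F (x 0) - l * indicator (?E (Suc n)) x \<partial>iid)"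
  proof (rule integral_mono)
    fix x assume x: "x \<in> space iid"
    \<comment> \<open>On \<open>?E (Suc n)\<close> the recursion holds without the outer maximum,
      and monotonicity in \<open>n\<close> bounds the difference by \<open>F (x 0) - l\<close>. Off
      it, \<open>?m\<close> is 0 and its shift is nonnegative.\<close>
    show "?m x - ?m (?\<theta> x) \<le> indicator (?E (Suc n)) x * F (x 0) - l * indicator (?E (Suc n)) x"
    proof (cases "?m x > 0")
      case True
      then have "?m x = F (x 0) - l + max_excess F l n (?\<theta> x)"
        by (auto simp: max_def split: if_splits)
      then show ?thesis using True x max_excess_mono[of F l n "?\<theta> x"] by simp
    next
      case False
      then show ?thesis using max_excess_nonneg[of F l "Suc n" "?\<theta> x"] by simp
    qed
  qed (use I\<theta> IF integrable_max_excess[of l "Suc n"] in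
      \<open>auto intro!: Bochner_Integration.integrable_diff integrable_real_indicator simp del: max_excess.simps simp: P.emeasure_eq_measure\<close>)
  also have "\<dots> = (\<integral>x. indicator (?E (Suc n)) x * F (x 0) \<partial>iid) - l * measure iid (?E (Suc n))"
    using IF by (subst Bochner_Integration.integral_diff) (auto simp del: max_excess.simps simp: P.emeasure_eq_measure intro!: integrable_real_indicator)
  also have "(\<integral>x. indicator (?E (Suc n)) x * F (x 0) \<partial>iid) \<le> (\<integral>x. F (x 0) \<partial>iid)"
    using IF integrable_iid_component[of 0] F_nonneg
    by (intro integral_mono) (auto simp del: max_excess.simps simp: indicator_def)
  finally have "l * measure iid (?E (Suc n)) \<le> (\<integral>a. F a \<partial>M)"
    by (simp add: integral_iid_component)
  moreover have "measure iid (?E n) \<le> measure iid (?E (Suc n))"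
    using max_excess_mono[of F l n] by (intro P.finite_measure_mono) (auto simp del: max_excess.simps intro: less_le_trans)
  ultimately have "l * measure iid (?E n) \<le> (\<integral>a. F a \<partial>M)"
    using assms by (smt (verit) mult_left_mono)
  then show ?thesis using assms by (simp add: field_simps)
qed

text \<open>By the maximal inequality the partial sums ever exceed the slope \<open>l\<close> with
  probability at most the mean of \<open>F\<close> over \<open>l\<close>. Along integer slopes these
  bounds tend to 0, so almost surely some slope is never exceeded.\<close>

lemma AE_iid_sum_linear_bound:
  "AE x in iid. \<exists>l>0. \<forall>m. (\<Sum>i<m. F (x i)) \<le> l * real m"
proof -
  interpret P: prob_space iid by (rule prob_space_iid)
  let ?E = "\<lambda>j n. {x \<in> space iid. max_excess F (real (Suc j)) n x > 0}"
  let ?U = "\<lambda>j. \<Union>n. ?E j n"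
  let ?N = "\<Inter>j. ?U j"
  have meas [measurable]: "?E j n \<in> sets iid" for j n by measurable
  have U: "measure iid (?U j) \<le> (\<integral>a. F a \<partial>M) / real (Suc j)" for j
  proof -
    have "(\<lambda>n. measure iid (?E j n)) \<longlonglongrightarrow> measure iid (?U j)"
      using max_excess_mono[of F "real (Suc j)"]
      by (intro P.finite_Lim_measure_incseq incseq_SucI)
         (auto simp del: max_excess.simps intro: less_le_trans)
    then show ?thesis
      by (rule LIMSEQ_le_const2) (use maximal_inequality[of "real (Suc j)"] in auto)
  qed
  have "measure iid ?N \<le> (\<integral>a. F a \<partial>M) / real (Suc j)" for j
  proof -
    have "measure iid ?N \<le> measure iid (?U j)" by (intro P.finite_measure_mono) auto
    with U[of j] show ?thesis by linarith
  qed
  moreover have "(\<lambda>j. (\<integral>a. F a \<partial>M) / real (Suc j)) \<longlonglongrightarrow> 0"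
    by (rule LIMSEQ_Suc[OF lim_const_over_n])
  ultimately have "measure iid ?N \<le> 0"
    by (intro LIMSEQ_le_const[of "\<lambda>j. (\<integral>a. F a \<partial>M) / real (Suc j)"]) auto
  then have "?N \<in> null_sets iid"
    using meas by (auto simp: null_sets_def P.emeasure_eq_measure measure_le_0_iff)
  then have "AE x in iid. x \<notin> ?N" by (rule AE_not_in)
  then show ?thesis
  proof (rule AE_mp, intro AE_I2 impI)
    fix x assume x: "x \<in> space iid" "x \<notin> ?N"
    then obtain j where j: "\<And>n. max_excess F (real (Suc j)) n x \<le> 0"
      by (auto simp: not_less)
    have "(\<Sum>i<m. F (x i)) \<le> real (Suc j) * real m" for m
    proof -
      have "(\<Sum>i<m. F (x i) - real (Suc j)) \<le> 0"
        using sum_le_max_excess[OF order_refl, of F x "real (Suc j)" m] j[of m] by linarith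
      then show ?thesis by (simp add: sum_subtractf algebra_simps)
    qed
    then show "\<exists>l>0. \<forall>m. (\<Sum>i<m. F (x i)) \<le> l * real m"
      by (intro exI[of _ "real (Suc j)"]) auto
  qed
qed

text \<open>Counts positive integers below a / \<epsilon>. Integrated, it bounds the sum of the tail
  probabilities of an integrable variable by its mean over \<epsilon>.\<close>

lemma sum_indicator_le:
  fixes a \<epsilon> :: real
  assumes "\<epsilon> > 0" "a \<ge> 0"
  shows "(\<Sum>n<N. if a > \<epsilon> * real (Suc n) then 1 else 0 :: real) \<le> a / \<epsilon>"
proof -
  have "{n. n < N \<and> a > \<epsilon> * real (Suc n)} \<subseteq> {..<nat \<lfloor>a / \<epsilon>\<rfloor>}"
  proof
    fix n assume "n \<in> {n. n < N \<and> a > \<epsilon> * real (Suc n)}"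
    then have "real (Suc n) < a / \<epsilon>" using assms by (simp add: field_simps)
    then have "int (Suc n) \<le> \<lfloor>a / \<epsilon>\<rfloor>" by (simp add: le_floor_iff)
    then show "n \<in> {..<nat \<lfloor>a / \<epsilon>\<rfloor>}" by auto
  qed
  then have "card {n. n < N \<and> a > \<epsilon> * real (Suc n)} \<le> nat \<lfloor>a / \<epsilon>\<rfloor>"
    using card_mono[of "{..<nat \<lfloor>a / \<epsilon>\<rfloor>}"] by simp
  then have "real (card {n. n < N \<and> a > \<epsilon> * real (Suc n)}) \<le> real (nat \<lfloor>a / \<epsilon>\<rfloor>)" by simp
  also have "\<dots> \<le> a / \<epsilon>" using assms by (simp add: of_nat_nat)
  finally show ?thesis by (simp add: sum.If_cases Int_def)
qed

text \<open>Borel-Cantelli. The coordinates have the same law, so all tails are those of one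
  variable and can be summed under a single integral.\<close>

lemma AE_iid_eventually_le:
  assumes "\<epsilon> > 0"
  shows "AE x in iid. eventually (\<lambda>n. F (x n) \<le> \<epsilon> * real (Suc n)) sequentially"
proof -
  interpret P: prob_space iid by (rule prob_space_iid)
  let ?A = "\<lambda>n. {x \<in> space iid. F (x n) > \<epsilon> * real (Suc n)}"
  let ?B = "\<lambda>n. {a \<in> space M. F a > \<epsilon> * real (Suc n)}"
  have [measurable]: "?A n \<in> sets iid" for n by measurable
  have [measurable]: "?B n \<in> sets M" for n by measurable
  have A: "measure iid (?A n) = measure M (?B n)" for n
  proof -
    have "measure M (?B n) = measure (distr iid M (\<lambda>x. x n)) (?B n)" by (simp only: distr_iid_component)
    also have "\<dots> = measure iid ((\<lambda>x. x n) -` ?B n \<inter> space iid)" by (rule measure_distr) auto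
    also have "(\<lambda>x. x n) -` ?B n \<inter> space iid = ?A n" by (auto simp: space_PiM PiE_iff)
    finally show ?thesis ..
  qed
  have "summable (\<lambda>n. measure iid (?A n))"
  proof (rule summableI_nonneg_bounded)
    fix N
    have "(\<Sum>n<N. measure iid (?A n)) = (\<Sum>n<N. \<integral>a. indicator (?B n) a \<partial>M)"
      unfolding A by (simp add: emeasure_eq_measure)
    also have "\<dots> = (\<integral>a. (\<Sum>n<N. indicator (?B n) a) \<partial>M)"
      by (rule Bochner_Integration.integral_sum[symmetric]) (auto simp: emeasure_eq_measure intro!: integrable_real_indicator)
    also have "\<dots> \<le> (\<integral>a. F a / \<epsilon> \<partial>M)"
    proof (rule integral_mono)
      fix a assume "a \<in> space M"
      then have "(\<Sum>n<N. indicator (?B n) a) = (\<Sum>n<N. if F a > \<epsilon> * real (Suc n) then 1 else 0 :: real)"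
        by (intro sum.cong) (auto simp: indicator_def)
      with sum_indicator_le[OF assms F_nonneg] show "(\<Sum>n<N. indicator (?B n) a) \<le> F a / \<epsilon>"
        by (simp only:)
    qed (use F in \<open>auto simp: emeasure_eq_measure intro!: integrable_real_indicator Bochner_Integration.integrable_sum\<close>)
    finally show "(\<Sum>n<N. measure iid (?A n)) \<le> (\<integral>a. F a \<partial>M) / \<epsilon>" by simp
  qed simp
  then have "AE x in iid. eventually (\<lambda>n. x \<in> space iid - ?A n) sequentially"
    by (intro borel_cantelli_AE1) (auto simp: P.emeasure_eq_measure)
  then show ?thesis
    by (rule AE_mp) (auto elim!: eventually_mono simp: not_less)
qed

text \<open>One null set for all \<epsilon>, obtained from the countably many values 1 / (j +
  1).\<close>

lemma AE_iid_sublinear: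
  "AE x in iid. \<forall>\<epsilon>>0. eventually (\<lambda>n. F (x n) \<le> \<epsilon> * real (Suc n)) sequentially"
proof -
  have "AE x in iid. \<forall>j. eventually (\<lambda>n. F (x n) \<le> inverse (real (Suc j)) * real (Suc n)) sequentially"
    unfolding AE_all_countable by (intro allI AE_iid_eventually_le) simp
  then show ?thesis
  proof (rule AE_mp, intro AE_I2 impI allI)
    fix x and \<epsilon> :: real
    assume x: "\<forall>j. eventually (\<lambda>n. F (x n) \<le> inverse (real (Suc j)) * real (Suc n)) sequentially" and "\<epsilon> > 0"
    obtain j where j: "inverse (real (Suc j)) < \<epsilon>" using reals_Archimedean[OF \<open>\<epsilon> > 0\<close>] by blast
    show "eventually (\<lambda>n. F (x n) \<le> \<epsilon> * real (Suc n)) sequentially"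
      using x[rule_format, of j]
      by (rule eventually_mono) (use j in \<open>smt (verit) mult_right_mono of_nat_0_le_iff\<close>)
  qed
qed

end

end

section \<open>Moments of excursions\<close>

text \<open>The expectation under P_e of \<open>g\<close> at time \<open>n\<close> on the event of
  no return during the times 1 to \<open>n\<close>; \<open>tl\<close> drops the start at
  \<open>e\<close>. Summed over \<open>n\<close> it integrates \<open>g\<close> against the
  occupation measure of an excursion.\<close>

definition taboo_integral :: "('e \<Rightarrow> 'e pmf) \<Rightarrow> 'e \<Rightarrow> ('e \<Rightarrow> ennreal) \<Rightarrow> nat \<Rightarrow> ennreal" where
  "taboo_integral K e g n = (\<integral>\<^sup>+l. g (last l) * indicator {l. e \<notin> set (tl l)} l \<partial>path_pmf K e n)"

lemma taboo_integral_0: "taboo_integral K e g 0 = g e"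
  by (simp add: taboo_integral_def)

text \<open>Integrates out the last step: it must avoid \<open>e\<close>, and this constraint moves
  into the new integrand.\<close>

lemma taboo_integral_Suc:
  "taboo_integral K e g (Suc n) = taboo_integral K e (\<lambda>x. \<integral>\<^sup>+y. g y * indicator (- {e}) y \<partial>K x) n"
proof -
  have "taboo_integral K e g (Suc n) =
      (\<integral>\<^sup>+l. \<integral>\<^sup>+y. g y * indicator {l. e \<notin> set (tl l)} (l @ [y]) \<partial>K (last l) \<partial>path_pmf K e n)"
    by (simp add: taboo_integral_def)
  also have "\<dots> = (\<integral>\<^sup>+l. (\<integral>\<^sup>+y. g y * indicator (- {e}) y \<partial>K (last l)) * indicator {l. e \<notin> set (tl l)} l \<partial>path_pmf K e n)"
  proof (rule nn_integral_cong_AE, rule AE_pmfI)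
    fix l assume "l \<in> set_pmf (path_pmf K e n)"
    then have "l \<noteq> []" using set_path_pmf by fastforce
    then have "g y * indicator {l. e \<notin> set (tl l)} (l @ [y]) =
        g y * indicator (- {e}) y * indicator {l. e \<notin> set (tl l)} l" for y
      by (auto simp: indicator_def)
    then show "(\<integral>\<^sup>+y. g y * indicator {l. e \<notin> set (tl l)} (l @ [y]) \<partial>K (last l)) =
        (\<integral>\<^sup>+y. g y * indicator (- {e}) y \<partial>K (last l)) * indicator {l. e \<notin> set (tl l)} l"
      by (simp add: nn_integral_multc)
  qed
  finally show ?thesis by (simp add: taboo_integral_def)
qed

text \<open>One half of Kac's formula; the other half is not needed. The induction replaces \<open>g\<close> by its
  one-step average over the points other than \<open>e\<close>.\<close>

lemma kac_inequality:
  assumes "stationary_distribution K \<pi>"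
  shows "ennreal (pmf \<pi> e) * (\<Sum>j\<le>n. taboo_integral K e g j) \<le> (\<integral>\<^sup>+x. g x \<partial>\<pi>)"
proof (induction n arbitrary: g)
  case 0
  have "ennreal (pmf \<pi> e) * g e = (\<integral>\<^sup>+x. g e * indicator {e} x \<partial>\<pi>)"
    by (simp add: nn_integral_cmult_indicator emeasure_pmf_single mult.commute)
  also have "\<dots> \<le> (\<integral>\<^sup>+x. g x \<partial>\<pi>)"
    by (intro nn_integral_mono) (auto simp: indicator_def)
  finally show ?case by (simp add: taboo_integral_0)
next
  case (Suc n)
  let ?g = "\<lambda>y. g y * indicator (- {e}) y"
  have "ennreal (pmf \<pi> e) * (\<Sum>j\<le>Suc n. taboo_integral K e g j) =
      ennreal (pmf \<pi> e) * g e + ennreal (pmf \<pi> e) * (\<Sum>j\<le>n. taboo_integral K e (\<lambda>x. \<integral>\<^sup>+y. ?g y \<partial>K x) j)"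
    unfolding sum.atMost_Suc_shift taboo_integral_0 taboo_integral_Suc by (simp only: distrib_left)
  also have "\<dots> \<le> ennreal (pmf \<pi> e) * g e + (\<integral>\<^sup>+x. \<integral>\<^sup>+y. ?g y \<partial>K x \<partial>\<pi>)"
    by (intro add_left_mono Suc.IH)
  \<comment> \<open>Averaging over one step and then over \<pi> is integration against
    \<open>bind_pmf \<pi> K\<close>, which stationarity turns back into \<pi>. The term at
    \<open>e\<close> and the rest then add up to the full integral.\<close>
  also have "(\<integral>\<^sup>+x. \<integral>\<^sup>+y. ?g y \<partial>K x \<partial>\<pi>) = (\<integral>\<^sup>+y. ?g y \<partial>bind_pmf \<pi> K)"
    by (simp only: nn_integral_bind_pmf)
  also have "bind_pmf \<pi> K = \<pi>" using assms by (simp add: stationary_distribution_def)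
  also have "ennreal (pmf \<pi> e) * g e = (\<integral>\<^sup>+x. g x * indicator {e} x \<partial>\<pi>)"
  proof -
    have "(\<integral>\<^sup>+x. g x * indicator {e} x \<partial>\<pi>) = (\<integral>\<^sup>+x. g e * indicator {e} x \<partial>\<pi>)"
      by (intro nn_integral_cong) (auto simp: indicator_def)
    then show ?thesis by (simp add: nn_integral_cmult_indicator emeasure_pmf_single mult.commute)
  qed
  also have "(\<integral>\<^sup>+x. g x * indicator {e} x \<partial>\<pi>) + (\<integral>\<^sup>+y. ?g y \<partial>\<pi>) = (\<integral>\<^sup>+x. g x * indicator {e} x + ?g x \<partial>\<pi>)"
    by (rule nn_integral_add[symmetric]) auto
  also have "\<dots> = (\<integral>\<^sup>+x. g x \<partial>\<pi>)"
    by (intro nn_integral_cong) (auto simp: indicator_def)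
  finally show ?case .
qed

lemma last_path_in_support:
  assumes "stationary_distribution K \<pi>" "x \<in> set_pmf \<pi>"
  shows "l \<in> set_pmf (path_pmf K x n) \<Longrightarrow> last l \<in> set_pmf \<pi>"
proof (induction n arbitrary: l)
  case 0
  then show ?case using assms(2) by simp
next
  case (Suc n)
  then obtain m y where m: "m \<in> set_pmf (path_pmf K x n)" "y \<in> set_pmf (K (last m))" "l = m @ [y]"
    by auto
  have "y \<in> set_pmf (bind_pmf \<pi> K)" using m Suc.IH[OF m(1)] by auto
  then have "y \<in> set_pmf \<pi>" using assms(1) by (simp only: stationary_distribution_def)
  then show ?case using m by simp
qed

text \<open>The support of a stationary law is closed under transitions. If it missed
  \<open>e\<close>, a chain started in it would almost surely never visit \<open>e\<close>, against
  irreducibility.\<close>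

lemma stationary_pmf_pos:
  fixes K :: "'e::countable \<Rightarrow> 'e pmf"
  assumes irr: "irreducible_chain K" and stat: "stationary_distribution K \<pi>"
  shows "0 < pmf \<pi> e"
proof -
  obtain x where x: "x \<in> set_pmf \<pi>" using set_pmf_not_empty[of \<pi>] by blast
  have "e \<in> set_pmf \<pi>"
  proof (rule ccontr)
    assume e: "e \<notin> set_pmf \<pi>"
    have "AE \<omega> in markov_measure K x. \<omega> n \<noteq> e" for n
    proof -
      have "AE l in measure_pmf (path_pmf K x n). last l \<noteq> e"
        using last_path_in_support[OF stat x] e by (intro AE_pmfI) blast
      then have "AE l in distr (markov_measure K x) (count_space UNIV) (\<lambda>\<omega>. map \<omega> [0..<Suc n]). last l \<noteq> e"
        unfolding distr_markov_segment .
      then have "AE \<omega> in markov_measure K x. last (map \<omega> [0..<Suc n]) \<noteq> e"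
        by (rule AE_distrD[rotated]) (simp only: measurable_markov_measure measurable_segment)
      then show ?thesis by simp
    qed
    then have "AE \<omega> in markov_measure K x. \<forall>n. \<omega> n \<noteq> e" unfolding AE_all_countable by blast
    then have "AE \<omega> in markov_measure K x. \<not> return_time e \<omega> < \<infinity>"
      by eventually_elim (simp only: return_time_finite_iff simp_thms not_False_eq_True)
    from emeasure_eq_0_AE[OF this] have "measure (markov_measure K x) {\<omega>. return_time e \<omega> < \<infinity>} = 0"
      unfolding measure_def space_markov_measure by (simp only: UNIV_I simp_thms) simp
    moreover have "measure (markov_measure K x) {\<omega>. return_time e \<omega> < \<infinity>} > 0"
      using irr unfolding irreducible_chain_def by blast
    ultimately show False by linarith
  qed
  then show ?thesis by (rule pmf_positive)
qed

lemma sum_list_map_segment: "sum_list (map f (map \<omega> [0..<n])) = (\<Sum>j<n. f (\<omega> j) :: real)"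
  by (induction n) simp_all

context
  fixes K :: "'e::countable \<Rightarrow> 'e pmf" and e :: 'e
  assumes rec: "recurrent_chain K"
begin

text \<open>Before the first return time a segment has not come back to \<open>e\<close>, so the
  taboo indicators are 1 there and the sum over the excursion is a partial sum of the series
  \<open>?H\<close>.\<close>

lemma nn_integral_excursion_le:
  fixes f :: "'e \<Rightarrow> real"
  assumes f: "\<And>x. 0 \<le> f x"
  shows "(\<integral>\<^sup>+l. ennreal (sum_list (map f l)) \<partial>excursion_law K e) \<le>
    (\<Sum>j. taboo_integral K e (\<lambda>x. ennreal (f x)) j)"
proof -
  let ?P = "markov_measure K e"
  let ?h = "\<lambda>l. ennreal (f (last l)) * indicator {l. e \<notin> set (tl l)} l"
  let ?H = "\<lambda>j \<omega>. ?h (map \<omega> [0..<Suc j])"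
  have seg: "(\<lambda>\<omega>. map \<omega> [0..<Suc j]) \<in> measurable ?P (count_space UNIV)" for j
    by (simp only: measurable_markov_measure measurable_segment)
  have H: "?H j \<in> borel_measurable ?P" for j
    by (rule measurable_compose[OF seg]) simp
  have "(\<integral>\<^sup>+l. ennreal (sum_list (map f l)) \<partial>excursion_law K e) =
      (\<integral>\<^sup>+\<omega>. ennreal (sum_list (map f (excursion e \<omega> 0))) \<partial>?P)"
    unfolding excursion_law_def by (rule nn_integral_distr[OF measurable_excursion_markov(1)]) simp
  also have "\<dots> \<le> (\<integral>\<^sup>+\<omega>. (\<Sum>j. ?H j \<omega>) \<partial>?P)"
  proof (rule nn_integral_mono_AE)
    show "AE \<omega> in ?P. ennreal (sum_list (map f (excursion e \<omega> 0))) \<le> (\<Sum>j. ?H j \<omega>)"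
      using AE_returns[OF rec]
    proof eventually_elim
      fix \<omega> :: "nat \<Rightarrow> 'e" assume ret: "\<exists>n\<ge>1. \<omega> n = e"
      have H: "?H j \<omega> = ennreal (f (\<omega> j))" if j: "j < rt e \<omega>" for j
      proof -
        have "e \<notin> \<omega> ` {1..<Suc j}"
        proof
          assume "e \<in> \<omega> ` {1..<Suc j}"
          then obtain i where "1 \<le> i" "i < rt e \<omega>" "\<omega> i = e" using j by auto
          then show False using rt_finite(3)[OF ret] by blast
        qed
        moreover have "tl (map \<omega> [0..<Suc j]) = map \<omega> [1..<Suc j]"
          by (simp add: upt_conv_Cons del: upt_Suc)
        moreover have "last (map \<omega> [0..<Suc j]) = \<omega> j" by simp
        ultimately show ?thesis by (simp del: upt_Suc)
      qed
      have "ennreal (sum_list (map f (excursion e \<omega> 0))) = (\<Sum>j<rt e \<omega>. ennreal (f (\<omega> j)))"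
        unfolding excursion_0 sum_list_map_segment by (simp add: f)
      also have "\<dots> = (\<Sum>j<rt e \<omega>. ?H j \<omega>)" by (intro sum.cong refl) (simp only: H lessThan_iff)
      also have "\<dots> \<le> (\<Sum>j. ?H j \<omega>)" by (rule sum_le_suminf) auto
      finally show "ennreal (sum_list (map f (excursion e \<omega> 0))) \<le> (\<Sum>j. ?H j \<omega>)" .
    qed
  qed
  also have "\<dots> = (\<Sum>j. \<integral>\<^sup>+\<omega>. ?H j \<omega> \<partial>?P)" by (rule nn_integral_suminf[OF H])
  also have "\<dots> = (\<Sum>j. taboo_integral K e (\<lambda>x. ennreal (f x)) j)"
  proof (rule suminf_cong)
    fix j
    have "(\<integral>\<^sup>+\<omega>. ?H j \<omega> \<partial>?P) = (\<integral>\<^sup>+l. ?h l \<partial>distr ?P (count_space UNIV) (\<lambda>\<omega>. map \<omega> [0..<Suc j]))"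
      by (rule nn_integral_distr[OF seg, symmetric]) simp
    then show "(\<integral>\<^sup>+\<omega>. ?H j \<omega> \<partial>?P) = taboo_integral K e (\<lambda>x. ennreal (f x)) j"
      unfolding distr_markov_segment taboo_integral_def .
  qed
  finally show ?thesis .
qed

text \<open>Kac's inequality divided by the positive mass \<open>pmf \<pi> e\<close> bounds all
  partial sums of the taboo series at once.\<close>

lemma integrable_excursion_sum:
  assumes irr: "irreducible_chain K" and stat: "stationary_distribution K \<pi>"
    and f: "\<And>x. 0 \<le> f x" and fin: "(\<integral>\<^sup>+x. ennreal (f x) \<partial>\<pi>) < \<infinity>"
  shows "integrable (excursion_law K e) (\<lambda>l. sum_list (map f l))"
proof (rule integrableI_nonneg)
  show "(\<lambda>l. sum_list (map f l)) \<in> borel_measurable (excursion_law K e)"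
    unfolding excursion_law_def by simp
  show "AE l in excursion_law K e. 0 \<le> sum_list (map f l)"
    using f by (intro AE_I2 sum_list_nonneg) auto
  let ?p = "pmf \<pi> e" and ?I = "\<integral>\<^sup>+x. ennreal (f x) \<partial>\<pi>" and ?t = "taboo_integral K e (\<lambda>x. ennreal (f x))"
  have p: "0 < ?p" by (rule stationary_pmf_pos[OF irr stat])
  have "(\<Sum>j<n. ?t j) \<le> ennreal (1 / ?p) * ?I" for n
  proof -
    have "(\<Sum>j<n. ?t j) \<le> (\<Sum>j\<le>n. ?t j)" by (intro sum_mono2) auto
    also have "\<dots> = ennreal (1 / ?p) * (ennreal ?p * (\<Sum>j\<le>n. ?t j))"
      using p by (simp add: mult.assoc[symmetric] ennreal_mult[symmetric])
    also have "\<dots> \<le> ennreal (1 / ?p) * ?I"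
      by (intro mult_left_mono kac_inequality[OF stat]) simp
    finally show ?thesis .
  qed
  then have "(\<Sum>j. ?t j) \<le> ennreal (1 / ?p) * ?I" by (intro suminf_le_const) auto
  also have "\<dots> < \<infinity>" using fin by (simp add: ennreal_mult_less_top)
  finally show "(\<integral>\<^sup>+l. ennreal (sum_list (map f l)) \<partial>excursion_law K e) < \<infinity>"
    using nn_integral_excursion_le[of f] f le_less_trans by blast
qed

end

lemma nn_integral_pmf_finite_of_summable:
  fixes f :: "'e \<Rightarrow> real"
  assumes "(\<lambda>x. f x * pmf \<pi> x) summable_on UNIV" "\<And>x. 0 \<le> f x"
  shows "(\<integral>\<^sup>+x. ennreal (f x) \<partial>\<pi>) < \<infinity>"
proof -
  have "Infinite_Set_Sum.abs_summable_on (\<lambda>x. f x * pmf \<pi> x) UNIV"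
    by (rule abs_summable_equivalent[THEN iffD1, OF summable_on_iff_abs_summable_on_real[THEN iffD1, OF assms(1)]])
  then have "integrable (count_space UNIV) (\<lambda>x. f x * pmf \<pi> x)"
    unfolding Infinite_Set_Sum.abs_summable_on_def .
  then have "(\<integral>\<^sup>+x. ennreal (f x * pmf \<pi> x) \<partial>count_space UNIV) < \<infinity>"
    using assms(2) by (simp add: integrable_iff_bounded)
  then show ?thesis
    by (simp add: nn_integral_measure_pmf ennreal_mult assms(2) mult.commute)
qed

section \<open>Growth along subsequences\<close>

text \<open>Replaces the lower limit by an eventual linear lower bound, the form in which
  subsequences can be handled. The index 0, where division gives 0 by convention, drops out
  eventually.\<close>

lemma liminf_pos_iff:
  "liminf (\<lambda>n. ereal (1 / real n * a n)) > 0 \<longleftrightarrow>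
    (\<exists>\<delta>>0. eventually (\<lambda>n. \<delta> * real n \<le> a n) sequentially)"
proof
  assume "liminf (\<lambda>n. ereal (1 / real n * a n)) > 0"
  then obtain \<delta> where \<delta>: "0 < ereal \<delta>" "ereal \<delta> < liminf (\<lambda>n. ereal (1 / real n * a n))"
    using ereal_dense2 by blast
  from less_LiminfD[OF \<delta>(2)] eventually_gt_at_top[of 0]
  have "eventually (\<lambda>n. \<delta> * real n \<le> a n) sequentially"
    by eventually_elim (simp add: field_simps)
  then show "\<exists>\<delta>>0. eventually (\<lambda>n. \<delta> * real n \<le> a n) sequentially" using \<delta>(1) by auto
next
  assume "\<exists>\<delta>>0. eventually (\<lambda>n. \<delta> * real n \<le> a n) sequentially"
  then obtain \<delta> where \<delta>: "\<delta> > 0" "eventually (\<lambda>n. \<delta> * real n \<le> a n) sequentially" by blast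
  from \<delta>(2) eventually_gt_at_top[of 0]
  have "eventually (\<lambda>n. ereal \<delta> \<le> ereal (1 / real n * a n)) sequentially"
    by eventually_elim (simp add: field_simps)
  then have "ereal \<delta> \<le> liminf (\<lambda>n. ereal (1 / real n * a n))" by (rule Liminf_bounded)
  then show "liminf (\<lambda>n. ereal (1 / real n * a n)) > 0"
    using \<delta>(1) by (metis ereal_less(2) less_le_trans)
qed

lemma liminf_pos_subsequence:
  assumes "liminf (\<lambda>n. ereal (1 / real n * a n)) > 0" "\<And>n. n \<le> t n"
  shows "liminf (\<lambda>n. ereal (1 / real n * a (t n))) > 0"
proof -
  obtain \<delta> N where \<delta>: "\<delta> > 0" "\<And>n. n \<ge> N \<Longrightarrow> \<delta> * real n \<le> a n"
    using assms(1) unfolding liminf_pos_iff eventually_sequentially by blast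
  have "\<delta> * real n \<le> a (t n)" if "n \<ge> N" for n
  proof -
    have "\<delta> * real n \<le> \<delta> * real (t n)" using \<delta>(1) assms(2)[of n] by simp
    also have "\<dots> \<le> a (t n)" using \<delta>(2)[of "t n"] that assms(2)[of n] by simp
    finally show ?thesis .
  qed
  then show ?thesis unfolding liminf_pos_iff eventually_sequentially using \<delta>(1) by blast
qed

text \<open>For n in the m-th block, \<open>a n\<close> falls below \<delta> m by at most D + y m.
  Allowing m \<delta> / 4 for the constant and m \<delta> / 2 for \<open>y\<close> leaves m \<delta>
  / 4, and n \<le> 2 l m turns this into the rate \<delta> / (8 l).\<close>

lemma liminf_pos_interpolate:
  fixes a y :: "nat \<Rightarrow> real" and t :: "nat \<Rightarrow> nat"
  assumes t0: "t 0 = 0" and mono: "\<And>m. t m < t (Suc m)" and lin: "\<And>m. real (t m) \<le> l * real m" and l: "l > 0"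
    and lim: "liminf (\<lambda>m. ereal (1 / real m * a (t m))) > 0"
    and lower: "\<And>m n. t m \<le> n \<Longrightarrow> n \<le> t (Suc m) \<Longrightarrow> a (t m) - D - y m \<le> a n"
    and y: "\<And>\<epsilon>. \<epsilon> > 0 \<Longrightarrow> eventually (\<lambda>m. y m \<le> \<epsilon> * real (Suc m)) sequentially"
  shows "liminf (\<lambda>n. ereal (1 / real n * a n)) > 0"
proof -
  obtain \<delta> where \<delta>: "\<delta> > 0" "eventually (\<lambda>m. \<delta> * real m \<le> a (t m)) sequentially"
    using lim unfolding liminf_pos_iff by blast
  have "eventually (\<lambda>m. real m \<ge> 4 * D / \<delta>) sequentially"
    by (rule filterlim_at_top[THEN iffD1, rule_format, OF filterlim_real_sequentially])
  moreover have "eventually (\<lambda>m. y m \<le> \<delta> / 4 * real (Suc m)) sequentially"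
    by (rule y) (use \<delta>(1) in simp)
  \<comment> \<open>The condition \<open>1 \<le> m\<close> bounds \<open>Suc m\<close> by 2 m, so
    that the quarter granted to \<open>y\<close> here becomes a half in terms of m.\<close>
  ultimately have "eventually (\<lambda>m. \<delta> * real m \<le> a (t m) \<and> y m \<le> \<delta> / 4 * real (Suc m) \<and> 4 * D / \<delta> \<le> real m \<and> 1 \<le> m) sequentially"
    by (intro eventually_conj \<delta>(2) eventually_ge_at_top)
  then obtain M where M: "\<And>m. m \<ge> M \<Longrightarrow>
      \<delta> * real m \<le> a (t m) \<and> y m \<le> \<delta> / 4 * real (Suc m) \<and> 4 * D / \<delta> \<le> real m \<and> 1 \<le> m"
    unfolding eventually_sequentially by blast
  have sm: "strict_mono t" using mono by (simp add: strict_mono_Suc_iff)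
  have "\<delta> / (8 * l) * real n \<le> a n" if n: "n \<ge> t M" for n
  proof -
    have ex: "\<exists>m. n < t (Suc m)"
      using strict_mono_imp_increasing[OF sm, of "Suc n"] by (intro exI[of _ n]) (simp only: Suc_le_eq)
    define m where "m = (LEAST m. n < t (Suc m))"
    have m1: "n < t (Suc m)" unfolding m_def by (rule LeastI_ex[OF ex])
    have m0: "t m \<le> n"
    proof (cases m)
      case 0
      then show ?thesis using t0 by simp
    next
      case (Suc j)
      then have "\<not> n < t (Suc j)" using not_less_Least[of j "\<lambda>m. n < t (Suc m)"] unfolding m_def by simp
      then show ?thesis using Suc by simp
    qed
    have "M \<le> m"
    proof (rule ccontr)
      assume "\<not> M \<le> m"
      then have "t (Suc m) \<le> t M" using sm by (simp add: strict_mono_less_eq)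
      then show False using m1 n by simp
    qed
    note Mm = M[OF this]
    have "real (Suc m) \<le> 2 * real m" using Mm by simp
    then have "\<delta> / 4 * real (Suc m) \<le> \<delta> / 4 * (2 * real m)" using \<delta>(1) by (intro mult_left_mono) auto
    then have ym: "y m \<le> \<delta> / 2 * real m" using Mm by simp
    have D: "D \<le> \<delta> / 4 * real m" using Mm \<delta>(1) by (simp add: field_simps)
    have "real n \<le> l * real (Suc m)" using lin[of "Suc m"] m1 by linarith
    also have "\<dots> \<le> l * (2 * real m)" using \<open>real (Suc m) \<le> 2 * real m\<close> l by (intro mult_left_mono) auto
    finally have "\<delta> / (8 * l) * real n \<le> \<delta> / (8 * l) * (l * (2 * real m))"
      using \<delta>(1) l by (intro mult_left_mono) auto
    also have "\<dots> = \<delta> / 4 * real m" using l by simp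
    also have "\<dots> \<le> a n" using lower[OF m0] m1 ym D Mm by (simp add: field_simps)
    finally show ?thesis .
  qed
  then show ?thesis
    unfolding liminf_pos_iff eventually_sequentially using \<delta>(1) l
    by (intro exI[of _ "\<delta> / (8 * l)"]) auto
qed

section \<open>The renewal measure\<close>

lemma measurable_PiM_coordinate: "(\<lambda>x. x i) \<in> measurable (PiM UNIV (\<lambda>_. N)) N"
  by simp

lemma distr_PiM_componentwise:
  assumes q: "prob_space q" and h: "h \<in> measurable q N"
  shows "distr (PiM UNIV (\<lambda>_::nat. q)) (PiM UNIV (\<lambda>_. N)) (\<lambda>x i. h (x i)) = PiM UNIV (\<lambda>_. distr q N h)"
proof (rule measure_eqI_PiM_infinite[symmetric])
  have m: "(\<lambda>x i. h (x i)) \<in> measurable (PiM UNIV (\<lambda>_::nat. q)) (PiM UNIV (\<lambda>_. N))"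
  proof (rule measurable_PiM_single')
    show "(\<lambda>x. h (x i)) \<in> measurable (PiM UNIV (\<lambda>_::nat. q)) N" for i
      by (rule measurable_compose[OF measurable_PiM_coordinate h])
    show "(\<lambda>x i. h (x i)) \<in> space (PiM UNIV (\<lambda>_::nat. q)) \<rightarrow> UNIV \<rightarrow>\<^sub>E space N"
      using measurable_space[OF h] by (auto simp: space_PiM PiE_iff)
  qed
  show s: "sets (PiM UNIV (\<lambda>_::nat. distr q N h)) = sets (PiM UNIV (\<lambda>_. N))"
    by (rule sets_PiM_cong) auto
  have pd: "prob_space (distr q N h)" by (rule prob_space.prob_space_distr[OF q h])
  interpret D: prob_space "PiM UNIV (\<lambda>_::nat. distr q N h)" by (rule prob_space_PiM[OF pd])
  show "finite_measure (PiM UNIV (\<lambda>_::nat. distr q N h))" by unfold_locales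
  fix A :: "nat \<Rightarrow> _ set" and J :: "nat set"
  assume J: "finite J" and A: "\<And>i. i \<in> J \<Longrightarrow> A i \<in> sets N"
  let ?E = "prod_emb UNIV (\<lambda>_. N) J (PiE J A)"
  have "?E = prod_emb UNIV (\<lambda>_. distr q N h) J (PiE J A)" by (simp add: prod_emb_def)
  then have "emeasure (PiM UNIV (\<lambda>_. distr q N h)) ?E = (\<Prod>i\<in>J. emeasure (distr q N h) (A i))"
    by (simp only:) (rule emeasure_PiM_emb, use pd J A in auto)
  also have "\<dots> = (\<Prod>i\<in>J. emeasure q (h -` A i \<inter> space q))"
    by (intro prod.cong refl emeasure_distr h A)
  also have "\<dots> = emeasure (PiM UNIV (\<lambda>_. q)) (prod_emb UNIV (\<lambda>_. q) J (PiE J (\<lambda>i. h -` A i \<inter> space q)))"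
    by (rule emeasure_PiM_emb[symmetric]) (simp_all add: q J measurable_sets[OF h A])
  also have "prod_emb UNIV (\<lambda>_. q) J (PiE J (\<lambda>i. h -` A i \<inter> space q)) =
      (\<lambda>x i. h (x i)) -` ?E \<inter> space (PiM UNIV (\<lambda>_. q))"
    using measurable_space[OF h] by (auto simp: prod_emb_def space_PiM PiE_iff)
  also have "emeasure (PiM UNIV (\<lambda>_. q)) \<dots> = emeasure (distr (PiM UNIV (\<lambda>_::nat. q)) (PiM UNIV (\<lambda>_. N)) (\<lambda>x i. h (x i))) ?E"
    by (rule emeasure_distr[symmetric, OF m sets_PiM_I]) (use J A in auto)
  finally show "emeasure (PiM UNIV (\<lambda>_. distr q N h)) ?E =
      emeasure (distr (PiM UNIV (\<lambda>_::nat. q)) (PiM UNIV (\<lambda>_. N)) (\<lambda>x i. h (x i))) ?E" .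
qed simp

section \<open>Borel sets of G and products over excursions\<close>

lemma space_borel_of: "space (borel_of T) = topspace T"
  by (simp add: borel_of_def space_measure_of_conv)

lemma openin_borel_of: "openin T U \<Longrightarrow> U \<in> sets (borel_of T)"
proof -
  assume "openin T U"
  have "{U. openin T U} \<subseteq> Pow (topspace T)" using openin_subset by blast
  then show ?thesis unfolding borel_of_def using \<open>openin T U\<close> by (simp add: sets_measure_of)
qed

lemma countable_borel_of:
  assumes "Hausdorff_space T" "countable S" "S \<subseteq> topspace T"
  shows "S \<in> sets (borel_of T)"
proof -
  have "{x} \<in> sets (borel_of T)" if "x \<in> S" for x
  proof -
    have "closedin T {x}" using assms that by (auto intro: closedin_Hausdorff_singleton)
    then have "topspace T - {x} \<in> sets (borel_of T)" by (intro openin_borel_of) (simp add: closedin_def)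
    then have "space (borel_of T) - (topspace T - {x}) \<in> sets (borel_of T)" by (rule sets.compl_sets)
    moreover have "space (borel_of T) - (topspace T - {x}) = {x}"
      using assms that by (auto simp: space_borel_of)
    ultimately show ?thesis by simp
  qed
  then have "(\<Union>x\<in>S. {x}) \<in> sets (borel_of T)" using assms(2) by (intro sets.countable_UN') auto
  then show ?thesis by simp
qed

lemma left_prod_cong: "(\<And>i. i < n \<Longrightarrow> b i = b' i) \<Longrightarrow> left_prod G b n = left_prod G b' n"
  by (induction n) auto

definition list_prod :: "'g monoid \<Rightarrow> ('e \<Rightarrow> 'g) \<Rightarrow> 'e list \<Rightarrow> 'g" where
  "list_prod G c l = left_prod G (\<lambda>i. c (l ! i)) (length l)"

lemma list_prod_excursion:
  "list_prod G c (excursion e \<omega> m) =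
    left_prod G (\<lambda>i. c (\<omega> (visit e \<omega> m + i))) (rt e (\<lambda>i. \<omega> (visit e \<omega> m + i)))"
  unfolding list_prod_def excursion_def by (auto intro!: left_prod_cong)

context lie_group
begin

context
  fixes c :: "'e::countable \<Rightarrow> 'g"
  assumes c: "\<And>x. c x \<in> carrier G"
begin

lemma list_prod_closed: "list_prod G c l \<in> carrier G"
  unfolding list_prod_def by (rule left_prod_closed) (rule c)

lemma left_prod_excursions:
  "left_prod G (\<lambda>m. list_prod G c (excursion e \<omega> m)) n = left_prod G (\<lambda>i. c (\<omega> i)) (visit e \<omega> n)"
proof (induction n)
  case (Suc n)
  show ?case
    unfolding left_prod.simps visit.simps Suc.IH
    by (subst left_prod_add) (simp_all add: c list_prod_excursion)
qed simp

lemma measurable_list_prod: "list_prod G c \<in> measurable (excursion_law K e) (borel_of T)"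
  using list_prod_closed
  by (auto simp: measurable_def sets_excursion_law space_borel_of topspace_eq)

lemma renewal_measure_eq:
  "renewal_measure G T c K e = distr (excursion_law K e) (borel_of T) (list_prod G c)"
proof -
  have "list_prod G c \<in> measurable (count_space UNIV) (borel_of T)"
    using list_prod_closed by (auto simp: space_borel_of topspace_eq)
  from distr_distr[OF this measurable_excursion_markov(1)]
  have "distr (excursion_law K e) (borel_of T) (list_prod G c) =
      distr (markov_measure K e) (borel_of T) (list_prod G c \<circ> (\<lambda>\<omega>. excursion e \<omega> 0))"
    unfolding excursion_law_def .
  also have "list_prod G c \<circ> (\<lambda>\<omega>. excursion e \<omega> 0) =
      (\<lambda>\<omega>. left_prod G (\<lambda>n. c (\<omega> n)) (the_enat (return_time e \<omega>)))"
    by (auto simp: fun_eq_iff list_prod_excursion rt_def)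
  finally show ?thesis by (simp add: renewal_measure_def)
qed

text \<open>The Borel structure of \<open>T\<close> need not be countably generated, so measurability of \<open>P\<close> is
  only required after pulling back to the countable set of excursions. The values of
  \<open>list_prod\<close> form a countable, hence measurable, set of full renewal measure.\<close>

lemma AE_renewal_iff:
  assumes P: "{x \<in> space seq_space. P (\<lambda>i. list_prod G c (x i))} \<in> sets seq_space"
  shows "(AE b in PiM UNIV (\<lambda>_::nat. renewal_measure G T c K e). P b) \<longleftrightarrow>
    (AE x in PiM UNIV (\<lambda>_::nat. excursion_law K e). P (\<lambda>i. list_prod G c (x i)))"
proof -
  let ?h = "list_prod G c" and ?q = "excursion_law K e" and ?N = "borel_of T"
  let ?Q = "PiM UNIV (\<lambda>_::nat. ?q)" and ?B = "PiM UNIV (\<lambda>_::nat. ?N)"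
  have eq: "PiM UNIV (\<lambda>_::nat. renewal_measure G T c K e) = distr ?Q ?B (\<lambda>x i. ?h (x i))"
    unfolding renewal_measure_eq
    by (rule distr_PiM_componentwise[OF prob_space_excursion_law measurable_list_prod, symmetric])
  have hm: "(\<lambda>x i. ?h (x i)) \<in> measurable ?Q ?B"
  proof (rule measurable_PiM_single')
    show "(\<lambda>x. ?h (x i)) \<in> measurable ?Q ?N" for i
      by (rule measurable_compose[OF measurable_PiM_coordinate measurable_list_prod])
    show "(\<lambda>x i. ?h (x i)) \<in> space ?Q \<rightarrow> UNIV \<rightarrow>\<^sub>E space ?N"
      using list_prod_closed by (auto simp: space_borel_of topspace_eq PiE_iff)
  qed
  \<comment> \<open>A right inverse of \<open>list_prod\<close> on its countable range. With one
    fixed word off the range, every preimage is a countable set, possibly united with the complement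
    of the range.\<close>
  define r where "r g = (if g \<in> range ?h then inv_into UNIV ?h g else [])" for g
  have hr: "?h (r g) = g" if "g \<in> range ?h" for g
    using that by (simp add: r_def f_inv_into_f)
  have S: "S \<in> sets ?N" if "S \<subseteq> range ?h" for S
  proof (rule countable_borel_of[OF Hausdorff])
    show "countable S" using that by (rule countable_subset) auto
    show "S \<subseteq> topspace T" using that list_prod_closed by (auto simp: topspace_eq)
  qed
  have r: "r \<in> measurable ?N (count_space UNIV)"
  proof (rule measurableI)
    fix X :: "'e list set"
    have "r -` X \<inter> space ?N = (r -` X \<inter> range ?h) \<union> (if [] \<in> X then space ?N - range ?h else {})"
      using list_prod_closed by (auto simp: r_def space_borel_of topspace_eq split: if_splits)
    also have "\<dots> \<in> sets ?N" 
    proof (rule sets.Un)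
      show "r -` X \<inter> range ?h \<in> sets ?N" by (rule S) (rule Int_lower2)
      have "space ?N - range ?h \<in> sets ?N" by (rule sets.compl_sets) (rule S[OF order_refl])
      then show "(if [] \<in> X then space ?N - range ?h else {}) \<in> sets ?N" by (simp only: sets.empty_sets split: if_split) simp
    qed
    finally show "r -` X \<inter> space ?N \<in> sets ?N" .
  qed simp
  have rm: "(\<lambda>b i. r (b i)) \<in> measurable ?B seq_space"
    by (rule measurable_PiM_single', rule measurable_compose[OF measurable_PiM_coordinate r]) simp
  \<comment> \<open>A measurable event that implies \<open>P\<close> and agrees with it on all
    sequences of products of words.\<close>
  define P' where "P' b \<longleftrightarrow> (\<forall>i. b i \<in> range ?h) \<and> P (\<lambda>i. ?h (r (b i)))" for b
  have "{b \<in> space ?B. P' b} = (\<Inter>i. (\<lambda>b. b i) -` range ?h \<inter> space ?B) \<inter>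
      ((\<lambda>b i. r (b i)) -` {x \<in> space seq_space. P (\<lambda>i. ?h (x i))} \<inter> space ?B)"
    by (auto simp: P'_def space_PiM)
  also have "\<dots> \<in> sets ?B"
  proof (rule sets.Int)
    have "(\<lambda>b. b i) -` range ?h \<inter> space ?B \<in> sets ?B" for i
      by (rule measurable_sets[OF measurable_PiM_coordinate S[OF order_refl]])
    then show "(\<Inter>i. (\<lambda>b. b i) -` range ?h \<inter> space ?B) \<in> sets ?B"
      by (intro sets.countable_INT image_subsetI UNIV_not_empty)
  qed (rule measurable_sets[OF rm P])
  finally have P'm: "{b \<in> space ?B. P' b} \<in> sets ?B" .
  have P'_imp: "P b" if "P' b" for b
  proof -
    have "(\<lambda>i. ?h (r (b i))) = b" using that by (auto simp: P'_def hr)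
    then show ?thesis using that by (simp only: P'_def)
  qed
  show ?thesis
  proof
    assume "AE b in PiM UNIV (\<lambda>_::nat. renewal_measure G T c K e). P b"
    then show "AE x in ?Q. P (\<lambda>i. ?h (x i))" unfolding eq by (rule AE_distrD[OF hm])
  next
    \<comment> \<open>Passing to the image measure calls for a measurable event, so the statement
      travels with \<open>P'\<close>.\<close>
    assume "AE x in ?Q. P (\<lambda>i. ?h (x i))"
    then have "AE x in ?Q. P' (\<lambda>i. ?h (x i))"
      by eventually_elim (simp add: P'_def hr)
    then have "AE b in distr ?Q ?B (\<lambda>x i. ?h (x i)). P' b" by (simp only: AE_distr_iff[OF hm P'm])
    then show "AE b in PiM UNIV (\<lambda>_::nat. renewal_measure G T c K e). P b"
      unfolding eq by eventually_elim (rule P'_imp)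
  qed
qed

text \<open>At stage \<open>n\<close> the product depends on the first \<open>n\<close> words, which
  range over a countable set; this gives measurability whatever the dependence on the group
  element.\<close>

lemma growth_rate_sets:
  "{x \<in> space seq_space. growth_rate G ch nrm k v (\<lambda>i. list_prod G c (x i)) > 0} \<in>
    sets (seq_space :: (nat \<Rightarrow> 'e list) measure)"
proof -
  have "(\<lambda>x::nat \<Rightarrow> 'e list. ereal (1 / real n * ln (nrm k (ext_map k (Ad G ch (left_prod G (\<lambda>i. list_prod G c (x i)) n)) v))))
      \<in> borel_measurable seq_space" for n
  proof (rule measurable_of_segment[where n = n and
        h = "\<lambda>xs. ereal (1 / real n * ln (nrm k (ext_map k (Ad G ch (left_prod G (\<lambda>i. list_prod G c (xs ! i)) n)) v)))"])
    fix x :: "nat \<Rightarrow> 'e list"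
    have "left_prod G (\<lambda>i. list_prod G c (x i)) n = left_prod G (\<lambda>i. list_prod G c (map x [0..<n] ! i)) n"
      by (rule left_prod_cong) simp
    then show "ereal (1 / real n * ln (nrm k (ext_map k (Ad G ch (left_prod G (\<lambda>i. list_prod G c (x i)) n)) v))) =
        ereal (1 / real n * ln (nrm k (ext_map k (Ad G ch (left_prod G (\<lambda>i. list_prod G c (map x [0..<n] ! i)) n)) v)))"
      by (simp only:)
  qed simp
  then have "(\<lambda>x::nat \<Rightarrow> 'e list. growth_rate G ch nrm k v (\<lambda>i. list_prod G c (x i))) \<in> borel_measurable seq_space"
    unfolding growth_rate_def by (rule borel_measurable_liminf)
  then show ?thesis by measurable
qed

lemma AE_renewal_growth_iff:
  assumes rec: "recurrent_chain K"
  shows "(AE b in PiM UNIV (\<lambda>_::nat. renewal_measure G T c K e). growth_rate G ch nrm k v b > 0) \<longleftrightarrow>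
    (AE \<omega> in markov_measure K e. growth_rate G ch nrm k v (\<lambda>m. list_prod G c (excursion e \<omega> m)) > 0)"
  unfolding AE_renewal_iff[OF growth_rate_sets] excursions_iid[OF rec, symmetric]
  by (rule AE_distr_iff[OF measurable_excursion_markov(2) growth_rate_sets])

section \<open>Transfer of growth between the chain and its renewal walk\<close>

lemma renewal_growth_if_chain_growth:
  assumes rec: "recurrent_chain K"
    and growth: "AE \<omega> in markov_measure K e. growth_rate G ch nrm k v (\<lambda>n. c (\<omega> n)) > 0"
  shows "AE b in PiM UNIV (\<lambda>_::nat. renewal_measure G T c K e). growth_rate G ch nrm k v b > 0"
  unfolding AE_renewal_growth_iff[OF rec]
  using growth AE_excursion_loops[OF rec]
proof eventually_elim
  fix \<omega> assume g: "growth_rate G ch nrm k v (\<lambda>n. c (\<omega> n)) > 0" and loops: "\<forall>m. is_loop e (excursion e \<omega> m)"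
  have "n \<le> visit e \<omega> n" for n
  proof -
    have "(\<Sum>i<n. 1) \<le> (\<Sum>i<n. length (excursion e \<omega> i))"
      using loops by (intro sum_mono) (auto simp: is_loop_def Suc_le_eq)
    then show ?thesis by (simp add: visit_eq_sum_length)
  qed
  from liminf_pos_subsequence[OF g[unfolded growth_rate_def] this]
  show "growth_rate G ch nrm k v (\<lambda>m. list_prod G c (excursion e \<omega> m)) > 0"
    unfolding growth_rate_def left_prod_excursions .
qed

text \<open>Log-norms are compared between a time and the last visit before it: the partial product
  in between is undone by its inverse, at a cost of at most \<open>ln C\<close> plus
  \<open>k\<close> times the sum of \<open>s\<close> along it.\<close>

lemma chain_growth_if_renewal_growth:
  fixes nrm :: "nat \<Rightarrow> 'b multivector \<Rightarrow> real"
  assumes U: "(U, \<phi>) \<in> A" "\<one> \<in> U"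
    and nrm: "ext_norm k (nrm k)" and nontriv: "\<exists>v::'b. v \<noteq> 0" and k: "1 \<le> k"
    and irr: "irreducible_chain K" and rec: "recurrent_chain K"
    and stat: "stationary_distribution K \<pi>" and moment: "finite_first_moment G (U, \<phi>) c \<pi>"
    and v: "v \<in> pure_wedges k"
    and growth: "AE b in PiM UNIV (\<lambda>_::nat. renewal_measure G T c K e). growth_rate G (U, \<phi>) nrm k v b > 0"
  shows "AE \<omega> in markov_measure K e. growth_rate G (U, \<phi>) nrm k v (\<lambda>n. c (\<omega> n)) > 0"
proof -
  let ?Ad = "Ad G (U, \<phi>)" and ?q = "excursion_law K e"
  obtain w where w: "v = wedge k w" "wedge k w \<noteq> (\<lambda>_. 0)" using v by (auto simp: pure_wedges_def)
  obtain C where C: "C > 0"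
      "\<And>L u. bounded_linear L \<Longrightarrow> nrm k (ext_map k L (wedge k u)) \<le> C * onorm L ^ k * nrm k (wedge k u)"
    using ext_map_norm_bound[OF nrm finite_dimensional] by blast
  define s where "s x = ln (Ad_size G (U, \<phi>) (c x))" for x
  have s: "s x \<ge> 0" for x using Ad_size_ge_1[OF U c nontriv] by (simp add: s_def)
  let ?u = "\<lambda>g i. ?Ad g (w i)"
  have lin: "linear (?Ad g)" if "g \<in> carrier G" for g
    using bounded_linear_Ad[OF U that] by (rule bounded_linear.linear)
  have ext_v: "ext_map k (?Ad g) v = wedge k (?u g)" if "g \<in> carrier G" for g
    unfolding w by (rule ext_map_wedge[OF lin[OF that]])
  have step: "nrm k (wedge k (?u p)) \<le> C * onorm (?Ad (inv g)) ^ k * nrm k (wedge k (?u (g \<otimes> p)))"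
    if g: "g \<in> carrier G" and p: "p \<in> carrier G" for g p
  proof -
    have g': "inv g \<in> carrier G" using g by simp
    have "ext_map k (?Ad (inv g)) (wedge k (?u (g \<otimes> p))) = wedge k (?u p)"
      using g p by (simp add: ext_map_wedge[OF lin[OF g']] Ad_mult[OF U] Ad_inv_left[OF U])
    then show ?thesis using C(2)[OF bounded_linear_Ad[OF U g'], of "?u (g \<otimes> p)"] by simp
  qed
  \<comment> \<open>Undoing \<open>g\<close> leads back to the nonzero wedge of \<open>w\<close>, so
    no norm vanishes and the logarithms are meaningful.\<close>
  have pos: "nrm k (wedge k (?u g)) > 0" if g: "g \<in> carrier G" for g
  proof -
    have nn: "nrm k (wedge k u) \<ge> 0" for u by (rule ext_norm_nonneg[OF nrm wedge_in_ext_power])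
    have "nrm k (wedge k w) \<noteq> 0" using ext_norm_eq_0_iff[OF nrm wedge_in_ext_power] w(2) by blast
    then have "nrm k (wedge k (?u \<one>)) > 0" using nn[of w] by (simp add: Ad_one[OF U])
    moreover have "nrm k (wedge k (?u \<one>)) \<le> C * onorm (?Ad (inv g)) ^ k * nrm k (wedge k (?u g))"
      using step[OF g one_closed] g by simp
    ultimately have "nrm k (wedge k (?u g)) \<noteq> 0" by auto
    with nn[of "?u g"] show ?thesis by simp
  qed
  have growth_eq: "growth_rate G (U, \<phi>) nrm k v b =
      liminf (\<lambda>n. ereal (1 / real n * ln (nrm k (wedge k (?u (left_prod G b n))))))"
    if "\<And>i. b i \<in> carrier G" for b
    unfolding growth_rate_def using ext_v left_prod_closed that by simp
  \<comment> \<open>The summand 1 lets one function serve twice: the sum of \<open>f\<close> over an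
    excursion dominates both its length and its sum of \<open>s\<close>.\<close>
  define f where "f x = 1 + s x" for x
  have f: "f x \<ge> 0" "f x \<ge> 1" for x using s[of x] by (auto simp: f_def)
  have "(\<lambda>x. s x * pmf \<pi> x) summable_on UNIV"
    using moment by (simp add: finite_first_moment_def s_def)
  from nn_integral_pmf_finite_of_summable[OF this s]
  have "(\<integral>\<^sup>+x. ennreal (s x) \<partial>\<pi>) < \<infinity>" .
  moreover have "(\<integral>\<^sup>+x. ennreal (f x) \<partial>\<pi>) = 1 + (\<integral>\<^sup>+x. ennreal (s x) \<partial>\<pi>)"
    using s by (simp add: f_def nn_integral_add)
  ultimately have fin: "(\<integral>\<^sup>+x. ennreal (f x) \<partial>\<pi>) < \<infinity>" by simp
  let ?F = "\<lambda>l. sum_list (map f l)"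
  have F: "?F l \<ge> 0" for l using f(1) by (intro sum_list_nonneg) auto
  have IF: "integrable ?q ?F" by (rule integrable_excursion_sum[OF rec irr stat f(1) fin])
  have "AE x in PiM UNIV (\<lambda>_::nat. ?q). (\<exists>l>0. \<forall>m. (\<Sum>i<m. ?F (x i)) \<le> l * real m) \<and>
      (\<forall>\<epsilon>>0. eventually (\<lambda>n. ?F (x n) \<le> \<epsilon> * real (Suc n)) sequentially)"
    using prob_space.AE_iid_sum_linear_bound[OF prob_space_excursion_law IF F]
      prob_space.AE_iid_sublinear[OF prob_space_excursion_law IF F]
    by eventually_elim blast
  then have "AE \<omega> in markov_measure K e.
      (\<exists>l>0. \<forall>m. (\<Sum>i<m. ?F (excursion e \<omega> i)) \<le> l * real m) \<and>
      (\<forall>\<epsilon>>0. eventually (\<lambda>n. ?F (excursion e \<omega> n) \<le> \<epsilon> * real (Suc n)) sequentially)"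
    unfolding excursions_iid[OF rec, symmetric] by (rule AE_distrD[OF measurable_excursion_markov(2)])
  then show ?thesis
    using AE_excursion_loops[OF rec] growth[unfolded AE_renewal_growth_iff[OF rec]]
  proof eventually_elim
    fix \<omega> :: "nat \<Rightarrow> 'e"
    assume iid: "(\<exists>l>0. \<forall>m. (\<Sum>i<m. ?F (excursion e \<omega> i)) \<le> l * real m) \<and>
        (\<forall>\<epsilon>>0. eventually (\<lambda>n. ?F (excursion e \<omega> n) \<le> \<epsilon> * real (Suc n)) sequentially)"
      and loops: "\<forall>m. is_loop e (excursion e \<omega> m)"
      and gr: "growth_rate G (U, \<phi>) nrm k v (\<lambda>m. list_prod G c (excursion e \<omega> m)) > 0"
    obtain l where l: "l > 0" "\<And>m. (\<Sum>i<m. ?F (excursion e \<omega> i)) \<le> l * real m" using iid by blast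
    define t where "t = visit e \<omega>"
    define p where "p n = left_prod G (\<lambda>i. c (\<omega> i)) n" for n
    define a where "a n = ln (nrm k (wedge k (?u (p n))))" for n
    have pc: "p n \<in> carrier G" for n unfolding p_def by (rule left_prod_closed) (rule c)
    have tS: "t (Suc m) = t m + length (excursion e \<omega> m)" for m
      by (simp add: t_def visit_eq_sum_length)
    have "liminf (\<lambda>n. ereal (1 / real n * a n)) > 0"
    proof (rule liminf_pos_interpolate)
      show "t 0 = 0" by (simp add: t_def)
      show "t m < t (Suc m)" for m using loops tS[of m] by (auto simp: is_loop_def)
      show "real (t m) \<le> l * real m" for m
      proof -
        have "real (length xs) \<le> ?F xs" for xs
          using f(2) by (induction xs) (auto simp: add_mono)
        then have "real (t m) \<le> (\<Sum>i<m. ?F (excursion e \<omega> i))"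
          by (simp add: t_def visit_eq_sum_length sum_mono)
        with l(2)[of m] show ?thesis by linarith
      qed
      show "l > 0" by fact
      show "liminf (\<lambda>m. ereal (1 / real m * a (t m))) > 0"
        using gr unfolding growth_eq[OF list_prod_closed] left_prod_excursions by (simp add: a_def t_def p_def)
      show "eventually (\<lambda>m. real k * ?F (excursion e \<omega> m) \<le> \<epsilon> * real (Suc m)) sequentially" if "\<epsilon> > 0" for \<epsilon>
      proof -
        have "\<epsilon> / real k > 0" using that k by simp
        then have "eventually (\<lambda>m. ?F (excursion e \<omega> m) \<le> \<epsilon> / real k * real (Suc m)) sequentially"
          using iid by blast
        then show ?thesis by (rule eventually_mono) (use k in \<open>simp add: field_simps\<close>)
      qed
      show "a (t m) - ln C - real k * ?F (excursion e \<omega> m) \<le> a n" if n: "t m \<le> n" "n \<le> t (Suc m)" for m n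
      proof -
        define j where "j = n - t m"
        have j: "n = t m + j" "j \<le> length (excursion e \<omega> m)" using n tS[of m] by (auto simp: j_def)
        define g where "g = left_prod G (\<lambda>i. c (\<omega> (t m + i))) j"
        have g: "g \<in> carrier G" unfolding g_def by (rule left_prod_closed) (rule c)
        have pn: "p n = g \<otimes> p (t m)" unfolding p_def g_def j(1) by (rule left_prod_add) (rule c)
        \<comment> \<open>A partial excursion is completed to a whole one, at no harm because
          \<open>f\<close> is nonnegative.\<close>
        have "(\<Sum>i<j. s (\<omega> (t m + i))) \<le> (\<Sum>i<length (excursion e \<omega> m). f (\<omega> (t m + i)))"
        proof -
          have "(\<Sum>i<j. s (\<omega> (t m + i))) \<le> (\<Sum>i<j. f (\<omega> (t m + i)))" by (intro sum_mono) (simp add: f_def)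
          also have "\<dots> \<le> (\<Sum>i<length (excursion e \<omega> m). f (\<omega> (t m + i)))"
            using j(2) f(1) by (intro sum_mono2) auto
          finally show ?thesis .
        qed
        also have "\<dots> = ?F (excursion e \<omega> m)"
        proof -
          have "excursion e \<omega> m = map (\<lambda>i. \<omega> (t m + i)) [0..<length (excursion e \<omega> m)]"
            by (rule nth_equalityI) (auto simp: excursion_def t_def)
          then show ?thesis by (metis sum_list_map_segment)
        qed
        finally have S: "(\<Sum>i<j. s (\<omega> (t m + i))) \<le> ?F (excursion e \<omega> m)" .
        have "onorm (?Ad (inv g)) \<le> exp (\<Sum>i<j. s (\<omega> (t m + i)))"
          unfolding g_def s_def by (rule onorm_Ad_inv_left_prod_le[OF U c nontriv])
        also have "\<dots> \<le> exp (?F (excursion e \<omega> m))" using S by simp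
        finally have "onorm (?Ad (inv g)) ^ k \<le> exp (?F (excursion e \<omega> m)) ^ k"
          by (intro power_mono onorm_pos_le bounded_linear_Ad[OF U] inv_closed g)
        also have "\<dots> = exp (real k * ?F (excursion e \<omega> m))" by (simp add: exp_of_nat_mult)
        finally have "C * onorm (?Ad (inv g)) ^ k * nrm k (wedge k (?u (p n))) \<le>
            C * exp (real k * ?F (excursion e \<omega> m)) * nrm k (wedge k (?u (p n)))"
          using C(1) pos[OF pc[of n]] by (intro mult_right_mono mult_left_mono) auto
        with step[OF g pc[of "t m"]]
        have "nrm k (wedge k (?u (p (t m)))) \<le> C * exp (real k * ?F (excursion e \<omega> m)) * nrm k (wedge k (?u (p n)))"
          unfolding pn by linarith
        then have "a (t m) \<le> ln (C * exp (real k * ?F (excursion e \<omega> m)) * nrm k (wedge k (?u (p n))))"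
          unfolding a_def using pos[OF pc[of "t m"]] by (intro ln_mono) auto
        also have "\<dots> = ln C + real k * ?F (excursion e \<omega> m) + a n"
          unfolding a_def using C(1) pos[OF pc[of n]] by (simp add: ln_mult)
        finally show ?thesis by simp
      qed
    qed
    then show "growth_rate G (U, \<phi>) nrm k v (\<lambda>n. c (\<omega> n)) > 0"
      unfolding growth_eq[OF c] by (simp add: a_def p_def)
  qed
qed

end

end

lemma nontrivial_if_dim_pos:
  assumes "0 < dim (UNIV :: 'b::real_vector set)"
  shows "\<exists>v::'b. v \<noteq> 0"
proof (rule ccontr)
  assume "\<not> (\<exists>v::'b. v \<noteq> 0)"
  then have "(UNIV :: 'b set) = {0}" by auto
  then have "dim (UNIV :: 'b set) = card ({} :: 'b set)"
    by (intro dim_eq_card) (auto simp: independent_empty)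
  then show False using assms by simp
qed

theorem lemma3p15:
  fixes G :: "'g monoid" and T :: "'g topology"
    and A :: "('g, 'b::real_normed_vector) chart set"
    and U :: "'g set" and \<phi> :: "'g \<Rightarrow> 'b"
    and nrm :: "nat \<Rightarrow> 'b multivector \<Rightarrow> real"
    and c :: "'e::countable \<Rightarrow> 'g" and K :: "'e \<Rightarrow> 'e pmf" and e :: 'e
  assumes "lie_group G T A"
    and "(U, \<phi>) \<in> A" and "\<one>\<^bsub>G\<^esub> \<in> U"
    and "\<And>k. ext_norm k (nrm k)"
    and "\<And>e'. c e' \<in> carrier G"
    and "irreducible_chain K" and "recurrent_chain K"
  shows "(expanding_from G (U, \<phi>) nrm c K e \<longrightarrow>
            unif_expanding_on_grassmannians G (U, \<phi>) nrm (renewal_measure G T c K e)) \<and>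
         (\<forall>\<pi>. positive_recurrent_chain K \<and> stationary_distribution K \<pi> \<and>
               finite_first_moment G (U, \<phi>) c \<pi> \<longrightarrow>
            (expanding_from G (U, \<phi>) nrm c K e \<longleftrightarrow>
             unif_expanding_on_grassmannians G (U, \<phi>) nrm (renewal_measure G T c K e)))"
proof -
  interpret lie_group G T A by fact
  have forward: "unif_expanding_on_grassmannians G (U, \<phi>) nrm (renewal_measure G T c K e)"
    if "expanding_from G (U, \<phi>) nrm c K e"
    using that renewal_growth_if_chain_growth[of c, OF assms(5,7)]
    unfolding expanding_from_def unif_expanding_on_grassmannians_def by blast
  have backward: "expanding_from G (U, \<phi>) nrm c K e"
    if \<pi>: "stationary_distribution K \<pi>" "finite_first_moment G (U, \<phi>) c \<pi>"
      and unif: "unif_expanding_on_grassmannians G (U, \<phi>) nrm (renewal_measure G T c K e)" for \<pi>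
    unfolding expanding_from_def
  proof (intro ballI)
    fix k and v :: "'b multivector"
    assume k: "k \<in> {1..dim (UNIV :: 'b set) - 1}" and v: "v \<in> pure_wedges k"
    \<comment> \<open>A \<open>k\<close> in this range forces a positive dimension.\<close>
    then have nontriv: "\<exists>v::'b. v \<noteq> 0" by (intro nontrivial_if_dim_pos) auto
    have k1: "1 \<le> k" using k by simp
    have growth: "AE b in PiM UNIV (\<lambda>_::nat. renewal_measure G T c K e). growth_rate G (U, \<phi>) nrm k v b > 0"
      using unif k v unfolding unif_expanding_on_grassmannians_def by blast
    show "AE \<omega> in markov_measure K e. growth_rate G (U, \<phi>) nrm k v (\<lambda>n. c (\<omega> n)) > 0"
      by (rule chain_growth_if_renewal_growth[where nrm = nrm, OF assms(5,2,3) assms(4)[of k] nontriv k1 assms(6,7) \<pi> v growth])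
  qed
  show ?thesis using forward backward by blast
qed

end
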